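(* Let $X_n$, $n\ge1$, be a sequence of real random variables that is centered, L-weakly dependent with coefficients $\gamma_k$, $k\ge 1$, and strictly stationary, with $\mathbb{E}|X_1|^{4+\delta}<\infty$ for some $\delta>0$. Let $S_n=X_1+\cdots+X_n$ and assume that $\frac1n\mathbb{E}S_n^2\to\sigma^2$ as $n\to\infty$ for some $\sigma^2\in(0,\infty)$. Assume that the coefficients $\gamma_k$ are decreasing in $k$ and satisfy $\gamma_k=O(k^{-2-8/\delta})$. Define $$\xi_n(t)=\frac{1}{\sqrt n}\sum_{j=1}^{\lfloor nt\rfloor}X_j,\qquad 0\le t\le1 .$$ Then $\xi_n$ converges in distribution, as $n\to\infty$, to $\sigma W$ in the Skorohod space $\mathbb{D}[0,1]$, where $W$ is a standard Brownian motion on $[0,1]$.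
   Context: L-weak dependence: real random variables $X_n$, $n\ge1$, are L-weakly dependent with nonnegative coefficients $\gamma_k$, $k\ge1$, if $\sum_{k\ge1}\gamma_k<\infty$ and for all disjoint finite subsets $I,J\subset\{1,2,\ldots\}$ and all real valued Lipschitz functions $f:\mathbb{R}^I\to\mathbb{R}$, $g:\mathbb{R}^J\to\mathbb{R}$, the covariance below is well defined and $$|\mathrm{Cov}(f(X_i,i\in I),g(X_j,j\in J))|\le \|f\|_L\|g\|_L\sum_{i\in I}\sum_{j\in J}\gamma_{|j-i|},$$ where $\|f\|_L=\sup_{x\neq y}\frac{|f(x)-f(y)|}{|x-y|}$ and $|x-y|=\sum_i|x_i-y_i|$ is the $\ell^1$ distance. *)

theory Defs
  imports "HOL-Probability.Probability"
begin

section \<open>The Skorohod space on the unit interval\<close>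

definition cadlag :: "(real \<Rightarrow> real) \<Rightarrow> bool" where
  "cadlag x \<longleftrightarrow>
     (\<forall>t\<in>{0..<1}. (x \<longlongrightarrow> x t) (at_right t)) \<and>
     (\<forall>t\<in>{0<..1}. \<exists>l. (x \<longlongrightarrow> l) (at_left t))"

definition time_changes :: "(real \<Rightarrow> real) set" where
  "time_changes =
     {\<tau>. strict_mono_on {0..1} \<tau> \<and> continuous_on {0..1} \<tau> \<and> \<tau> ` {0..1} = {0..1}}"

definition skorohod_bounds :: "(real \<Rightarrow> real) \<Rightarrow> (real \<Rightarrow> real) \<Rightarrow> real set" where
  "skorohod_bounds x y =
     {e. \<exists>\<tau>\<in>time_changes. \<forall>t\<in>{0..1}. \<bar>\<tau> t - t\<bar> \<le> e \<and> \<bar>x t - y (\<tau> t)\<bar> \<le> e}"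

lemma time_change_in: "\<tau> \<in> time_changes \<Longrightarrow> t \<in> {0..1} \<Longrightarrow> \<tau> t \<in> {0..1}"
  by (auto simp: time_changes_def)

lemma id_time_change: "(\<lambda>t. t) \<in> time_changes"
  by (auto simp: time_changes_def strict_mono_on_def)

lemma time_change_compose:
  assumes "\<tau> \<in> time_changes" "\<rho> \<in> time_changes"
  shows "\<rho> \<circ> \<tau> \<in> time_changes"
proof -
  have im: "\<tau> ` {0..1} = {0..1}" "\<rho> ` {0..1} = {0..1}"
    using assms by (auto simp: time_changes_def)
  have "(\<rho> \<circ> \<tau>) ` {0..1} = {0..1}"
    by (simp only: image_comp [symmetric] im)
  moreover have "strict_mono_on {0..1} (\<rho> \<circ> \<tau>)"
  proof (rule strict_mono_onI)
    fix r s :: real assume rs: "r \<in> {0..1}" "s \<in> {0..1}" "r < s"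
    then have "\<tau> r < \<tau> s"
      using assms(1) by (auto simp: time_changes_def strict_mono_on_def)
    then show "(\<rho> \<circ> \<tau>) r < (\<rho> \<circ> \<tau>) s"
      using assms time_change_in [OF assms(1) rs(1)] time_change_in [OF assms(1) rs(2)]
      by (simp add: time_changes_def strict_mono_on_def)
  qed
  moreover have "continuous_on {0..1} (\<rho> \<circ> \<tau>)"
    using assms im by (intro continuous_on_compose) (auto simp: time_changes_def)
  ultimately show ?thesis
    by (simp add: time_changes_def)
qed

lemma time_change_inverse:
  assumes "\<tau> \<in> time_changes"
  obtains \<rho> where "\<rho> \<in> time_changes"
    "\<And>t. t \<in> {0..1} \<Longrightarrow> \<tau> (\<rho> t) = t" "\<And>t. t \<in> {0..1} \<Longrightarrow> \<rho> (\<tau> t) = t"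
proof -
  have sm: "strict_mono_on {0..1} \<tau>" and c: "continuous_on {0..1} \<tau>" and im: "\<tau> ` {0..1} = {0..1}"
    using assms by (auto simp: time_changes_def)
  have inj: "inj_on \<tau> {0..1}"
    by (rule strict_mono_on_imp_inj_on [OF sm])
  define \<rho> where "\<rho> = the_inv_into {0..1} \<tau>"
  have l: "\<rho> (\<tau> t) = t" if "t \<in> {0..1}" for t
    using that inj by (simp add: \<rho>_def the_inv_into_f_f)
  have r: "\<tau> (\<rho> t) = t" if "t \<in> {0..1}" for t
    using that inj im by (simp add: \<rho>_def f_the_inv_into_f)
  have im': "\<rho> ` {0..1} = {0..1}"
    using the_inv_into_onto [OF inj] im by (simp add: \<rho>_def)
  have "continuous_on (\<tau> ` {0..1}) \<rho>"
    by (rule continuous_on_inv [OF c]) (auto simp: l)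
  then have c': "continuous_on {0..1} \<rho>"
    by (simp add: im)
  have "strict_mono_on {0..1} \<rho>"
  proof (rule strict_mono_onI)
    fix u v :: real assume uv: "u \<in> {0..1}" "v \<in> {0..1}" "u < v"
    then have in01: "\<rho> u \<in> {0..1}" "\<rho> v \<in> {0..1}"
      using im' by blast+
    show "\<rho> u < \<rho> v"
    proof (rule ccontr)
      assume "\<not> \<rho> u < \<rho> v"
      then have "\<tau> (\<rho> v) \<le> \<tau> (\<rho> u)"
        using in01 sm by (cases "\<rho> v = \<rho> u") (auto simp: strict_mono_on_def intro: less_imp_le)
      then show False
        using uv r by simp
    qed
  qed
  with c' im' have "\<rho> \<in> time_changes"
    by (simp add: time_changes_def)
  then show ?thesis
    using that l r by blast
qed

lemma time_change_1:
  assumes "\<tau> \<in> time_changes"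
  shows "\<tau> 1 = 1"
proof -
  have sm: "strict_mono_on {0..1} \<tau>" and im: "\<tau> ` {0..1} = {0..1}"
    using assms by (auto simp: time_changes_def)
  have "1 \<in> \<tau> ` {0..1}"
    using im by simp
  then obtain t where t: "t \<in> {0..1}" "\<tau> t = 1"
    by auto
  have "\<tau> 1 \<le> 1"
    using time_change_in [OF assms, of 1] by simp
  moreover have "\<tau> t < \<tau> 1" if "t \<noteq> 1"
    using that t(1) sm by (auto simp: strict_mono_on_def)
  ultimately show ?thesis
    using t by fastforce
qed

lemma skorohod_bounds_nonneg: "e \<in> skorohod_bounds x y \<Longrightarrow> 0 \<le> e"
  by (fastforce simp: skorohod_bounds_def)

lemma bdd_below_skorohod_bounds: "bdd_below (skorohod_bounds x y)"
  using skorohod_bounds_nonneg by (rule bdd_belowI)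

lemma skorohod_bounds_subset: "skorohod_bounds x y \<subseteq> skorohod_bounds y x"
proof
  fix e assume "e \<in> skorohod_bounds x y"
  then obtain \<tau> where \<tau>: "\<tau> \<in> time_changes"
    "\<And>t. t \<in> {0..1} \<Longrightarrow> \<bar>\<tau> t - t\<bar> \<le> e \<and> \<bar>x t - y (\<tau> t)\<bar> \<le> e"
    by (auto simp: skorohod_bounds_def)
  obtain \<rho> where \<rho>: "\<rho> \<in> time_changes" "\<And>t. t \<in> {0..1} \<Longrightarrow> \<tau> (\<rho> t) = t"
    using time_change_inverse [OF \<tau>(1)] by metis
  have "\<bar>\<rho> t - t\<bar> \<le> e \<and> \<bar>y t - x (\<rho> t)\<bar> \<le> e" if "t \<in> {0..1}" for t
    using \<tau>(2) [OF time_change_in [OF \<rho>(1) that]] \<rho>(2) [OF that] by (auto simp: abs_minus_commute)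
  with \<rho>(1) show "e \<in> skorohod_bounds y x"
    unfolding skorohod_bounds_def by blast
qed

lemma skorohod_bounds_sym: "skorohod_bounds x y = skorohod_bounds y x"
  using skorohod_bounds_subset by blast

lemma skorohod_bounds_add:
  assumes "d \<in> skorohod_bounds x z" "e \<in> skorohod_bounds z y"
  shows "d + e \<in> skorohod_bounds x y"
proof -
  obtain \<tau> where \<tau>: "\<tau> \<in> time_changes"
    "\<And>t. t \<in> {0..1} \<Longrightarrow> \<bar>\<tau> t - t\<bar> \<le> d \<and> \<bar>x t - z (\<tau> t)\<bar> \<le> d"
    using assms(1) by (auto simp: skorohod_bounds_def)
  obtain \<rho> where \<rho>: "\<rho> \<in> time_changes"
    "\<And>t. t \<in> {0..1} \<Longrightarrow> \<bar>\<rho> t - t\<bar> \<le> e \<and> \<bar>z t - y (\<rho> t)\<bar> \<le> e"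
    using assms(2) by (auto simp: skorohod_bounds_def)
  have "\<bar>(\<rho> \<circ> \<tau>) t - t\<bar> \<le> d + e \<and> \<bar>x t - y ((\<rho> \<circ> \<tau>) t)\<bar> \<le> d + e" if "t \<in> {0..1}" for t
    using \<tau>(2) [OF that] \<rho>(2) [OF time_change_in [OF \<tau>(1) that]] unfolding o_def by linarith
  then show ?thesis
    using time_change_compose [OF \<tau>(1) \<rho>(1)] unfolding skorohod_bounds_def by blast
qed

lemma cadlag_bounded:
  assumes "cadlag x"
  shows "\<exists>B. \<forall>t\<in>{0..1}. \<bar>x t\<bar> \<le> B"
proof -
  have "\<exists>B. \<forall>t\<in>{0..1} \<inter> {0..1}. \<bar>x t\<bar> \<le> B"
  proof (rule Bolzano [where P = "\<lambda>a b. \<exists>B. \<forall>t\<in>{a..b} \<inter> {0..1}. \<bar>x t\<bar> \<le> B" and a = "0::real" and b = 1])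
    fix a b c :: real
    assume "\<exists>B. \<forall>t\<in>{a..b} \<inter> {0..1}. \<bar>x t\<bar> \<le> B" "\<exists>B. \<forall>t\<in>{b..c} \<inter> {0..1}. \<bar>x t\<bar> \<le> B"
    then obtain B C where "\<forall>t\<in>{a..b} \<inter> {0..1}. \<bar>x t\<bar> \<le> B" "\<forall>t\<in>{b..c} \<inter> {0..1}. \<bar>x t\<bar> \<le> C"
      by blast
    then have "\<forall>t\<in>{a..c} \<inter> {0..1}. \<bar>x t\<bar> \<le> max B C"
      by (metis IntE IntI atLeastAtMost_iff le_max_iff_disj linorder_le_cases)
    then show "\<exists>B. \<forall>t\<in>{a..c} \<inter> {0..1}. \<bar>x t\<bar> \<le> B"
      by blast
  next
    fix s :: real assume s: "0 \<le> s" "s \<le> 1"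
    have R: "\<exists>d>0. \<exists>B. \<forall>t\<in>{0..1}. s < t \<and> t < s + d \<longrightarrow> \<bar>x t\<bar> \<le> B"
    proof (cases "s < 1")
      case True
      then have "(x \<longlongrightarrow> x s) (at_right s)"
        using assms s by (simp add: cadlag_def)
      then have "eventually (\<lambda>t. dist (x t) (x s) < 1) (at_right s)"
        by (rule tendstoD) simp
      then obtain b where "s < b" "\<And>t. s < t \<Longrightarrow> t < b \<Longrightarrow> dist (x t) (x s) < 1"
        unfolding eventually_at_right_field by blast
      then show ?thesis
        by (intro exI [of _ "b - s"] conjI exI [of _ "\<bar>x s\<bar> + 1"]) (fastforce simp: dist_real_def)+
    next
      case False
      with s show ?thesis
        by (intro exI [of _ 1]) auto
    qed
    have L: "\<exists>d>0. \<exists>B. \<forall>t\<in>{0..1}. s - d < t \<and> t < s \<longrightarrow> \<bar>x t\<bar> \<le> B"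
    proof (cases "0 < s")
      case True
      then obtain l where "(x \<longlongrightarrow> l) (at_left s)"
        using assms s by (meson cadlag_def greaterThanAtMost_iff)
      then have "eventually (\<lambda>t. dist (x t) l < 1) (at_left s)"
        by (rule tendstoD) simp
      then obtain b where "b < s" "\<And>t. b < t \<Longrightarrow> t < s \<Longrightarrow> dist (x t) l < 1"
        unfolding eventually_at_left_field by blast
      then show ?thesis
        by (intro exI [of _ "s - b"] conjI exI [of _ "\<bar>l\<bar> + 1"]) (fastforce simp: dist_real_def)+
    next
      case False
      with s show ?thesis
        by (intro exI [of _ 1]) auto
    qed
    from R L obtain d B d' B' where d: "d > 0" "d' > 0"
      and B: "\<And>t. t \<in> {0..1} \<Longrightarrow> s < t \<Longrightarrow> t < s + d \<Longrightarrow> \<bar>x t\<bar> \<le> B"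
      and B': "\<And>t. t \<in> {0..1} \<Longrightarrow> s - d' < t \<Longrightarrow> t < s \<Longrightarrow> \<bar>x t\<bar> \<le> B'"
      by blast
    show "\<exists>d>0. \<forall>a b. a \<le> s \<and> s \<le> b \<and> b - a < d \<longrightarrow> (\<exists>B. \<forall>t\<in>{a..b} \<inter> {0..1}. \<bar>x t\<bar> \<le> B)"
    proof (rule exI [of _ "min d d'"], rule conjI)
      show "0 < min d d'"
        using d by simp
      have "\<exists>B. \<forall>t\<in>{a..b} \<inter> {0..1}. \<bar>x t\<bar> \<le> B"
        if ab: "a \<le> s \<and> s \<le> b \<and> b - a < min d d'" for a b
      proof (intro exI [of _ "max \<bar>x s\<bar> (max B B')"] ballI)
        fix t assume t: "t \<in> {a..b} \<inter> {0..1}"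
        consider "t = s" | "s < t" | "t < s"
          by linarith
        then show "\<bar>x t\<bar> \<le> max \<bar>x s\<bar> (max B B')"
        proof cases
          case 2
          then show ?thesis
            using B [of t] t ab by auto
        next
          case 3
          then show ?thesis
            using B' [of t] t ab by auto
        qed simp
      qed
      then show "\<forall>a b. a \<le> s \<and> s \<le> b \<and> b - a < min d d' \<longrightarrow>
          (\<exists>B. \<forall>t\<in>{a..b} \<inter> {0..1}. \<bar>x t\<bar> \<le> B)"
        by blast
    qed
  qed simp
  then show ?thesis
    by simp
qed

lemma skorohod_bounds_nonempty:
  assumes "cadlag x" "cadlag y"
  shows "skorohod_bounds x y \<noteq> {}"
proof -
  obtain B C where B: "\<And>t. t \<in> {0..1} \<Longrightarrow> \<bar>x t\<bar> \<le> B" and C: "\<And>t. t \<in> {0..1} \<Longrightarrow> \<bar>y t\<bar> \<le> C"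
    using cadlag_bounded assms by metis
  have "\<bar>x t - y t\<bar> \<le> B + C" if "t \<in> {0..1}" for t
    using B [OF that] C [OF that] by linarith
  moreover have "0 \<le> B + C"
    using B [of 0] C [of 0] by auto
  ultimately have "\<forall>t\<in>{0..1}. \<bar>t - t\<bar> \<le> B + C \<and> \<bar>x t - y t\<bar> \<le> B + C"
    by simp
  then have "B + C \<in> skorohod_bounds x y"
    unfolding skorohod_bounds_def by (intro CollectI bexI [OF _ id_time_change])
  then show ?thesis
    by blast
qed

lemma skorohod_bounds_separated:
  assumes "cadlag x" "cadlag y" and small: "\<And>e. 0 < e \<Longrightarrow> \<exists>d\<in>skorohod_bounds x y. d < e"
    and t: "t \<in> {0..1}"
  shows "x t = y t"
proof -
  have close: "\<exists>s\<in>{0..1}. \<bar>s - u\<bar> < e \<and> \<bar>x u - y s\<bar> < e \<and> (u = 1 \<longrightarrow> s = 1)"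
    if e: "0 < e" and u: "u \<in> {0..1}" for e u
  proof -
    obtain d where d: "d \<in> skorohod_bounds x y" "d < e"
      using small [OF e] by blast
    obtain \<tau> where \<tau>: "\<tau> \<in> time_changes" "\<bar>\<tau> u - u\<bar> \<le> d" "\<bar>x u - y (\<tau> u)\<bar> \<le> d"
      using d(1) u by (auto simp: skorohod_bounds_def)
    show ?thesis
      using time_change_in [OF \<tau>(1) u] time_change_1 [OF \<tau>(1)] \<tau>(2,3) d(2)
      by (intro bexI [of _ "\<tau> u"]) auto
  qed
  have "\<bar>x t - y t\<bar> \<le> 0 + e" if "0 < e" for e
  proof (cases "t = 1")
    case True
    then show ?thesis
      using close [OF that, of 1] by auto
  next
    case False
    then have t1: "0 \<le> t" "t < 1"
      using t by auto
    have "(x \<longlongrightarrow> x t) (at_right t)" "(y \<longlongrightarrow> y t) (at_right t)"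
      using assms(1,2) t1 by (auto simp: cadlag_def)
    then have "eventually (\<lambda>u. dist (x u) (x t) < e / 3) (at_right t)"
      "eventually (\<lambda>u. dist (y u) (y t) < e / 3) (at_right t)"
      using that by (simp_all only: tendstoD divide_pos_pos zero_less_numeral)
    then have "eventually (\<lambda>u. dist (x u) (x t) < e / 3 \<and> dist (y u) (y t) < e / 3) (at_right t)"
      by (rule eventually_conj)
    then obtain b where b: "t < b"
      "\<And>u. t < u \<Longrightarrow> u < b \<Longrightarrow> dist (x u) (x t) < e / 3 \<and> dist (y u) (y t) < e / 3"
      unfolding eventually_at_right_field by blast
    define h where "h = min (b - t) (1 - t) / 2"
    have h: "0 < h" "t + 2 * h \<le> b" "t + 2 * h \<le> 1"
      using b(1) t1 by (auto simp: h_def min_def field_simps)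
    have "0 < min (e / 3) h" "t + h \<in> {0..1}"
      using that h t1 by auto
    from close [OF this] obtain s where s: "\<bar>s - (t + h)\<bar> < h" "\<bar>x (t + h) - y s\<bar> < e / 3"
      by auto
    have "\<bar>x (t + h) - x t\<bar> < e / 3"
      using b(2) [of "t + h"] h by (simp add: dist_real_def)
    moreover have "\<bar>y s - y t\<bar> < e / 3"
      using b(2) [of s] h s(1) by (simp add: dist_real_def abs_less_iff)
    ultimately show ?thesis
      using s(2) by linarith
  qed
  then have "\<bar>x t - y t\<bar> \<le> 0"
    by (rule field_le_epsilon)
  then show ?thesis
    by simp
qed

text \<open>
  Elements are functions on \<open>[0,1]\<close>, represented as total functions whose values outside
  \<open>[0,1]\<close> are \<^const>\<open>undefined\<close>.
\<close>

typedef skorohod = "{x. cadlag x \<and> x \<in> extensional {0..1}}"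
proof
  show "restrict (\<lambda>_. 0) {0..1} \<in> {x. cadlag x \<and> x \<in> extensional {0..1}}"
  proof -
    have "(restrict (\<lambda>_. 0::real) {0..1} \<longlongrightarrow> 0) (at_right t)" if "t \<in> {0..<1}" for t :: real
      by (rule tendsto_eventually, unfold eventually_at_right_field)
         (use that in \<open>auto intro!: exI [of _ 1]\<close>)
    moreover have "(restrict (\<lambda>_. 0::real) {0..1} \<longlongrightarrow> 0) (at_left t)" if "t \<in> {0<..1}" for t :: real
      by (rule tendsto_eventually, unfold eventually_at_left_field)
         (use that in \<open>auto intro!: exI [of _ 0]\<close>)
    ultimately show ?thesis
      by (fastforce simp: cadlag_def)
  qed
qed

text \<open>
  The metric is \<open>d(x,y) = inf\<^sub>\<tau> max (sup\<^sub>t \<bar>\<tau> t - t\<bar>) (sup\<^sub>t \<bar>x t - y (\<tau> t)\<bar>)\<close>; it induces the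
  Skorohod (J1) topology.
\<close>

instantiation skorohod :: metric_space
begin

definition dist_skorohod :: "skorohod \<Rightarrow> skorohod \<Rightarrow> real" where
  "dist_skorohod x y = Inf (skorohod_bounds (Rep_skorohod x) (Rep_skorohod y))"

definition uniformity_skorohod :: "(skorohod \<times> skorohod) filter" where
  "uniformity_skorohod = (INF e\<in>{0 <..}. principal {(x, y). dist x y < e})"

definition open_skorohod :: "skorohod set \<Rightarrow> bool" where
  "open_skorohod U \<longleftrightarrow> (\<forall>x\<in>U. eventually (\<lambda>(x', y). x' = x \<longrightarrow> y \<in> U) uniformity)"

instance
proof
  show "(uniformity :: (skorohod \<times> skorohod) filter) = (INF e\<in>{0 <..}. principal {(x, y). dist x y < e})"
    by (rule uniformity_skorohod_def)
next
  fix U :: "skorohod set"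
  show "open U \<longleftrightarrow> (\<forall>x\<in>U. eventually (\<lambda>(x', y). x' = x \<longrightarrow> y \<in> U) uniformity)"
    by (rule open_skorohod_def)
next
  have cl: "cadlag (Rep_skorohod x)" for x
    using Rep_skorohod by simp
  have ext: "Rep_skorohod x \<in> extensional {0..1}" for x
    using Rep_skorohod by simp
  have ne: "skorohod_bounds (Rep_skorohod x) (Rep_skorohod y) \<noteq> {}" for x y
    by (intro skorohod_bounds_nonempty cl)
  {
    fix x y :: skorohod
    show "dist x y = 0 \<longleftrightarrow> x = y"
    proof
      assume "dist x y = 0"
      then have "\<exists>d\<in>skorohod_bounds (Rep_skorohod x) (Rep_skorohod y). d < e" if "0 < e" for e
        using that cInf_lessD [OF ne] by (metis dist_skorohod_def)
      then have "Rep_skorohod x t = Rep_skorohod y t" if "t \<in> {0..1}" for t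
        using that by (intro skorohod_bounds_separated [OF cl cl])
      then have "Rep_skorohod x = Rep_skorohod y"
        by (intro extensionalityI [OF ext ext])
      then show "x = y"
        by (simp add: Rep_skorohod_inject)
    next
      assume "x = y"
      then have "0 \<in> skorohod_bounds (Rep_skorohod x) (Rep_skorohod y)"
        using id_time_change unfolding skorohod_bounds_def by fastforce
      then have "dist x y \<le> 0"
        unfolding dist_skorohod_def by (rule cInf_lower [OF _ bdd_below_skorohod_bounds])
      moreover have "0 \<le> dist x y"
        unfolding dist_skorohod_def by (intro cInf_greatest [OF ne] skorohod_bounds_nonneg)
      ultimately show "dist x y = 0"
        by simp
    qed
  }
  {
    fix x y z :: skorohod
    show "dist x y \<le> dist x z + dist y z"
    proof (rule field_le_epsilon)
      fix e :: real assume "0 < e"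
      then have "Inf (skorohod_bounds (Rep_skorohod x) (Rep_skorohod z)) < dist x z + e / 2"
        "Inf (skorohod_bounds (Rep_skorohod z) (Rep_skorohod y)) < dist y z + e / 2"
        by (simp_all add: dist_skorohod_def skorohod_bounds_sym [of "Rep_skorohod z"])
      then obtain a b
        where a: "a \<in> skorohod_bounds (Rep_skorohod x) (Rep_skorohod z)" "a < dist x z + e / 2"
          and b: "b \<in> skorohod_bounds (Rep_skorohod z) (Rep_skorohod y)" "b < dist y z + e / 2"
        by (meson cInf_lessD [OF ne])
      have "dist x y \<le> a + b"
        unfolding dist_skorohod_def
        by (rule cInf_lower [OF skorohod_bounds_add [OF a(1) b(1)] bdd_below_skorohod_bounds])
      then show "dist x y \<le> dist x z + dist y z + e"
        using a(2) b(2) by linarith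
    qed
  }
qed

end

text \<open>Meaningful only for functions that are cadlag on \<open>[0,1]\<close>.\<close>

definition to_skorohod :: "(real \<Rightarrow> real) \<Rightarrow> skorohod" where
  "to_skorohod x = Abs_skorohod (restrict x {0..1})"

lemma cadlag_restrict:
  assumes "cadlag x"
  shows "cadlag (restrict x {0..1})"
proof -
  have "(restrict x {0..1} \<longlongrightarrow> restrict x {0..1} t) (at_right t)" if t: "t \<in> {0..<1}" for t
  proof -
    have "(x \<longlongrightarrow> x t) (at_right t)"
      using assms t by (simp add: cadlag_def)
    moreover have "eventually (\<lambda>u. x u = restrict x {0..1} u) (at_right t)"
      unfolding eventually_at_right_field using t by (auto intro!: exI [of _ 1])
    ultimately show ?thesis
      using t by (auto intro: Lim_transform_eventually)
  qed
  moreover have "\<exists>l. (restrict x {0..1} \<longlongrightarrow> l) (at_left t)" if t: "t \<in> {0<..1}" for t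
  proof -
    obtain l where "(x \<longlongrightarrow> l) (at_left t)"
      using assms t by (meson cadlag_def)
    moreover have "eventually (\<lambda>u. x u = restrict x {0..1} u) (at_left t)"
      unfolding eventually_at_left_field using t by (auto intro!: exI [of _ 0])
    ultimately show ?thesis
      by (blast intro: Lim_transform_eventually)
  qed
  ultimately show ?thesis
    by (simp add: cadlag_def)
qed

lemma Rep_to_skorohod: "cadlag x \<Longrightarrow> Rep_skorohod (to_skorohod x) = restrict x {0..1}"
  unfolding to_skorohod_def by (rule Abs_skorohod_inverse) (simp add: cadlag_restrict)

lemma continuous_imp_cadlag:
  assumes c: "continuous_on {0..1} x"
  shows "cadlag x"
proof -
  have lim: "(x \<longlongrightarrow> x t) (at t within {0..1})" if "t \<in> {0..1}" for t
    using c that by (auto simp: continuous_on_def)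
  have "(x \<longlongrightarrow> x t) (at_right t)" if "t \<in> {0..<1}" for t
    using lim [of t] that at_within_Icc_at_right [of t 1]
    by (metis at_within_Icc_at_right atLeastAtMost_iff atLeastLessThan_iff atLeastatMost_subset_iff
        less_imp_le order_refl tendsto_within_subset)
  moreover have "(x \<longlongrightarrow> x t) (at_left t)" if "t \<in> {0<..1}" for t
    using lim [of t] that
    by (metis at_within_Icc_at_left atLeastAtMost_iff atLeastatMost_subset_iff
        greaterThanAtMost_iff less_imp_le order_refl tendsto_within_subset)
  ultimately show ?thesis
    unfolding cadlag_def by blast
qed


section \<open>Convergence in distribution and Brownian motion\<close>

definition converges_in_distribution ::
  "'a measure \<Rightarrow> (nat \<Rightarrow> 'a \<Rightarrow> 'c::topological_space) \<Rightarrow> 'b measure \<Rightarrow> ('b \<Rightarrow> 'c) \<Rightarrow> bool" where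
  "converges_in_distribution M Y N Z \<longleftrightarrow>
     (\<forall>n. Y n \<in> borel_measurable M) \<and> Z \<in> borel_measurable N \<and>
     (\<forall>F :: 'c \<Rightarrow> real. continuous_on UNIV F \<and> bounded (range F) \<longrightarrow>
        (\<lambda>n. \<integral>\<omega>. F (Y n \<omega>) \<partial>M) \<longlonglongrightarrow> (\<integral>\<omega>. F (Z \<omega>) \<partial>N))"

definition standard_brownian_motion :: "'b measure \<Rightarrow> (real \<Rightarrow> 'b \<Rightarrow> real) \<Rightarrow> bool" where
  "standard_brownian_motion N W \<longleftrightarrow>
     prob_space N \<and>
     (\<forall>t\<in>{0..1}. W t \<in> borel_measurable N) \<and>
     (\<forall>\<omega>\<in>space N. continuous_on {0..1} (\<lambda>t. W t \<omega>)) \<and>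
     (AE \<omega> in N. W 0 \<omega> = 0) \<and>
     (\<forall>s t. 0 \<le> s \<and> s < t \<and> t \<le> 1 \<longrightarrow>
        distributed N lborel (\<lambda>\<omega>. W t \<omega> - W s \<omega>) (normal_density 0 (sqrt (t - s)))) \<and>
     (\<forall>(k::nat) t. strict_mono_on {..k} t \<and> t ` {..k} \<subseteq> {0..1} \<longrightarrow>
        prob_space.indep_vars N (\<lambda>_. borel) (\<lambda>i \<omega>. W (t (Suc i)) \<omega> - W (t i) \<omega>) {..<k})"


section \<open>L-weak dependence and stationarity\<close>

text \<open>
  \<open>\<real>\<^sup>I\<close> is \<open>I \<rightarrow>\<^sub>E UNIV\<close>. The added \<open>0\<close> only matters for \<open>I = {}\<close>, where the
  supremum would range over the empty set.
\<close>

definition l1_dist :: "nat set \<Rightarrow> (nat \<Rightarrow> real) \<Rightarrow> (nat \<Rightarrow> real) \<Rightarrow> real" where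
  "l1_dist I x y = (\<Sum>i\<in>I. \<bar>x i - y i\<bar>)"

definition l1_lipschitz :: "nat set \<Rightarrow> ((nat \<Rightarrow> real) \<Rightarrow> real) \<Rightarrow> bool" where
  "l1_lipschitz I f \<longleftrightarrow>
     (\<exists>L. \<forall>x\<in>I \<rightarrow>\<^sub>E UNIV. \<forall>y\<in>I \<rightarrow>\<^sub>E UNIV. \<bar>f x - f y\<bar> \<le> L * l1_dist I x y)"

definition lipschitz_norm :: "nat set \<Rightarrow> ((nat \<Rightarrow> real) \<Rightarrow> real) \<Rightarrow> real" where
  "lipschitz_norm I f =
     Sup (insert 0 {\<bar>f x - f y\<bar> / l1_dist I x y | x y.
       x \<in> I \<rightarrow>\<^sub>E UNIV \<and> y \<in> I \<rightarrow>\<^sub>E UNIV \<and> x \<noteq> y})"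

definition covariance_well_defined :: "'a measure \<Rightarrow> ('a \<Rightarrow> real) \<Rightarrow> ('a \<Rightarrow> real) \<Rightarrow> bool" where
  "covariance_well_defined M U V \<longleftrightarrow>
     integrable M U \<and> integrable M V \<and> integrable M (\<lambda>\<omega>. U \<omega> * V \<omega>)"

definition covariance :: "'a measure \<Rightarrow> ('a \<Rightarrow> real) \<Rightarrow> ('a \<Rightarrow> real) \<Rightarrow> real" where
  "covariance M U V =
     (\<integral>\<omega>. (U \<omega> - (\<integral>\<omega>'. U \<omega>' \<partial>M)) * (V \<omega> - (\<integral>\<omega>'. V \<omega>' \<partial>M)) \<partial>M)"

text \<open>Only the variables and coefficients with index at least \<open>1\<close> are used.\<close>

definition L_weakly_dependent :: "'a measure \<Rightarrow> (nat \<Rightarrow> 'a \<Rightarrow> real) \<Rightarrow> (nat \<Rightarrow> real) \<Rightarrow> bool" where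
  "L_weakly_dependent M X \<gamma> \<longleftrightarrow>
     (\<forall>k\<ge>1. 0 \<le> \<gamma> k) \<and> summable (\<lambda>k. \<gamma> (Suc k)) \<and>
     (\<forall>I J f g. finite I \<and> finite J \<and> I \<subseteq> {1..} \<and> J \<subseteq> {1..} \<and> I \<inter> J = {} \<and>
        l1_lipschitz I f \<and> l1_lipschitz J g \<longrightarrow>
        (let U = (\<lambda>\<omega>. f (\<lambda>i\<in>I. X i \<omega>)); V = (\<lambda>\<omega>. g (\<lambda>j\<in>J. X j \<omega>)) in
           covariance_well_defined M U V \<and>
           \<bar>covariance M U V\<bar> \<le>
             lipschitz_norm I f * lipschitz_norm J g *
               (\<Sum>i\<in>I. \<Sum>j\<in>J. \<gamma> (nat \<bar>int j - int i\<bar>))))"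

definition strictly_stationary :: "'a measure \<Rightarrow> (nat \<Rightarrow> 'a \<Rightarrow> real) \<Rightarrow> bool" where
  "strictly_stationary M X \<longleftrightarrow>
     (\<forall>m h. distr M (\<Pi>\<^sub>M i\<in>{1..m}. borel) (\<lambda>\<omega>. \<lambda>i\<in>{1..m}. X (i + h) \<omega>) =
            distr M (\<Pi>\<^sub>M i\<in>{1..m}. borel) (\<lambda>\<omega>. \<lambda>i\<in>{1..m}. X i \<omega>))"

definition scaled_partial_sums :: "(nat \<Rightarrow> 'a \<Rightarrow> real) \<Rightarrow> nat \<Rightarrow> 'a \<Rightarrow> real \<Rightarrow> real" where
  "scaled_partial_sums X n \<omega> t = 1 / sqrt (real n) * (\<Sum>j = 1..nat \<lfloor>real n * t\<rfloor>. X j \<omega>)"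

lemma cadlag_scaled_partial_sums: "cadlag (scaled_partial_sums X n \<omega>)"
proof -
  have R: "(scaled_partial_sums X n \<omega> \<longlongrightarrow> scaled_partial_sums X n \<omega> t) (at_right t)" for t
  proof (cases "n = 0")
    case False
    then have n: "0 < real n" by simp
    define b where "b = (of_int \<lfloor>real n * t\<rfloor> + 1) / real n"
    have "t < b"
      using n unfolding b_def by (simp add: pos_less_divide_eq mult.commute)
    moreover have "\<lfloor>real n * u\<rfloor> = \<lfloor>real n * t\<rfloor>" if "t < u" "u < b" for u
    proof -
      have "real n * t < real n * u" "real n * u < of_int \<lfloor>real n * t\<rfloor> + 1"
        using n that by (simp_all add: b_def pos_less_divide_eq mult.commute)
      then show ?thesis by linarith
    qed
    ultimately show ?thesis
      by (intro tendsto_eventually, unfold eventually_at_right_field)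
         (auto simp: scaled_partial_sums_def intro!: exI [of _ b])
  qed (simp add: scaled_partial_sums_def [abs_def])
  have L: "\<exists>l. (scaled_partial_sums X n \<omega> \<longlongrightarrow> l) (at_left t)" for t
  proof (cases "n = 0")
    case False
    then have n: "0 < real n" by simp
    define k where "k = \<lceil>real n * t\<rceil> - 1"
    define b where "b = of_int k / real n"
    have "b < t"
      using n unfolding b_def k_def by (simp add: pos_divide_less_eq mult.commute) linarith
    moreover have "\<lfloor>real n * u\<rfloor> = k" if "b < u" "u < t" for u
    proof -
      have "real n * u < real n * t" "of_int k < real n * u"
        using n that by (simp_all add: b_def pos_divide_less_eq mult.commute)
      then show ?thesis unfolding k_def by linarith
    qed
    ultimately have "eventually (\<lambda>u. \<lfloor>real n * u\<rfloor> = k) (at_left t)"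
      unfolding eventually_at_left_field by blast
    then have "eventually (\<lambda>u. scaled_partial_sums X n \<omega> u = 1 / sqrt (real n) * (\<Sum>j = 1..nat k. X j \<omega>)) (at_left t)"
      by eventually_elim (simp add: scaled_partial_sums_def)
    then show ?thesis
      by (blast intro: tendsto_eventually)
  qed (auto simp: scaled_partial_sums_def [abs_def])
  show ?thesis
    using R L by (simp add: cadlag_def)
qed

end

theory Submission
  imports Defs
begin

text \<open>
  Put \<open>tail q = (\<Sum>d>q. d * \<gamma> d)\<close>, which tends to \<open>0\<close>. For Lipschitz functions of two blocks of
  indices separated by a gap of \<open>q\<close> the double sum of the \<open>\<gamma> (j - i)\<close> is at most \<open>tail q\<close>, however long
  the blocks are. After normalisation by \<open>sqrt n\<close> the covariance is thus \<open>O(tail q / n)\<close>, and second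
  moments suffice throughout.

  Central limit theorem: cut \<open>S n\<close> into adjacent blocks of fixed length \<open>p\<close>. The characteristic function
  factorises up to an error \<open>(n / p) * O(1 / n)\<close>, so let \<open>n\<close> and then \<open>p\<close> tend to infinity. The same
  bound makes increments over disjoint time intervals asymptotically independent when tested against
  products of Lipschitz functions; sums of products of tent functions approximate all Lipschitz functions
  of finitely many increments.

  Tightness: a smooth version of Ottaviani's inequality with a gap \<open>q\<close> bounds the probability that
  the partial sums of one of \<open>m\<close> blocks fluctuate by more than a multiple of \<open>l * sqrt n\<close>. The errors sum to
  \<open>O(tail q / l\<^sup>2)\<close> over all blocks, uniformly in \<open>m\<close>, and the Gaussian limit contributes \<open>O(1 / m)\<close>.

  Both processes are therefore close to their discretisations on a grid of mesh \<open>1 / m\<close>, which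
  depend on finitely many increments, and it suffices to test convergence against bounded Lipschitz
  functions because every bounded continuous function is an increasing limit of such functions.
\<close>

section \<open>Covariances and second moments of partial sums\<close>

text \<open>Weak dependence controls covariances of Lipschitz functions only, so no indicator may
  enter a covariance. This dictates \<open>ramp\<close> for exceedance events, sine and cosine for
  the complex exponential, and \<open>tent\<close> for lattice cells. A Lipschitz function of a
  normalised block sum has constant of order 1 / sqrt n, so one covariance costs order 1 / n and
  about n of them are affordable: one for each possible time of first passage. Their total does not
  shrink when the blocks become finer, which is why \<open>q\<close> is fixed before
  \<open>m\<close>, and \<open>n\<close> goes to infinity last. Chebyshev's inequality for
  \<open>m\<close> block increments of variance about \<sigma>^2 / m only gives a total of order 1.
  Fourth powers would give m * O(1 / m^2), but no fourth moment of partial sums is estimated here.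
  Instead the fourth power is truncated at 1, which makes it bounded and continuous; by the central
  limit theorem its expectation converges to a Gaussian integral, where the fourth moment is
  explicit.\<close>

lemma lipschitz_norm_bounds:
  assumes "0 \<le> A" and lip: "\<And>x y. \<bar>f x - f y\<bar> \<le> A * l1_dist I x y"
  shows "0 \<le> lipschitz_norm I f" "lipschitz_norm I f \<le> A"
proof -
  let ?S = "insert 0 {\<bar>f x - f y\<bar> / l1_dist I x y |x y. x \<in> I \<rightarrow>\<^sub>E UNIV \<and> y \<in> I \<rightarrow>\<^sub>E UNIV \<and> x \<noteq> y}"
  have le: "r \<le> A" if "r \<in> ?S" for r
  proof -
    from that consider "r = 0" | x y where "r = \<bar>f x - f y\<bar> / l1_dist I x y" by auto
    then show ?thesis
    proof cases
      case 2
      have "0 \<le> l1_dist I x y" by (simp add: l1_dist_def sum_nonneg)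
      with lip[of x y] \<open>0 \<le> A\<close> show ?thesis
        unfolding 2 by (cases "l1_dist I x y = 0") (auto simp: divide_le_eq)
    qed (use \<open>0 \<le> A\<close> in simp)
  qed
  show "0 \<le> lipschitz_norm I f"
    unfolding lipschitz_norm_def by (rule cSup_upper) (auto intro: bdd_aboveI[OF le])
  show "lipschitz_norm I f \<le> A"
    unfolding lipschitz_norm_def by (rule cSup_least[OF _ le]) auto
qed

text \<open>The moment condition and the rate of decay enter through
  \<open>square_integrable\<close> and \<open>summable_weighted\<close>; the final proof derives
  both.\<close>

locale stationary_L_weakly_dependent = prob_space M for M :: "'a measure" +
  fixes X :: "nat \<Rightarrow> 'a \<Rightarrow> real" and \<gamma> :: "nat \<Rightarrow> real" and \<sigma> :: real
  assumes rv: "1 \<le> n \<Longrightarrow> X n \<in> borel_measurable M"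
    and centered: "1 \<le> n \<Longrightarrow> expectation (X n) = 0"
    and weakly_dependent: "L_weakly_dependent M X \<gamma>"
    and stationary: "strictly_stationary M X"
    and square_integrable: "integrable M (\<lambda>\<omega>. (X 1 \<omega>)\<^sup>2)"
    and summable_weighted: "summable (\<lambda>k. real (Suc k) * \<gamma> (Suc k))"
    and variance_limit: "(\<lambda>n. expectation (\<lambda>\<omega>. (\<Sum>j = 1..n. X j \<omega>)\<^sup>2) / real n) \<longlonglongrightarrow> \<sigma>\<^sup>2"
begin

lemma gamma_nonneg: "1 \<le> k \<Longrightarrow> 0 \<le> \<gamma> k"
  using weakly_dependent by (simp add: L_weakly_dependent_def)

text \<open>The Lipschitz conditions range over all sequences, not only over those extensional on
  \<open>I\<close> or \<open>J\<close>. As \<open>l1_dist I\<close> vanishes on sequences that agree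
  on \<open>I\<close>, they also say that \<open>f\<close> reads only the coordinates in
  \<open>I\<close>, and likewise for \<open>g\<close>. This removes the restrictions in the
  definition of weak dependence.\<close>

lemma covariance_bound:
  assumes I: "finite I" "I \<subseteq> {1..}" and J: "finite J" "J \<subseteq> {1..}" and "I \<inter> J = {}"
    and A: "0 \<le> A" "\<And>x y. \<bar>f x - f y\<bar> \<le> A * l1_dist I x y"
    and B: "0 \<le> B" "\<And>x y. \<bar>g x - g y\<bar> \<le> B * l1_dist J x y"
  shows "integrable M (\<lambda>\<omega>. f (\<lambda>i. X i \<omega>))" (is ?F)
    and "integrable M (\<lambda>\<omega>. g (\<lambda>i. X i \<omega>))" (is ?G)
    and "integrable M (\<lambda>\<omega>. f (\<lambda>i. X i \<omega>) * g (\<lambda>i. X i \<omega>))" (is ?FG)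
    and "\<bar>expectation (\<lambda>\<omega>. f (\<lambda>i. X i \<omega>) * g (\<lambda>i. X i \<omega>))
          - expectation (\<lambda>\<omega>. f (\<lambda>i. X i \<omega>)) * expectation (\<lambda>\<omega>. g (\<lambda>i. X i \<omega>))\<bar>
         \<le> A * B * (\<Sum>i\<in>I. \<Sum>j\<in>J. \<gamma> (nat \<bar>int j - int i\<bar>))" (is ?bd)
proof -
  have lf: "l1_lipschitz I f" and lg: "l1_lipschitz J g"
    using A B unfolding l1_lipschitz_def by blast+
  have rf: "f (restrict x I) = f x" for x
    using A(2)[of "restrict x I" x] by (simp add: l1_dist_def)
  have rg: "g (restrict x J) = g x" for x
    using B(2)[of "restrict x J" x] by (simp add: l1_dist_def)
  let ?S = "\<Sum>i\<in>I. \<Sum>j\<in>J. \<gamma> (nat \<bar>int j - int i\<bar>)"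
  have wd: "covariance_well_defined M (\<lambda>\<omega>. f (\<lambda>i. X i \<omega>)) (\<lambda>\<omega>. g (\<lambda>i. X i \<omega>))"
    and cov: "\<bar>covariance M (\<lambda>\<omega>. f (\<lambda>i. X i \<omega>)) (\<lambda>\<omega>. g (\<lambda>i. X i \<omega>))\<bar>
        \<le> lipschitz_norm I f * lipschitz_norm J g * ?S"
    using weakly_dependent[unfolded L_weakly_dependent_def, THEN conjunct2, THEN conjunct2, rule_format, of I J f g]
      assms lf lg
    unfolding Let_def rf rg by blast+
  show 1: ?F and 2: ?G and 3: ?FG
    using wd by (auto simp: covariance_well_defined_def)
  let ?f = "\<lambda>\<omega>. f (\<lambda>i. X i \<omega>)" and ?g = "\<lambda>\<omega>. g (\<lambda>i. X i \<omega>)"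
  have "covariance M ?f ?g = expectation (\<lambda>\<omega>. ?f \<omega> * ?g \<omega> - expectation ?f * ?g \<omega> - ?f \<omega> * expectation ?g
      + expectation ?f * expectation ?g)"
    unfolding covariance_def by (simp add: algebra_simps)
  also have "\<dots> = expectation (\<lambda>\<omega>. ?f \<omega> * ?g \<omega>) - expectation ?f * expectation ?g"
    using 1 2 3 by (simp add: prob_space)
  finally have eq: "covariance M ?f ?g = expectation (\<lambda>\<omega>. ?f \<omega> * ?g \<omega>) - expectation ?f * expectation ?g" .
  have S: "0 \<le> ?S"
  \<comment> \<open>Nothing is known about the sign of \<open>\<gamma> 0\<close>; disjointness keeps
    it out of the sum.\<close>
  proof (intro sum_nonneg gamma_nonneg)
    fix i j assume "i \<in> I" "j \<in> J"
    with \<open>I \<inter> J = {}\<close> have "i \<noteq> j" by auto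
    then show "1 \<le> nat \<bar>int j - int i\<bar>" by linarith
  qed
  have "lipschitz_norm I f * lipschitz_norm J g * ?S \<le> A * B * ?S"
    by (intro mult_right_mono mult_mono lipschitz_norm_bounds(2)[OF A] lipschitz_norm_bounds[OF B] A(1) S)
  with cov eq show ?bd by linarith
qed

definition tail :: "nat \<Rightarrow> real" where
  "tail q = (\<Sum>k. real (Suc (k + q)) * \<gamma> (Suc (k + q)))"

lemma tail_tendsto_0: "tail \<longlonglongrightarrow> 0"
proof -
  let ?g = "\<lambda>k. real (Suc k) * \<gamma> (Suc k)"
  have "tail = (\<lambda>q. suminf ?g - sum ?g {..<q})"
    using suminf_minus_initial_segment[OF summable_weighted] by (simp add: tail_def fun_eq_iff)
  moreover have "(\<lambda>q. suminf ?g - sum ?g {..<q}) \<longlonglongrightarrow> suminf ?g - suminf ?g"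
    by (intro tendsto_intros summable_LIMSEQ summable_weighted)
  ultimately show ?thesis by (simp only: diff_self)
qed

lemma summable_tail: "summable (\<lambda>k. real (Suc (k + q)) * \<gamma> (Suc (k + q)))"
  using summable_ignore_initial_segment[OF summable_weighted, of q] by (simp only: add_Suc)

lemma tail_nonneg: "0 \<le> tail q"
  unfolding tail_def by (intro suminf_nonneg summable_tail mult_nonneg_nonneg gamma_nonneg) auto

text \<open>Sort the pairs by their difference \<open>d\<close>, which exceeds \<open>q\<close>. As
  \<open>i\<close> is at most \<open>u\<close> and \<open>i + d\<close> lies beyond
  \<open>u\<close>, only the last \<open>d\<close> values up to \<open>u\<close> are possible for
  \<open>i\<close>, and \<open>i\<close> determines the pair. So \<open>\<gamma> d\<close> occurs at
  most \<open>d\<close> times, whatever the sizes of \<open>I\<close> and \<open>J\<close>.\<close>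

lemma gamma_double_sum_le:
  assumes I: "finite I" "I \<subseteq> {..u}" and J: "finite J" "J \<subseteq> {u + q<..}"
  shows "(\<Sum>i\<in>I. \<Sum>j\<in>J. \<gamma> (nat \<bar>int j - int i\<bar>)) \<le> tail q"
proof -
  let ?d = "\<lambda>p::nat \<times> nat. snd p - fst p"
  have lt: "i \<le> u" "u + q < j" if "(i, j) \<in> I \<times> J" for i j
    using that I J by auto
  have ge: "q < d" if "d \<in> ?d ` (I \<times> J)" for d
  proof -
    from that obtain i j where "(i, j) \<in> I \<times> J" "d = j - i" by auto
    with lt[of i j] show ?thesis by simp
  qed
  have "(\<Sum>i\<in>I. \<Sum>j\<in>J. \<gamma> (nat \<bar>int j - int i\<bar>)) = (\<Sum>p\<in>I \<times> J. \<gamma> (?d p))"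
    unfolding sum.cartesian_product
  proof (intro sum.cong refl, clarsimp)
    fix i j assume "i \<in> I" "j \<in> J"
    with lt[of i j] have "nat \<bar>int j - int i\<bar> = j - i" by auto
    then show "\<gamma> (nat \<bar>int j - int i\<bar>) = \<gamma> (j - i)" by (rule arg_cong)
  qed
  also have "\<dots> = (\<Sum>d\<in>?d ` (I \<times> J). \<Sum>p\<in>{p \<in> I \<times> J. ?d p = d}. \<gamma> (?d p))"
    using I J by (intro sum.image_gen) auto
  also have "\<dots> \<le> (\<Sum>d\<in>?d ` (I \<times> J). real d * \<gamma> d)"
  proof (rule sum_mono)
    fix d assume "d \<in> ?d ` (I \<times> J)"
    then have d: "q < d" by (rule ge)
    let ?P = "{p \<in> I \<times> J. ?d p = d}"
    have "inj_on fst ?P"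
    proof (rule inj_onI)
      fix a b assume ab: "a \<in> ?P" "b \<in> ?P" "fst a = fst b"
      with lt[of "fst a" "snd a"] lt[of "fst b" "snd b"] show "a = b"
        by (auto simp: prod_eq_iff)
    qed
    then have "card ?P = card (fst ` ?P)" by (simp add: card_image)
    \<comment> \<open>The subtraction is truncated if \<open>d > u + 1\<close>; the interval then
      has fewer than \<open>d\<close> elements.\<close>
    also have "\<dots> \<le> card {u + 1 - d..u}"
    proof (rule card_mono)
      show "fst ` ?P \<subseteq> {u + 1 - d..u}"
      proof
        fix i assume "i \<in> fst ` ?P"
        then obtain j where "(i, j) \<in> I \<times> J" "d = j - i" by auto
        with lt[of i j] show "i \<in> {u + 1 - d..u}" by simp
      qed
    qed simp
    also have "\<dots> \<le> d" by simp
    finally have "real (card ?P) * \<gamma> d \<le> real d * \<gamma> d"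
      using d by (intro mult_right_mono gamma_nonneg) auto
    then show "(\<Sum>p\<in>?P. \<gamma> (?d p)) \<le> real d * \<gamma> d" by simp
  qed
  also have "\<dots> = (\<Sum>k\<in>(\<lambda>d. d - Suc q) ` ?d ` (I \<times> J). real (Suc (k + q)) * \<gamma> (Suc (k + q)))"
  proof (rule trans[OF _ sum.reindex[symmetric]])
    show "inj_on (\<lambda>d. d - Suc q) (?d ` (I \<times> J))"
      by (intro inj_on_diff_nat Suc_leI ge)
    show "(\<Sum>d\<in>?d ` (I \<times> J). real d * \<gamma> d) =
        sum ((\<lambda>k. real (Suc (k + q)) * \<gamma> (Suc (k + q))) \<circ> (\<lambda>d. d - Suc q)) (?d ` (I \<times> J))"
    proof (rule sum.cong[OF refl])
      fix d assume "d \<in> ?d ` (I \<times> J)"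
      then have "Suc (d - Suc q + q) = d" using ge[of d] by simp
      then show "real d * \<gamma> d = ((\<lambda>k. real (Suc (k + q)) * \<gamma> (Suc (k + q))) \<circ> (\<lambda>d. d - Suc q)) d"
        by (simp only: o_def)
    qed
  qed
  also have "\<dots> \<le> tail q"
    unfolding tail_def using I J by (intro sum_le_suminf summable_tail mult_nonneg_nonneg gamma_nonneg) auto
  finally show ?thesis .
qed

lemma covariance_tail_bound:
  assumes I: "I \<subseteq> {1..u}" and J: "finite J" "J \<subseteq> {u + q<..}"
    and A: "0 \<le> A" "\<And>x y. \<bar>f x - f y\<bar> \<le> A * l1_dist I x y"
    and B: "0 \<le> B" "\<And>x y. \<bar>g x - g y\<bar> \<le> B * l1_dist J x y"
  shows "integrable M (\<lambda>\<omega>. f (\<lambda>i. X i \<omega>))"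
    and "integrable M (\<lambda>\<omega>. g (\<lambda>i. X i \<omega>))"
    and "integrable M (\<lambda>\<omega>. f (\<lambda>i. X i \<omega>) * g (\<lambda>i. X i \<omega>))"
    and "\<bar>expectation (\<lambda>\<omega>. f (\<lambda>i. X i \<omega>) * g (\<lambda>i. X i \<omega>))
          - expectation (\<lambda>\<omega>. f (\<lambda>i. X i \<omega>)) * expectation (\<lambda>\<omega>. g (\<lambda>i. X i \<omega>))\<bar> \<le> A * B * tail q"
proof -
  have I': "finite I" "I \<subseteq> {1..}" "I \<subseteq> {..u}" and J': "J \<subseteq> {1..}" and dis: "I \<inter> J = {}"
    using I J by (auto intro: finite_subset) fastforce+
  note * = covariance_bound[OF I'(1,2) J(1) J' dis A B]
  show "integrable M (\<lambda>\<omega>. f (\<lambda>i. X i \<omega>))" "integrable M (\<lambda>\<omega>. g (\<lambda>i. X i \<omega>))"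
    "integrable M (\<lambda>\<omega>. f (\<lambda>i. X i \<omega>) * g (\<lambda>i. X i \<omega>))"
    by (rule *)+
  have "A * B * (\<Sum>i\<in>I. \<Sum>j\<in>J. \<gamma> (nat \<bar>int j - int i\<bar>)) \<le> A * B * tail q"
    using A B by (intro mult_left_mono gamma_double_sum_le[where u = u] I' J) auto
  with *(4) show "\<bar>expectation (\<lambda>\<omega>. f (\<lambda>i. X i \<omega>) * g (\<lambda>i. X i \<omega>))
          - expectation (\<lambda>\<omega>. f (\<lambda>i. X i \<omega>)) * expectation (\<lambda>\<omega>. g (\<lambda>i. X i \<omega>))\<bar> \<le> A * B * tail q"
    by linarith
qed

section \<open>Partial sums over index intervals: stationarity and second moments\<close>

definition psum :: "nat \<Rightarrow> nat \<Rightarrow> 'a \<Rightarrow> real" where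
  "psum a b \<omega> = (\<Sum>j\<in>{a<..b}. X j \<omega>)"

text \<open>The interval is open on the left, so \<open>X 0\<close>, about which nothing is assumed,
  never occurs.\<close>

lemma psum_measurable [measurable]: "psum a b \<in> borel_measurable M"
  unfolding psum_def by (intro borel_measurable_sum rv) auto

lemma psum_split: "a \<le> b \<Longrightarrow> b \<le> c \<Longrightarrow> psum a c \<omega> = psum a b \<omega> + psum b c \<omega>"
  unfolding psum_def by (subst sum.union_disjoint[symmetric]) (auto intro!: sum.cong)

lemma psum_shift: "psum a (a + N) \<omega> = (\<Sum>i\<in>{1..N}. X (i + a) \<omega>)"
  unfolding psum_def
  by (rule sum.reindex_bij_witness[of _ "\<lambda>i. i + a" "\<lambda>i. i - a"]) auto

text \<open>Both laws are images, under summation of the coordinates, of the joint law of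
  \<open>N\<close> consecutive variables.\<close>

lemma psum_distr: "distr M borel (psum a (a + N)) = distr M borel (psum 0 N)"
proof -
  let ?S = "\<lambda>x::nat \<Rightarrow> real. \<Sum>i\<in>{1..N}. x i"
  have S: "?S \<in> borel_measurable (\<Pi>\<^sub>M i\<in>{1..N}. borel)" by measurable
  have m: "(\<lambda>\<omega>. \<lambda>i\<in>{1..N}. X (i + h) \<omega>) \<in> measurable M (\<Pi>\<^sub>M i\<in>{1..N}. borel)" for h
    by (intro measurable_restrict rv) auto
  have *: "distr M borel (psum h (h + N)) =
      distr (distr M (\<Pi>\<^sub>M i\<in>{1..N}. borel) (\<lambda>\<omega>. \<lambda>i\<in>{1..N}. X (i + h) \<omega>)) borel ?S" for h
    by (subst distr_distr[OF S m]) (simp add: comp_def psum_shift[abs_def])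
  show ?thesis
    using *[of a] *[of 0] stationary by (simp add: strictly_stationary_def)
qed

lemma psum_expectation_eq:
  fixes \<phi> :: "real \<Rightarrow> 'c::{banach, second_countable_topology}"
  assumes [measurable]: "\<phi> \<in> borel_measurable borel"
  shows "expectation (\<lambda>\<omega>. \<phi> (psum a (a + N) \<omega>)) = expectation (\<lambda>\<omega>. \<phi> (psum 0 N \<omega>))"
  using arg_cong[OF psum_distr[of a N], of "\<lambda>D. integral\<^sup>L D \<phi>"] by (simp add: integral_distr)

lemma psum_integrable_eq:
  fixes \<phi> :: "real \<Rightarrow> 'c::{banach, second_countable_topology}"
  assumes [measurable]: "\<phi> \<in> borel_measurable borel"
  shows "integrable M (\<lambda>\<omega>. \<phi> (psum a (a + N) \<omega>)) \<longleftrightarrow> integrable M (\<lambda>\<omega>. \<phi> (psum 0 N \<omega>))"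
  using arg_cong[OF psum_distr[of a N], of "\<lambda>D. integrable D \<phi>"] by (simp add: integrable_distr_eq)

lemma psum_single: "psum a (Suc a) = X (Suc a)"
proof -
  have "{a<..Suc a} = {Suc a}" by auto
  then show ?thesis by (simp add: psum_def fun_eq_iff)
qed

lemma X_square_integrable:
  assumes "1 \<le> n" shows "integrable M (\<lambda>\<omega>. (X n \<omega>)\<^sup>2)"
  using psum_integrable_eq[of "\<lambda>x. x\<^sup>2" "n - 1" 1] square_integrable assms psum_single[of 0] psum_single[of "n - 1"]
  by simp

lemma psum_square_integrable: "integrable M (\<lambda>\<omega>. (psum a b \<omega>)\<^sup>2)"
proof -
  have "integrable M (\<lambda>\<omega>. (psum a (a + n) \<omega>)\<^sup>2)" for n
  proof (induction n)
    case (Suc n)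
    have "integrable M (\<lambda>\<omega>. (psum a (a + Suc n) \<omega>)\<^sup>2)"
    proof (rule Bochner_Integration.integrable_bound)
      show "integrable M (\<lambda>\<omega>. 2 * (psum a (a + n) \<omega>)\<^sup>2 + 2 * (X (Suc (a + n)) \<omega>)\<^sup>2)"
        using Suc X_square_integrable[of "Suc (a + n)"] by simp
      have "(psum a (a + Suc n) \<omega>)\<^sup>2 \<le> 2 * (psum a (a + n) \<omega>)\<^sup>2 + 2 * (X (Suc (a + n)) \<omega>)\<^sup>2" for \<omega>
        using psum_split[of a "a + n" "Suc (a + n)" \<omega>] psum_single[of "a + n"]
          zero_le_power2[of "psum a (a + n) \<omega> - X (Suc (a + n)) \<omega>"]
        by (simp add: power2_eq_square algebra_simps)
      then show "AE \<omega> in M. norm ((psum a (a + Suc n) \<omega>)\<^sup>2)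
          \<le> norm (2 * (psum a (a + n) \<omega>)\<^sup>2 + 2 * (X (Suc (a + n)) \<omega>)\<^sup>2)"
        by (intro AE_I2) (simp add: abs_of_nonneg)
    qed measurable
    then show ?case .
  qed (simp add: psum_def)
  from this[of "b - a"] show ?thesis
    by (cases "a \<le> b") (auto simp: psum_def)
qed

lemma psum_integrable: "integrable M (psum a b)"
  by (rule square_integrable_imp_integrable[OF _ psum_square_integrable]) simp

lemma psum_mean: "expectation (psum a b) = 0"
proof -
  have "integrable M (X j)" if "1 \<le> j" for j
    by (rule square_integrable_imp_integrable[OF rv[OF that] X_square_integrable[OF that]])
  then show ?thesis
    by (simp add: psum_def[abs_def] Bochner_Integration.integral_sum centered)
qed

lemma psum_moment_limit: "(\<lambda>n. expectation (\<lambda>\<omega>. (psum 0 n \<omega>)\<^sup>2) / real n) \<longlonglongrightarrow> \<sigma>\<^sup>2"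
proof -
  have "{0<..n} = {1..n}" for n :: nat by auto
  with variance_limit show ?thesis by (simp add: psum_def[abs_def])
qed

text \<open>A convergent sequence of variance ratios is bounded, and stationarity makes the bound
  uniform in the starting point.\<close>

lemma psum_moment_bound:
  "\<exists>C>0. \<forall>a N. expectation (\<lambda>\<omega>. (psum a (a + N) \<omega>)\<^sup>2) \<le> C * real N"
proof -
  have "Bseq (\<lambda>n. expectation (\<lambda>\<omega>. (psum 0 n \<omega>)\<^sup>2) / real n)"
    using psum_moment_limit by (intro convergent_imp_Bseq convergentI)
  then obtain C where C: "0 < C" "\<And>n. norm (expectation (\<lambda>\<omega>. (psum 0 n \<omega>)\<^sup>2) / real n) \<le> C"
    unfolding Bseq_def by blast
  have "expectation (\<lambda>\<omega>. (psum a (a + N) \<omega>)\<^sup>2) \<le> C * real N" for a N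
  proof (cases "N = 0")
    case False
    then show ?thesis
      using C(2)[of N] psum_expectation_eq[of "\<lambda>x. x\<^sup>2" a N]
      by (simp add: abs_le_iff divide_le_eq)
  qed (simp add: psum_def)
  with C(1) show ?thesis by blast
qed

end

section \<open>The central limit theorem\<close>

text \<open>The counterpart of \<open>psum\<close> on sequences of values instead of sample points,
  because the covariance bounds take functions of the coordinates.\<close>

definition block_sum :: "nat \<Rightarrow> nat \<Rightarrow> (nat \<Rightarrow> real) \<Rightarrow> real" where
  "block_sum a b x = (\<Sum>j\<in>{a<..b}. x j)"

lemma block_sum_lipschitz: "\<bar>block_sum a b x - block_sum a b y\<bar> \<le> l1_dist {a<..b} x y"
  unfolding block_sum_def l1_dist_def sum_subtractf[symmetric] by (rule sum_abs)

lemma lipschitz_block_sum_compose: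
  assumes "\<And>u v. \<bar>\<phi> u - \<phi> v\<bar> \<le> A * \<bar>u - v\<bar>" "0 \<le> A"
  shows "\<bar>\<phi> (block_sum a b x) - \<phi> (block_sum a b y)\<bar> \<le> A * l1_dist {a<..b} x y"
  using order_trans[OF assms(1) mult_left_mono[OF block_sum_lipschitz assms(2)]] .

lemma exp_minus_second_order:
  fixes y :: real
  assumes "0 \<le> y" shows "\<bar>exp (- y) - (1 - y)\<bar> \<le> y\<^sup>2"
proof -
  have "exp (- y) \<le> 1 / (1 + y)"
    using assms exp_ge_add_one_self[of y] by (simp add: exp_minus field_simps)
  \<comment> \<open>This is (1 + y) * (1 - y + y^2) = 1 + y^3.\<close>
  also have "\<dots> \<le> 1 - y + y\<^sup>2"
    using assms by (simp add: divide_le_eq) (simp add: algebra_simps power2_eq_square)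
  finally show ?thesis
    using exp_ge_add_one_self[of "- y"] by simp
qed

context stationary_L_weakly_dependent
begin

lemma psum_block_sum: "psum a b \<omega> = block_sum a b (\<lambda>i. X i \<omega>)"
  by (simp add: psum_def block_sum_def)

lemma covariance_blocks:
  assumes "b + q \<le> c" and A: "0 \<le> A" "\<And>u v. \<bar>\<phi> u - \<phi> v\<bar> \<le> A * \<bar>u - v\<bar>"
    and B: "0 \<le> B" "\<And>u v. \<bar>\<psi> u - \<psi> v\<bar> \<le> B * \<bar>u - v\<bar>"
  shows "integrable M (\<lambda>\<omega>. \<phi> (psum a b \<omega>))"
    and "integrable M (\<lambda>\<omega>. \<phi> (psum a b \<omega>) * \<psi> (psum c d \<omega>))"
    and "\<bar>expectation (\<lambda>\<omega>. \<phi> (psum a b \<omega>) * \<psi> (psum c d \<omega>))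
          - expectation (\<lambda>\<omega>. \<phi> (psum a b \<omega>)) * expectation (\<lambda>\<omega>. \<psi> (psum c d \<omega>))\<bar> \<le> A * B * tail q"
proof -
  have "{a<..b} \<subseteq> {1..b}" "finite {c<..d}" "{c<..d} \<subseteq> {b + q<..}"
    using assms(1) by auto
  note * = covariance_tail_bound[OF this A(1) lipschitz_block_sum_compose[OF A(2,1)] B(1) lipschitz_block_sum_compose[OF B(2,1)]]
  show "integrable M (\<lambda>\<omega>. \<phi> (psum a b \<omega>))"
    and "integrable M (\<lambda>\<omega>. \<phi> (psum a b \<omega>) * \<psi> (psum c d \<omega>))"
    and "\<bar>expectation (\<lambda>\<omega>. \<phi> (psum a b \<omega>) * \<psi> (psum c d \<omega>))
          - expectation (\<lambda>\<omega>. \<phi> (psum a b \<omega>)) * expectation (\<lambda>\<omega>. \<psi> (psum c d \<omega>))\<bar> \<le> A * B * tail q"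
    unfolding psum_block_sum by (rule *)+
qed

section \<open>Characteristic functions of partial sums\<close>

abbreviation cf :: "nat \<Rightarrow> real \<Rightarrow> complex" where
  "cf N \<equiv> char (distr M borel (psum 0 N))"

lemma cf_eq: "cf N s = expectation (\<lambda>\<omega>. iexp (s * psum a (a + N) \<omega>))"
  by (subst psum_expectation_eq[of "\<lambda>x. iexp (s * x)"]) (simp_all add: char_def integral_distr)

lemma integrable_iexp_psum: "integrable M (\<lambda>\<omega>. iexp (s * psum a b \<omega>))"
  by (rule integrable_const_bound[of _ 1]) auto

lemma Re_cf: "Re (cf N s) = expectation (\<lambda>\<omega>. cos (s * psum a (a + N) \<omega>))"
  unfolding cf_eq[of N s a] by (subst integral_Re[symmetric, OF integrable_iexp_psum]) (simp add: Re_exp)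

lemma Im_cf: "Im (cf N s) = expectation (\<lambda>\<omega>. sin (s * psum a (a + N) \<omega>))"
  unfolding cf_eq[of N s a] by (subst integral_Im[symmetric, OF integrable_iexp_psum]) (simp add: Im_exp)

lemma cf_le_1: "cmod (cf N s) \<le> 1"
  by (intro real_distribution.cmod_char_le_1 real_distribution_distr) simp

text \<open>The covariance bound is for real functions. The addition theorems split the exponential
  of a sum into four products of sines and cosines, each \<open>\<bar>s\<bar>\<close>-Lipschitz in
  the partial sum, and each costs \<open>s^2 * tail 0\<close>; no gap between the two blocks is
  required.\<close>

lemma cf_add: "cmod (cf (N + p) s - cf N s * cf p s) \<le> 4 * s\<^sup>2 * tail 0"
proof -
  let ?U = "psum 0 N" and ?V = "psum N (N + p)"
  have split: "psum 0 (N + p) \<omega> = ?U \<omega> + ?V \<omega>" for \<omega>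
    by (rule psum_split) auto
  have lip: "\<bar>cos (s * u) - cos (s * v)\<bar> \<le> \<bar>s\<bar> * \<bar>u - v\<bar>" "\<bar>sin (s * u) - sin (s * v)\<bar> \<le> \<bar>s\<bar> * \<bar>u - v\<bar>" for u v
  proof -
    have "\<bar>cos x - cos y\<bar> \<le> \<bar>x - y\<bar>" "\<bar>sin x - sin y\<bar> \<le> \<bar>x - y\<bar>" for x y :: real
    proof -
      have *: "\<bar>sin (z / 2)\<bar> \<le> \<bar>z\<bar> / 2" for z :: real
        using abs_sin_x_le_abs_x[of "z / 2"] by simp
      have **: "\<bar>2 * a * b\<bar> \<le> \<bar>x - y\<bar>" if "\<bar>a\<bar> \<le> 1" "\<bar>b\<bar> \<le> \<bar>x - y\<bar> / 2" for a b :: real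
      proof -
        have "\<bar>a\<bar> * \<bar>b\<bar> \<le> 1 * (\<bar>x - y\<bar> / 2)" using that by (intro mult_mono) auto
        then show ?thesis by (simp add: abs_mult)
      qed
      show "\<bar>cos x - cos y\<bar> \<le> \<bar>x - y\<bar>"
        unfolding cos_diff_cos using *[of "y - x"] by (intro **) (auto simp: abs_minus_commute)
      show "\<bar>sin x - sin y\<bar> \<le> \<bar>x - y\<bar>"
        using **[of "cos ((x + y) / 2)" "sin ((x - y) / 2)"] *[of "x - y"]
        unfolding sin_diff_sin by (simp add: mult_ac)
    qed
    from this[of "s * u" "s * v"] show "\<bar>cos (s * u) - cos (s * v)\<bar> \<le> \<bar>s\<bar> * \<bar>u - v\<bar>" "\<bar>sin (s * u) - sin (s * v)\<bar> \<le> \<bar>s\<bar> * \<bar>u - v\<bar>"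
      by (simp_all add: abs_mult[symmetric] right_diff_distrib)
  qed
  have "N + 0 \<le> N" by simp
  note int = covariance_blocks(2)[where a = 0 and d = "N + p", OF this abs_ge_zero _ abs_ge_zero]
    and cov = covariance_blocks(3)[where a = 0 and d = "N + p", OF this abs_ge_zero _ abs_ge_zero]
  have "Re (cf (N + p) s) = expectation (\<lambda>\<omega>. cos (s * ?U \<omega>) * cos (s * ?V \<omega>)) - expectation (\<lambda>\<omega>. sin (s * ?U \<omega>) * sin (s * ?V \<omega>))"
    unfolding Re_cf[of _ _ 0] using int[OF lip(1) lip(1)] int[OF lip(2) lip(2)] by (simp add: split distrib_left cos_add)
  then have "\<bar>Re (cf (N + p) s - cf N s * cf p s)\<bar> \<le> 2 * (\<bar>s\<bar> * \<bar>s\<bar> * tail 0)"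
    using cov[OF lip(1) lip(1)] cov[OF lip(2) lip(2)] Re_cf[of N s 0] Im_cf[of N s 0] Re_cf[of p s N] Im_cf[of p s N] by simp
  moreover have "Im (cf (N + p) s) = expectation (\<lambda>\<omega>. sin (s * ?U \<omega>) * cos (s * ?V \<omega>)) + expectation (\<lambda>\<omega>. cos (s * ?U \<omega>) * sin (s * ?V \<omega>))"
    unfolding Im_cf[of _ _ 0] using int[OF lip(1) lip(2)] int[OF lip(2) lip(1)] by (simp add: split distrib_left sin_add)
  then have "\<bar>Im (cf (N + p) s - cf N s * cf p s)\<bar> \<le> 2 * (\<bar>s\<bar> * \<bar>s\<bar> * tail 0)"
    using cov[OF lip(1) lip(2)] cov[OF lip(2) lip(1)] Re_cf[of N s 0] Im_cf[of N s 0] Re_cf[of p s N] Im_cf[of p s N] by simp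
  ultimately have "cmod (cf (N + p) s - cf N s * cf p s) \<le> 4 * (\<bar>s\<bar> * \<bar>s\<bar> * tail 0)"
    using cmod_le[of "cf (N + p) s - cf N s * cf p s"] by linarith
  then show ?thesis by (simp add: power2_eq_square)
qed

text \<open>Characteristic functions are bounded by 1, so the errors of successive splittings add up
  instead of multiplying.\<close>

lemma cf_power: "cmod (cf (r * p) s - cf p s ^ r) \<le> real r * (4 * s\<^sup>2 * tail 0)"
proof (induction r)
  case 0
  then show ?case
    unfolding mult_0 cf_eq[of 0 s 0] by (simp add: psum_def prob_space)
next
  case (Suc r)
  have "cf (Suc r * p) s - cf p s ^ Suc r
      = (cf (r * p + p) s - cf (r * p) s * cf p s) + (cf (r * p) s - cf p s ^ r) * cf p s"
    by (simp add: algebra_simps)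
  also have "cmod \<dots> \<le> 4 * s\<^sup>2 * tail 0 + real r * (4 * s\<^sup>2 * tail 0) * 1"
    unfolding norm_mult[symmetric]
    by (intro order_trans[OF norm_triangle_ineq] add_mono cf_add, unfold norm_mult, intro mult_mono Suc cf_le_1)
       (auto simp: tail_nonneg)
  finally show ?case by (simp add: algebra_simps)
qed

text \<open>Disposes of the fewer than \<open>p\<close> summands left over when a sum is cut into
  blocks of length \<open>p\<close>: with \<open>s\<close> of order 1 / sqrt n the bound vanishes
  for fixed \<open>p\<close>.\<close>

lemma cf_diff:
  assumes C: "\<And>a N. expectation (\<lambda>\<omega>. (psum a (a + N) \<omega>)\<^sup>2) \<le> C * real N"
  shows "cmod (cf (K + m) s - cf K s) \<le> \<bar>s\<bar> * (1 + C * real m)"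
proof -
  have 1: "cmod (iexp x - iexp y) \<le> \<bar>x - y\<bar>" for x y :: real
  proof -
    have "iexp y * iexp (x - y) = iexp x"
      unfolding mult_exp_exp by (simp add: algebra_simps)
    then have "iexp x - iexp y = iexp y * (iexp (x - y) - 1)"
      by (simp only: right_diff_distrib mult_1_right)
    also have "cmod \<dots> = cmod (iexp (x - y) - 1)" by (simp add: norm_mult)
    also have "\<dots> \<le> \<bar>x - y\<bar>" using iexp_approx1[of "x - y" 0] by simp
    finally show ?thesis .
  qed
  have "cf (K + m) s - cf K s = expectation (\<lambda>\<omega>. iexp (s * psum 0 (K + m) \<omega>) - iexp (s * psum 0 K \<omega>))"
    using cf_eq[of _ s 0] integrable_iexp_psum by (subst Bochner_Integration.integral_diff) simp_all
  also have "cmod \<dots> \<le> expectation (\<lambda>\<omega>. \<bar>s\<bar> * (1 + (psum K (K + m) \<omega>)\<^sup>2))"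
  proof (rule order_trans[OF integral_norm_bound integral_mono])
    show "integrable M (\<lambda>\<omega>. cmod (iexp (s * psum 0 (K + m) \<omega>) - iexp (s * psum 0 K \<omega>)))"
      by (intro integrable_norm Bochner_Integration.integrable_diff integrable_iexp_psum)
    show "integrable M (\<lambda>\<omega>. \<bar>s\<bar> * (1 + (psum K (K + m) \<omega>)\<^sup>2))"
      by (simp add: psum_square_integrable)
    fix \<omega>
    \<comment> \<open>Trades the first absolute moment for the second, for which the bound
      \<open>C\<close> is at hand.\<close>
    have "\<bar>x\<bar> \<le> 1 + x\<^sup>2" for x :: real
      using zero_le_power2[of "\<bar>x\<bar> - 1"] zero_le_power2[of x] by (simp add: power2_eq_square algebra_simps)
    then have "\<bar>s * psum 0 (K + m) \<omega> - s * psum 0 K \<omega>\<bar> \<le> \<bar>s\<bar> * (1 + (psum K (K + m) \<omega>)\<^sup>2)"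
      using psum_split[of 0 K "K + m" \<omega>] by (simp add: right_diff_distrib[symmetric] abs_mult mult_left_mono)
    with 1 show "cmod (iexp (s * psum 0 (K + m) \<omega>) - iexp (s * psum 0 K \<omega>)) \<le> \<bar>s\<bar> * (1 + (psum K (K + m) \<omega>)\<^sup>2)"
      using order_trans by blast
  qed
  also have "\<dots> = \<bar>s\<bar> * (1 + expectation (\<lambda>\<omega>. (psum K (K + m) \<omega>)\<^sup>2))"
    by (simp add: psum_square_integrable prob_space)
  also have "\<dots> \<le> \<bar>s\<bar> * (1 + C * real m)"
    by (intro mult_left_mono add_mono C) auto
  finally show ?thesis .
qed

text \<open>The factor \<open>n\<close> is there because the error is later multiplied by a number
  of blocks of order \<open>n\<close>. The comparison is with an exponential instead of the Taylor
  polynomial because its powers are again exponentials.\<close>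

lemma cf_taylor:
  defines "v p \<equiv> expectation (\<lambda>\<omega>. (psum 0 p \<omega>)\<^sup>2)"
  shows "(\<lambda>n. real n * cmod (cf p (t / sqrt n) - exp (- (t\<^sup>2 * v p / (2 * real n))))) \<longlonglongrightarrow> 0"
proof (rule Lim_null_comparison)
  \<comment> \<open>The cubic Taylor remainder capped by a quadratic one: domination by a multiple
    of the square and pointwise convergence to 0 take the place of a third moment.\<close>
  let ?I = "\<lambda>n. expectation (\<lambda>\<omega>. min (6 * (psum 0 p \<omega>)\<^sup>2) (\<bar>t / sqrt n\<bar> * \<bar>psum 0 p \<omega>\<bar>^3))"
  have "(\<lambda>n. ?I (real n)) \<longlonglongrightarrow> expectation (\<lambda>_. 0)"
  proof (rule integral_dominated_convergence)
    show "integrable M (\<lambda>\<omega>. 6 * (psum 0 p \<omega>)\<^sup>2)" by (simp add: psum_square_integrable)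
    have "(\<lambda>n. min (6 * (psum 0 p \<omega>)\<^sup>2) (\<bar>t / sqrt n\<bar> * \<bar>psum 0 p \<omega>\<bar>^3)) \<longlonglongrightarrow> min (6 * (psum 0 p \<omega>)\<^sup>2) 0" for \<omega>
    proof (intro tendsto_min tendsto_const tendsto_mult_left_zero tendsto_rabs_zero)
      have "filterlim (\<lambda>n. sqrt (real n)) at_top sequentially"
        by (intro filterlim_compose[OF sqrt_at_top] filterlim_real_sequentially)
      then show "(\<lambda>n. t / sqrt (real n)) \<longlonglongrightarrow> 0"
        by (rule real_tendsto_divide_at_top[OF tendsto_const])
    qed
    then show "AE \<omega> in M. (\<lambda>n. min (6 * (psum 0 p \<omega>)\<^sup>2) (\<bar>t / sqrt n\<bar> * \<bar>psum 0 p \<omega>\<bar>^3)) \<longlonglongrightarrow> 0"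
      by simp
  qed (auto intro!: AE_I2)
  then have "(\<lambda>n. t\<^sup>2 / 6 * ?I (real n) + (t\<^sup>2 * v p / 2)\<^sup>2 * (1 / real n)) \<longlonglongrightarrow> t\<^sup>2 / 6 * 0 + (t\<^sup>2 * v p / 2)\<^sup>2 * 0"
    by (intro tendsto_intros lim_1_over_n) simp
  then show "(\<lambda>n. t\<^sup>2 / 6 * ?I (real n) + (t\<^sup>2 * v p / 2)\<^sup>2 * (1 / real n)) \<longlonglongrightarrow> 0" by simp
  show "\<forall>\<^sub>F n in sequentially. norm (real n * cmod (cf p (t / sqrt n) - exp (- (t\<^sup>2 * v p / (2 * real n)))))
      \<le> t\<^sup>2 / 6 * ?I (real n) + (t\<^sup>2 * v p / 2)\<^sup>2 * (1 / real n)"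
    using eventually_gt_at_top[of 0]
  proof eventually_elim
    fix n :: nat assume n: "0 < n"
    let ?s = "t / sqrt n" and ?y = "t\<^sup>2 * v p / (2 * real n)"
    have v: "0 \<le> v p" by (simp add: v_def)
    have s2: "?s\<^sup>2 = t\<^sup>2 / n" using n by (simp add: power_divide)
    have "cmod (cf p ?s - (1 - ?s\<^sup>2 * v p / 2)) \<le> (?s\<^sup>2 / 6) * ?I n"
      by (rule char_approx3'[OF _ psum_integrable psum_square_integrable])
         (simp_all add: psum_mean v_def)
    then have 1: "cmod (cf p ?s - complex_of_real (1 - ?y)) \<le> (?s\<^sup>2 / 6) * ?I n"
      using n by (simp add: s2 field_simps)
    have 2: "cmod (complex_of_real (1 - ?y) - complex_of_real (exp (- ?y))) \<le> ?y\<^sup>2"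
      using exp_minus_second_order[of ?y] v unfolding of_real_diff[symmetric] norm_of_real by (simp add: abs_minus_commute)
    have "cmod (cf p ?s - exp (- ?y)) \<le> (?s\<^sup>2 / 6) * ?I n + ?y\<^sup>2"
      using norm_triangle_le[OF add_mono[OF 1 2]] by (simp add: algebra_simps)
    then have "real n * cmod (cf p ?s - exp (- ?y)) \<le> real n * ((?s\<^sup>2 / 6) * ?I n + ?y\<^sup>2)"
      by (intro mult_left_mono) auto
    also have "\<dots> = t\<^sup>2 / 6 * ?I n + (t\<^sup>2 * v p / 2)\<^sup>2 * (1 / real n)"
      using n unfolding s2 by (simp add: field_simps power2_eq_square)
    finally show "norm (real n * cmod (cf p ?s - exp (- ?y))) \<le> t\<^sup>2 / 6 * ?I n + (t\<^sup>2 * v p / 2)\<^sup>2 * (1 / real n)"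
      by simp
  qed
qed

lemma nat_div_ratio_tendsto:
  assumes N: "(\<lambda>n. real (N n) / real n) \<longlonglongrightarrow> c" and "0 < p"
  shows "(\<lambda>n. real (N n div p) / real n) \<longlonglongrightarrow> c / real p"
proof (rule tendsto_sandwich)
  have "(\<lambda>n. real (N n) / real n / real p - 1 / real n) \<longlonglongrightarrow> c / real p - 0"
    using \<open>0 < p\<close> by (intro tendsto_intros N lim_1_over_n) simp
  then show "(\<lambda>n. real (N n) / real n / real p - 1 / real n) \<longlonglongrightarrow> c / real p" by simp
  show "(\<lambda>n. real (N n) / real n / real p) \<longlonglongrightarrow> c / real p"
    using \<open>0 < p\<close> by (intro tendsto_intros N) simp
  have b: "real (k div p) \<le> real k / real p" "real k / real p - 1 \<le> real (k div p)" for k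
    using \<open>0 < p\<close> floor_divide_of_nat_eq[of k p, where ?'a = real] floor_correct[of "real k / real p"]
    by linarith+
  show "\<forall>\<^sub>F n in sequentially. real (N n) / real n / real p - 1 / real n \<le> real (N n div p) / real n"
    using divide_right_mono[OF b(2)] by (auto simp: field_simps diff_divide_distrib intro!: always_eventually)
  show "\<forall>\<^sub>F n in sequentially. real (N n div p) / real n \<le> real (N n) / real n / real p"
    using divide_right_mono[OF b(1)] by (auto simp: field_simps intro!: always_eventually)
qed

theorem cf_limit:
  assumes N: "(\<lambda>n. real (N n) / real n) \<longlonglongrightarrow> c"
  shows "(\<lambda>n. cf (N n) (t / sqrt n)) \<longlonglongrightarrow> exp (- (t\<^sup>2 * \<sigma>\<^sup>2 * c / 2))"
proof -
  define v where "v p = expectation (\<lambda>\<omega>. (psum 0 p \<omega>)\<^sup>2)" for p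
  obtain C where C: "0 < C" "\<And>a N. expectation (\<lambda>\<omega>. (psum a (a + N) \<omega>)\<^sup>2) \<le> C * real N"
    using psum_moment_bound by blast
  let ?lim = "exp (- (t\<^sup>2 * \<sigma>\<^sup>2 * c / 2))"
  \<comment> \<open>The summands bound, in this order, the error of dropping the
    \<open>N n mod p\<close> last terms, of factorising into blocks, of replacing each block factor
    by an exponential, and of the remaining difference between exponentials.\<close>
  define b where "b p n = \<bar>t / sqrt n\<bar> * (1 + C * real p) + 4 * t\<^sup>2 * tail 0 * (real (N n div p) / n)
      + (real (N n div p) / n) * (real n * cmod (cf p (t / sqrt n) - exp (- (t\<^sup>2 * v p / (2 * real n)))))
      + \<bar>exp (- (t\<^sup>2 * v p * (real (N n div p) / n) / 2)) - ?lim\<bar>" for p n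
  \<comment> \<open>The limit of \<open>b p\<close> in \<open>n\<close>. There are about c * n / p
    joints between blocks, each costing order 1 / n, so long blocks make the factorisation error
    small.\<close>
  define B where "B p = 4 * t\<^sup>2 * tail 0 * (c / p) + \<bar>exp (- (t\<^sup>2 * v p * (c / p) / 2)) - ?lim\<bar>" for p :: nat
  have b_lim: "b p \<longlonglongrightarrow> B p" if "0 < p" for p
  proof -
    have "filterlim (\<lambda>n. sqrt (real n)) at_top sequentially"
      by (intro filterlim_compose[OF sqrt_at_top] filterlim_real_sequentially)
    then have s: "(\<lambda>n. t / sqrt (real n)) \<longlonglongrightarrow> 0"
      by (rule real_tendsto_divide_at_top[OF tendsto_const])
    have "b p \<longlonglongrightarrow> \<bar>0\<bar> * (1 + C * real p) + 4 * t\<^sup>2 * tail 0 * (c / p)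
      + (c / p) * 0 + \<bar>exp (- (t\<^sup>2 * v p * (c / p) / 2)) - ?lim\<bar>"
      unfolding b_def
      using cf_taylor[of p t] by (intro tendsto_intros s nat_div_ratio_tendsto[OF N that]) (simp_all add: v_def)
    then show ?thesis by (simp add: B_def)
  qed
  have B_lim: "B \<longlonglongrightarrow> 0"
  proof -
    have eq: "t\<^sup>2 * v p * (c / p) / 2 = t\<^sup>2 * (v p / p) * c / 2" for p by simp
    have "B \<longlonglongrightarrow> 4 * t\<^sup>2 * tail 0 * (c * 0) + \<bar>exp (- (t\<^sup>2 * \<sigma>\<^sup>2 * c / 2)) - ?lim\<bar>"
      unfolding B_def eq
      using psum_moment_limit tendsto_mult[OF tendsto_const lim_1_over_n, of c]
      by (intro tendsto_intros) (simp_all add: v_def)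
    then show ?thesis by simp
  qed
  have le: "cmod (cf (N n) (t / sqrt n) - ?lim) \<le> b p n" if "0 < p" "0 < n" for p n
  proof -
    let ?s = "t / sqrt n" and ?r = "N n div p" and ?e = "complex_of_real (exp (- (t\<^sup>2 * v p / (2 * real n))))"
    have s2: "?s\<^sup>2 = t\<^sup>2 / n" using that by (simp add: power_divide)
    have "cmod (cf (N n) ?s - cf (?r * p) ?s) \<le> \<bar>?s\<bar> * (1 + C * real (N n mod p))"
      using cf_diff[OF C(2), of "?r * p" "N n mod p" ?s] by simp
    also have "\<dots> \<le> \<bar>?s\<bar> * (1 + C * real p)"
      using that C(1) by (intro mult_left_mono add_mono) (auto intro!: less_imp_le)
    finally have 1: "cmod (cf (N n) ?s - cf (?r * p) ?s) \<le> \<bar>?s\<bar> * (1 + C * real p)" .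
    have 2: "cmod (cf (?r * p) ?s - cf p ?s ^ ?r) \<le> 4 * t\<^sup>2 * tail 0 * (real ?r / n)"
      using cf_power[of ?r p ?s] unfolding s2 by (simp add: mult_ac)
    have "cmod (cf p ?s ^ ?r - ?e ^ ?r) \<le> real ?r * cmod (cf p ?s - ?e)"
    proof (rule norm_power_diff[OF cf_le_1])
      show "cmod ?e \<le> 1" unfolding norm_of_real by (simp add: v_def)
    qed
    then have 3: "cmod (cf p ?s ^ ?r - ?e ^ ?r) \<le> (real ?r / n) * (real n * cmod (cf p ?s - ?e))"
      using that by simp
    have e: "?e ^ ?r = complex_of_real (exp (- (t\<^sup>2 * v p * (real ?r / n) / 2)))"
      unfolding of_real_power[symmetric] exp_of_nat_mult[symmetric] using that by (simp add: field_simps)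
    have 4: "cmod (?e ^ ?r - ?lim) = \<bar>exp (- (t\<^sup>2 * v p * (real ?r / n) / 2)) - ?lim\<bar>"
      unfolding e of_real_diff[symmetric] norm_of_real ..
    have "cmod (cf (N n) ?s - ?lim) \<le> cmod (cf (N n) ?s - cf (?r * p) ?s) + cmod (cf (?r * p) ?s - cf p ?s ^ ?r)
        + cmod (cf p ?s ^ ?r - ?e ^ ?r) + cmod (?e ^ ?r - ?lim)"
      by (rule norm_triangle_le_diff norm_diff_triangle_le order_refl add_mono)+
    with 1 2 3 4 show ?thesis unfolding b_def by linarith
  qed
  show ?thesis
  proof (rule tendstoI)
    fix e :: real assume "0 < e"
    have "\<forall>\<^sub>F p in sequentially. B p < e \<and> 0 < p"
      using order_tendstoD(2)[OF B_lim \<open>0 < e\<close>] eventually_gt_at_top[of 0] by eventually_elim simp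
    then obtain p where p: "B p < e" "0 < p"
      using eventually_happens'[OF sequentially_bot] by blast
    show "\<forall>\<^sub>F n in sequentially. dist (cf (N n) (t / sqrt n)) (complex_of_real ?lim) < e"
      using order_tendstoD(2)[OF b_lim[OF p(2)] p(1)] eventually_gt_at_top[of 0]
    proof eventually_elim
      case (elim n)
      then show ?case using le[OF p(2), of n] by (simp add: dist_norm)
    qed
  qed
qed

text \<open>Levy's continuity theorem. The starting point \<open>a n\<close> may vary freely because
  the law depends only on the length. The limit is written as an image of the standard normal law,
  which also covers the point mass arising for \<open>c = 0\<close>.\<close>

theorem psum_weak_limit:
  fixes h :: "real \<Rightarrow> real"
  assumes N: "(\<lambda>n. real (N n) / real n) \<longlonglongrightarrow> c" and "0 \<le> c"
    and h: "continuous_on UNIV h" "\<And>x. \<bar>h x\<bar> \<le> B"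
  shows "(\<lambda>n. expectation (\<lambda>\<omega>. h (psum (a n) (a n + N n) \<omega> / sqrt n)))
    \<longlonglongrightarrow> (\<integral>x. h (\<sigma> * sqrt c * x) \<partial>std_normal_distribution)"
proof -
  have hm [measurable]: "h \<in> borel_measurable borel"
    using h(1) by (rule borel_measurable_continuous_onI)
  let ?\<mu> = "\<lambda>n. distr M borel (\<lambda>\<omega>. psum 0 (N n) \<omega> / sqrt n)"
    and ?\<nu> = "distr std_normal_distribution borel (\<lambda>x. \<sigma> * sqrt c * x)"
  interpret std: real_distribution std_normal_distribution by (rule real_dist_normal_dist)
  have m [measurable]: "(\<lambda>x. \<sigma> * sqrt c * x) \<in> borel_measurable std_normal_distribution" by simp
  interpret nu: real_distribution ?\<nu> by (rule std.real_distribution_distr) simp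
  have mu: "real_distribution (?\<mu> n)" for n by (rule real_distribution_distr) simp
  have "weak_conv_m ?\<mu> ?\<nu>"
  proof (rule levy_continuity[OF mu])
    show "real_distribution ?\<nu>" by unfold_locales
    fix t
    have "char ?\<nu> t = char std_normal_distribution (t * (\<sigma> * sqrt c))"
      unfolding char_def by (subst integral_distr) (auto simp: mult_ac)
    also have "\<dots> = exp (- (t\<^sup>2 * \<sigma>\<^sup>2 * c / 2))"
      using \<open>0 \<le> c\<close> by (simp add: char_std_normal_distribution power_mult_distrib)
    finally have 1: "char ?\<nu> t = exp (- (t\<^sup>2 * \<sigma>\<^sup>2 * c / 2))" .
    have 2: "char (?\<mu> n) t = cf (N n) (t / sqrt n)" for n
      unfolding char_def by (simp add: integral_distr)
    show "(\<lambda>n. char (?\<mu> n) t) \<longlonglongrightarrow> char ?\<nu> t"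
      unfolding 1 2 by (rule cf_limit[OF N])
  qed
  then have "(\<lambda>n. integral\<^sup>L (?\<mu> n) h) \<longlonglongrightarrow> integral\<^sup>L ?\<nu> h"
    using h by (intro weak_conv_imp_integral_bdd_continuous_conv[OF mu nu.real_distribution_axioms])
      (auto simp: continuous_on_eq_continuous_at)
  moreover have "integral\<^sup>L (?\<mu> n) h = expectation (\<lambda>\<omega>. h (psum (a n) (a n + N n) \<omega> / sqrt n))" for n
    by (subst psum_expectation_eq[of "\<lambda>x. h (x / sqrt n)"]) (simp_all add: integral_distr)
  moreover have "integral\<^sup>L ?\<nu> h = (\<integral>x. h (\<sigma> * sqrt c * x) \<partial>std_normal_distribution)"
    by (subst integral_distr) auto
  ultimately show ?thesis by simp
qed

end

section \<open>A maximal inequality\<close>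

text \<open>A Lipschitz stand-in for the indicator of the positive half-line. Applied to a maximum
  divided by \<open>l\<close>, minus 2, it is 0 for maxima up to \<open>2 * l\<close> and 1 from
  \<open>3 * l\<close> on.\<close>

definition ramp :: "real \<Rightarrow> real" where
  "ramp u = max 0 (min 1 u)"

lemma ramp_bounds: "0 \<le> ramp u" "ramp u \<le> 1"
  by (auto simp: ramp_def)

lemma ramp_lipschitz: "\<bar>ramp u - ramp v\<bar> \<le> \<bar>u - v\<bar>"
  by (auto simp: ramp_def)

lemma ramp_mono: "u \<le> v \<Longrightarrow> ramp u \<le> ramp v"
  by (auto simp: ramp_def)

lemma ramp_measurable [measurable]: "ramp \<in> borel_measurable borel"
  unfolding ramp_def by measurable

primrec runmax :: "(nat \<Rightarrow> real) \<Rightarrow> nat \<Rightarrow> real" where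
  "runmax u 0 = \<bar>u 0\<bar>"
| "runmax u (Suc k) = max (runmax u k) \<bar>u (Suc k)\<bar>"

lemma runmax_lipschitz: "(\<And>i. i \<le> k \<Longrightarrow> \<bar>u i - v i\<bar> \<le> D) \<Longrightarrow> \<bar>runmax u k - runmax v k\<bar> \<le> D"
proof (induction k)
  case 0
  from this[of 0] show ?case by auto
next
  case (Suc k)
  have "\<bar>runmax u k - runmax v k\<bar> \<le> D" using Suc by auto
  moreover have "\<bar>u (Suc k) - v (Suc k)\<bar> \<le> D" using Suc.prems by auto
  ultimately show ?case by (auto simp: max_def)
qed

lemma abs_le_runmax: "i \<le> k \<Longrightarrow> \<bar>u i\<bar> \<le> runmax u k"
  by (induction k) (auto simp: le_Suc_eq le_max_iff_disj)

lemma runmax_measurable [measurable]: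
  "(\<And>i. (\<lambda>\<omega>. u \<omega> i) \<in> borel_measurable M) \<Longrightarrow> (\<lambda>\<omega>. runmax (u \<omega>) k) \<in> borel_measurable M"
  by (induction k) simp_all

lemma block_sum_split:
  "a \<le> b \<Longrightarrow> b \<le> c \<Longrightarrow> block_sum a c x = block_sum a b x + block_sum b c x"
  unfolding block_sum_def by (subst sum.union_disjoint[symmetric]) (auto intro!: sum.cong)

lemma block_sum_empty [simp]: "b \<le> a \<Longrightarrow> block_sum a b x = 0"
  by (simp add: block_sum_def)

lemma l1_dist_mono: "I \<subseteq> J \<Longrightarrow> finite J \<Longrightarrow> l1_dist I x y \<le> l1_dist J x y"
  unfolding l1_dist_def by (intro sum_mono2) auto

text \<open>Ottaviani's argument with smooth functions: \<open>f k\<close> replaces the indicator of the event that the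
  level \<open>2 * l\<close> is first crossed at time \<open>Suc k\<close>, and \<open>g k\<close> the indicator that the increment after time
  \<open>Suc k + q\<close> is small. The gap of \<open>q\<close> indices makes the covariance of \<open>f k\<close> and \<open>g k\<close> small; it is
  bridged by excluding large single summands.\<close>

lemma first_passage_pointwise:
  fixes x :: "nat \<Rightarrow> real" and a N :: nat
  defines "S r k \<equiv> block_sum a (a + k) x / r"
  defines "f r l k \<equiv> ramp (runmax (S r) (Suc k) / l - 2) - ramp (runmax (S r) k / l - 2)"
    and "g r l q k \<equiv> ramp (2 - 2 * \<bar>block_sum (a + Suc k + q) (a + N) x / r\<bar> / l)"
  assumes "0 < r" "0 < l" "0 < q"
  shows "(\<Sum>k<N. f r l k * g r l q k)
    \<le> min 1 ((2 / l * S r N) ^ 4) + (\<Sum>j\<in>{a<..a + N}. indicator {y. l * r / (2 * real q) < \<bar>y\<bar>} (x j))"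
    (is "_ \<le> _ + ?bad")
proof -
  have f0: "0 \<le> f r l k" for k
    unfolding f_def using ramp_mono[of "runmax (S r) k / l - 2" "runmax (S r) (Suc k) / l - 2"] \<open>0 < l\<close>
    by (simp add: divide_right_mono)
  have S0: "S r 0 = 0" by (simp add: S_def)
  have bad0: "0 \<le> ?bad" by (intro sum_nonneg) simp
  \<comment> \<open>The \<open>f r l k\<close> telescope, like the probabilities of disjoint
    first-passage events, so the sum never exceeds 1. This settles the two cases in which a term on
    the right is at least 1: a large final sum or a large summand.\<close>
  have "(\<Sum>k<N. f r l k * g r l q k) \<le> (\<Sum>k<N. f r l k)"
    using f0 ramp_bounds(2) by (intro sum_mono mult_left_le) (auto simp: g_def)
  also have "\<dots> = ramp (runmax (S r) N / l - 2) - ramp (runmax (S r) 0 / l - 2)"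
    unfolding f_def by (rule sum_lessThan_telescope)
  also have "\<dots> \<le> 1"
    using ramp_bounds(2)[of "runmax (S r) N / l - 2"] ramp_bounds(1)[of "runmax (S r) 0 / l - 2"] by linarith
  finally have le1: "(\<Sum>k<N. f r l k * g r l q k) \<le> 1" .
  consider "l / 2 < \<bar>S r N\<bar>" | j where "j \<in> {a<..a + N}" "l * r / (2 * real q) < \<bar>x j\<bar>"
    | "\<bar>S r N\<bar> \<le> l / 2" "\<And>j. j \<in> {a<..a + N} \<Longrightarrow> \<bar>x j\<bar> \<le> l * r / (2 * real q)"
    by (meson not_le)
  then show ?thesis
  proof cases
    case 1
    then have "1 \<le> \<bar>2 / l * S r N\<bar>" using \<open>0 < l\<close> by (simp add: abs_mult field_simps)
    then have "1 \<le> \<bar>2 / l * S r N\<bar> ^ 4" by (rule one_le_power)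
    then have "1 \<le> (2 / l * S r N) ^ 4" by (subst (asm) power_even_abs) simp_all
    then have "min 1 ((2 / l * S r N) ^ 4) = 1" by (rule min_absorb1)
    with le1 bad0 show ?thesis by linarith
  next
    case 2
    then have "1 \<le> (\<Sum>j\<in>{a<..a + N}. indicator {y. l * r / (2 * real q) < \<bar>y\<bar>} (x j) :: real)"
      using member_le_sum[of j "{a<..a + N}" "\<lambda>j. indicator {y. l * r / (2 * real q) < \<bar>y\<bar>} (x j) :: real"] by simp
    moreover have "0 \<le> min 1 ((2 / l * S r N) ^ 4)" by simp
    ultimately show ?thesis using le1 by linarith
  next
    case 3
    \<comment> \<open>If both factors were nonzero, the running maximum would rise at
      \<open>Suc k\<close> to a value above \<open>2 * l\<close>, attained by the sum at
      \<open>Suc k\<close>. The gap takes away at most \<open>l / 2\<close> and the remaining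
      increment less than \<open>l\<close>, so the final sum would exceed
      \<open>l / 2\<close>.\<close>
    have "f r l k * g r l q k = 0" if "k < N" for k
    proof (rule ccontr)
      assume "f r l k * g r l q k \<noteq> 0"
      then have f: "f r l k \<noteq> 0" and g: "g r l q k \<noteq> 0" by auto
      have "runmax (S r) k < runmax (S r) (Suc k)"
      proof (rule ccontr)
        assume "\<not> ?thesis"
        then have "runmax (S r) (Suc k) = runmax (S r) k" by simp
        then show False using f by (simp only: f_def diff_self)
      qed
      moreover have "2 < runmax (S r) (Suc k) / l"
      proof (rule ccontr)
        assume "\<not> ?thesis"
        then have "ramp (runmax (S r) (Suc k) / l - 2) = 0" by (simp add: ramp_def)
        then show False using f f0[of k] ramp_bounds(1)[of "runmax (S r) k / l - 2"] by (simp add: f_def)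
      qed
      ultimately have S1: "2 * l < \<bar>S r (Suc k)\<bar>"
        using \<open>0 < l\<close> by (auto simp: max_def less_divide_eq split: if_splits)
      let ?B = "block_sum (a + Suc k + q) (a + N) x / r"
      have B: "\<bar>?B\<bar> < l"
      proof (rule ccontr)
        assume "\<not> ?thesis"
        then have "2 \<le> 2 * \<bar>?B\<bar> / l" using \<open>0 < l\<close> by (simp only: le_divide_eq if_True)
        then show False using g by (simp only: g_def ramp_def)
      qed
      \<comment> \<open>The cap covers a gap that runs past the end of the block; the remaining sum
        is then empty.\<close>
      let ?e = "min (a + Suc k + q) (a + N)"
      have "\<bar>block_sum (a + Suc k) ?e x\<bar> \<le> (\<Sum>j\<in>{a + Suc k<..?e}. \<bar>x j\<bar>)"
        unfolding block_sum_def by (rule sum_abs)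
      also have "\<dots> \<le> real (card {a + Suc k<..?e}) * (l * r / (2 * real q))"
        by (rule sum_bounded_above) (auto intro!: 3(2))
      \<comment> \<open>At most \<open>q\<close> summands lie in the gap; the threshold for single
        summands is chosen to make their total \<open>l / 2 * r\<close>.\<close>
      also have "\<dots> \<le> real q * (l * r / (2 * real q))"
        using \<open>0 < l\<close> \<open>0 < r\<close> by (intro mult_right_mono) auto
      also have "\<dots> = l / 2 * r" using \<open>0 < q\<close> by simp
      finally have m: "\<bar>block_sum (a + Suc k) ?e x / r\<bar> \<le> l / 2"
        using \<open>0 < r\<close> by (simp add: pos_divide_le_eq)
      have "block_sum ?e (a + N) x = block_sum (a + Suc k + q) (a + N) x"
        by (simp add: min_def)
      then have "block_sum a (a + N) x = block_sum a (a + Suc k) x + block_sum (a + Suc k) ?e x + block_sum (a + Suc k + q) (a + N) x"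
        using block_sum_split[of a "a + Suc k" "a + N" x] block_sum_split[of "a + Suc k" ?e "a + N" x] that
        by (simp add: min_def)
      then have "S r N = S r (Suc k) + block_sum (a + Suc k) ?e x / r + ?B"
        unfolding S_def by (simp only: add_divide_distrib)
      then show False using S1 B m 3(1) by linarith
    qed
    then have "(\<Sum>k<N. f r l k * g r l q k) = 0" by (intro sum.neutral) auto
    moreover have "0 \<le> min 1 ((2 / l * S r N) ^ 4)" by simp
    ultimately show ?thesis using bad0 by linarith
  qed
qed

context stationary_L_weakly_dependent
begin

text \<open>The probability that \<open>\<bar>X 1\<bar>\<close> exceeds \<open>c\<close>, written as
  an expectation so that \<open>psum_expectation_eq\<close> carries it over to every
  \<open>X j\<close>.\<close>

definition tail_prob :: "real \<Rightarrow> real" where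
  "tail_prob c = expectation (\<lambda>\<omega>. indicator {y. c < \<bar>y\<bar>} (X 1 \<omega>))"

definition block_max :: "nat \<Rightarrow> nat \<Rightarrow> nat \<Rightarrow> 'a \<Rightarrow> real" where
  "block_max n a N \<omega> = runmax (\<lambda>k. psum a (a + k) \<omega> / sqrt n) N"

lemma block_max_measurable [measurable]: "block_max n a N \<in> borel_measurable M"
  unfolding block_max_def by measurable

text \<open>By \<open>small\<close> and Chebyshev's inequality every \<open>g k\<close> has
  expectation at least 1/2, so the expectation of \<open>f k\<close> is at most twice the product of
  the two expectations. Passing to the expectation of the product costs a covariance, and the sum of
  the products is bounded pointwise. The 8 in \<open>small\<close> is the 4 from Chebyshev's
  inequality at level \<open>l / 2\<close>, divided by 1/2.\<close>

theorem maximal_inequality: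
  assumes C: "\<And>a N. expectation (\<lambda>\<omega>. (psum a (a + N) \<omega>)\<^sup>2) \<le> C * real N"
    and "0 < n" "0 < q" "0 < l" and small: "8 * C * real N \<le> real n * l\<^sup>2"
  shows "expectation (\<lambda>\<omega>. ramp (block_max n a N \<omega> / l - 2))
    \<le> 2 * (expectation (\<lambda>\<omega>. min 1 ((2 / l * (psum a (a + N) \<omega> / sqrt n)) ^ 4))
      + real N * tail_prob (l * sqrt n / (2 * real q)) + real N * (4 / (l\<^sup>2 * real n) * tail q))"
proof -
  let ?r = "sqrt (real n)" and ?c = "l * sqrt n / (2 * real q)"
  have r: "0 < ?r" using assms by simp
  define S where "S x k = block_sum a (a + k) x / ?r" for x k
  define f where "f k x = ramp (runmax (S x) (Suc k) / l - 2) - ramp (runmax (S x) k / l - 2)" for k x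
  define g where "g k x = ramp (2 - 2 * \<bar>block_sum (a + Suc k + q) (a + N) x / ?r\<bar> / l)" for k x
  let ?X = "\<lambda>\<omega> i. X i \<omega>"
  have SX: "S (?X \<omega>) = (\<lambda>k. psum a (a + k) \<omega> / ?r)" for \<omega>
    by (simp add: S_def psum_block_sum fun_eq_iff)
  have X1: "integrable M (\<lambda>\<omega>. indicator {y. ?c < \<bar>y\<bar>} (X j \<omega>) :: real)"
    "expectation (\<lambda>\<omega>. indicator {y. ?c < \<bar>y\<bar>} (X j \<omega>)) = tail_prob ?c" if "1 \<le> j" for j
  proof -
    show "integrable M (\<lambda>\<omega>. indicator {y. ?c < \<bar>y\<bar>} (X j \<omega>) :: real)"
      using rv[OF that] by (intro integrable_const_bound[of _ 1]) auto
    show "expectation (\<lambda>\<omega>. indicator {y. ?c < \<bar>y\<bar>} (X j \<omega>)) = tail_prob ?c"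
      using psum_expectation_eq[of "indicator {y. ?c < \<bar>y\<bar>} :: real \<Rightarrow> real" "j - 1" 1] that psum_single[of 0] psum_single[of "j - 1"]
      by (simp add: tail_prob_def)
  qed
  have f0: "0 \<le> f k x" for k x
    unfolding f_def using ramp_mono[of "runmax (S x) k / l - 2" "runmax (S x) (Suc k) / l - 2"] \<open>0 < l\<close>
    by (simp add: divide_right_mono)
  have f_lip: "\<bar>f k x - f k y\<bar> \<le> 2 / (l * ?r) * l1_dist {a<..a + Suc k} x y" for k x y
  proof -
    have "\<bar>S x i - S y i\<bar> \<le> l1_dist {a<..a + Suc k} x y / ?r" if "i \<le> Suc k" for i
    proof -
      have "\<bar>block_sum a (a + i) x - block_sum a (a + i) y\<bar> \<le> l1_dist {a<..a + Suc k} x y"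
        by (rule order_trans[OF block_sum_lipschitz l1_dist_mono]) (use that in auto)
      then show ?thesis
        using r by (simp add: S_def diff_divide_distrib[symmetric] divide_right_mono)
    qed
    then have rm: "\<bar>runmax (S x) j - runmax (S y) j\<bar> \<le> l1_dist {a<..a + Suc k} x y / ?r" if "j \<le> Suc k" for j
      using that by (intro runmax_lipschitz) auto
    have "\<bar>ramp (runmax (S x) j / l - 2) - ramp (runmax (S y) j / l - 2)\<bar> \<le> l1_dist {a<..a + Suc k} x y / ?r / l" if "j \<le> Suc k" for j
      using divide_right_mono[OF rm[OF that], of l] \<open>0 < l\<close>
      by (intro order_trans[OF ramp_lipschitz]) (simp add: diff_divide_distrib[symmetric])
    from this[OF le_SucI[OF order_refl]] this[OF order_refl] have "\<bar>f k x - f k y\<bar> \<le> 2 * (l1_dist {a<..a + Suc k} x y / ?r / l)"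
      unfolding f_def by linarith
    then show ?thesis by (simp add: mult_ac)
  qed
  have lr: "0 \<le> 2 / (l * ?r)" using r \<open>0 < l\<close> by simp
  have g_lip: "\<bar>g k x - g k y\<bar> \<le> 2 / (l * ?r) * l1_dist {a + Suc k + q<..a + N} x y" for k x y
  proof -
    have "\<bar>\<bar>block_sum (a + Suc k + q) (a + N) x\<bar> - \<bar>block_sum (a + Suc k + q) (a + N) y\<bar>\<bar> \<le> l1_dist {a + Suc k + q<..a + N} x y"
      by (rule order_trans[OF abs_triangle_ineq3 block_sum_lipschitz])
    then have "2 / (l * ?r) * \<bar>\<bar>block_sum (a + Suc k + q) (a + N) x\<bar> - \<bar>block_sum (a + Suc k + q) (a + N) y\<bar>\<bar>
        \<le> 2 / (l * ?r) * l1_dist {a + Suc k + q<..a + N} x y"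
      using r \<open>0 < l\<close> by (intro mult_left_mono) auto
    moreover have "\<bar>(2 - 2 * \<bar>u / ?r\<bar> / l) - (2 - 2 * \<bar>v / ?r\<bar> / l)\<bar> = 2 / (l * ?r) * \<bar>\<bar>u\<bar> - \<bar>v\<bar>\<bar>" for u v
    proof -
      have e: "2 * \<bar>w / ?r\<bar> / l = 2 / (l * ?r) * \<bar>w\<bar>" for w
        by (simp add: abs_divide mult_ac)
      have "(2 - c * p) - (2 - c * p') = c * (p' - p)" for c p p' :: real
        by (simp add: algebra_simps)
      then show ?thesis unfolding e using lr by (simp only: abs_mult abs_of_nonneg abs_minus_commute)
    qed
    ultimately show ?thesis
      unfolding g_def by (metis ramp_lipschitz order_trans)
  qed
  \<comment> \<open>\<open>f k\<close> reads indices up to \<open>a + Suc k\<close>, and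
    \<open>g k\<close> those beyond \<open>a + Suc k + q\<close>. Both constants contain a 2: two
    ramps in \<open>f k\<close>, a doubled slope in \<open>g k\<close>.\<close>
  have idx: "{a<..a + Suc k} \<subseteq> {1..a + Suc k}" "finite {a + Suc k + q<..a + N}"
    "{a + Suc k + q<..a + N} \<subseteq> {a + Suc k + q<..}" for k by auto
  note cov = covariance_tail_bound[OF idx lr f_lip lr g_lip]
  have "0 \<le> expectation (\<lambda>\<omega>. (psum 0 (0 + 1) \<omega>)\<^sup>2)" by (intro integral_nonneg_AE) simp
  then have "0 \<le> C" using order_trans[OF _ C[of 0 1]] by simp
  have g_half: "1 / 2 \<le> expectation (\<lambda>\<omega>. g k (?X \<omega>))" for k
  proof -
    let ?P = "psum (a + Suc k + q) (a + N)"
    have "1 - 4 / (l\<^sup>2 * real n) * (?P \<omega>)\<^sup>2 \<le> g k (?X \<omega>)" for \<omega>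
    proof -
      let ?u = "2 * \<bar>?P \<omega> / ?r\<bar> / l"
      have u: "4 / (l\<^sup>2 * real n) * (?P \<omega>)\<^sup>2 = ?u\<^sup>2"
        by (simp add: power_mult_distrib power_divide)
      have "0 \<le> ?u" using \<open>0 < l\<close> by simp
      \<comment> \<open>Up to 1 the ramp equals 1, and beyond 1 the left side is negative.\<close>
      then have "1 - ?u\<^sup>2 \<le> ramp (2 - ?u)"
        by (cases "?u \<le> 1") (auto simp: ramp_def intro!: max.coboundedI1)
      then show ?thesis unfolding g_def u psum_block_sum[symmetric] .
    qed
    then have "expectation (\<lambda>\<omega>. 1 - 4 / (l\<^sup>2 * real n) * (?P \<omega>)\<^sup>2) \<le> expectation (\<lambda>\<omega>. g k (?X \<omega>))"
      by (intro integral_mono cov(2)) (simp_all add: psum_square_integrable)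
    moreover have "expectation (\<lambda>\<omega>. 1 - 4 / (l\<^sup>2 * real n) * (?P \<omega>)\<^sup>2) = 1 - 4 / (l\<^sup>2 * real n) * expectation (\<lambda>\<omega>. (?P \<omega>)\<^sup>2)"
      by (simp add: psum_square_integrable prob_space)
    moreover have "expectation (\<lambda>\<omega>. (?P \<omega>)\<^sup>2) \<le> C * real N"
    proof (cases "Suc k + q \<le> N")
      case True
      have "expectation (\<lambda>\<omega>. (?P \<omega>)\<^sup>2) \<le> C * real (N - (Suc k + q))"
        using C[of "a + Suc k + q" "N - (Suc k + q)"] True by simp
      also have "\<dots> \<le> C * real N" using \<open>0 \<le> C\<close> by (intro mult_left_mono) auto
      finally show ?thesis .
    next
      case False
      then have "(?P \<omega>)\<^sup>2 = 0" for \<omega> by (simp add: psum_def)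
      moreover have "0 \<le> C * real N" using \<open>0 \<le> C\<close> by simp
      ultimately show ?thesis by simp
    qed
    then have "4 / (l\<^sup>2 * real n) * expectation (\<lambda>\<omega>. (?P \<omega>)\<^sup>2) \<le> 4 / (l\<^sup>2 * real n) * (C * real N)"
      by (intro mult_left_mono) auto
    moreover have "4 / (l\<^sup>2 * real n) * (C * real N) \<le> 1 / 2"
      using small \<open>0 < n\<close> \<open>0 < l\<close> by (simp add: divide_le_eq mult_ac)
    ultimately show ?thesis by linarith
  qed
  let ?E = "\<lambda>\<phi>. expectation (\<lambda>\<omega>. \<phi> (?X \<omega>))"
  \<comment> \<open>The ramp of the running maximum starts at 0, so it is the telescoping sum of the
    \<open>f k\<close>.\<close>
  have "ramp (block_max n a N \<omega> / l - 2) = (\<Sum>k<N. f k (?X \<omega>))" for \<omega>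
  proof -
    have "ramp (block_max n a 0 \<omega> / l - 2) = 0" by (simp add: block_max_def psum_def ramp_def)
    then show ?thesis
      unfolding f_def sum_lessThan_telescope[of "\<lambda>k. ramp (runmax (S (?X \<omega>)) k / l - 2)"]
      by (simp add: SX block_max_def)
  qed
  then have "expectation (\<lambda>\<omega>. ramp (block_max n a N \<omega> / l - 2)) = (\<Sum>k<N. ?E (f k))"
    by (simp add: Bochner_Integration.integral_sum cov(1))
  also have "\<dots> \<le> (\<Sum>k<N. 2 * (?E (f k) * ?E (g k)))"
  proof (rule sum_mono)
    fix k
    have "0 \<le> ?E (f k)" by (intro integral_nonneg_AE AE_I2 f0)
    from mult_left_mono[OF g_half[of k] this] show "?E (f k) \<le> 2 * (?E (f k) * ?E (g k))" by simp
  qed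
  also have "\<dots> \<le> (\<Sum>k<N. 2 * (expectation (\<lambda>\<omega>. f k (?X \<omega>) * g k (?X \<omega>)) + 4 / (l\<^sup>2 * real n) * tail q))"
  proof (intro sum_mono mult_left_mono)
    fix k
    have "2 / (l * ?r) * (2 / (l * ?r)) = 4 / (l\<^sup>2 * real n)"
      by (simp add: power2_eq_square)
    with cov(4)[of k]
    show "?E (f k) * ?E (g k) \<le> expectation (\<lambda>\<omega>. f k (?X \<omega>) * g k (?X \<omega>)) + 4 / (l\<^sup>2 * real n) * tail q"
      by (simp only: abs_le_iff) linarith
  qed simp
  also have "\<dots> = 2 * (expectation (\<lambda>\<omega>. \<Sum>k<N. f k (?X \<omega>) * g k (?X \<omega>)) + real N * (4 / (l\<^sup>2 * real n) * tail q))"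
    by (simp add: Bochner_Integration.integral_sum cov(3) sum.distrib sum_distrib_left[symmetric])
  also have "expectation (\<lambda>\<omega>. \<Sum>k<N. f k (?X \<omega>) * g k (?X \<omega>))
      \<le> expectation (\<lambda>\<omega>. min 1 ((2 / l * (psum a (a + N) \<omega> / ?r)) ^ 4)
          + (\<Sum>j\<in>{a<..a + N}. indicator {y. ?c < \<bar>y\<bar>} (X j \<omega>)))"
  proof (rule integral_mono)
    show "integrable M (\<lambda>\<omega>. \<Sum>k<N. f k (?X \<omega>) * g k (?X \<omega>))"
      by (intro Bochner_Integration.integrable_sum cov(3))
    show "integrable M (\<lambda>\<omega>. min 1 ((2 / l * (psum a (a + N) \<omega> / ?r)) ^ 4)
          + (\<Sum>j\<in>{a<..a + N}. indicator {y. ?c < \<bar>y\<bar>} (X j \<omega>)))"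
      by (intro Bochner_Integration.integrable_add Bochner_Integration.integrable_sum X1)
         (auto intro!: integrable_const_bound[of _ 1])
    fix \<omega>
    show "(\<Sum>k<N. f k (?X \<omega>) * g k (?X \<omega>)) \<le> min 1 ((2 / l * (psum a (a + N) \<omega> / ?r)) ^ 4)
          + (\<Sum>j\<in>{a<..a + N}. indicator {y. ?c < \<bar>y\<bar>} (X j \<omega>))"
      using first_passage_pointwise[OF r \<open>0 < l\<close> \<open>0 < q\<close>, where a = a and N = N and x = "?X \<omega>"]
      unfolding f_def g_def S_def psum_block_sum .
  qed
  also have "\<dots> = expectation (\<lambda>\<omega>. min 1 ((2 / l * (psum a (a + N) \<omega> / ?r)) ^ 4))
      + (\<Sum>j\<in>{a<..a + N}. expectation (\<lambda>\<omega>. indicator {y. ?c < \<bar>y\<bar>} (X j \<omega>)))"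
  proof (subst Bochner_Integration.integral_add)
    show "integrable M (\<lambda>\<omega>. min 1 ((2 / l * (psum a (a + N) \<omega> / ?r)) ^ 4))"
      by (rule integrable_const_bound[of _ 1]) auto
    show "integrable M (\<lambda>\<omega>. \<Sum>j\<in>{a<..a + N}. indicator {y. ?c < \<bar>y\<bar>} (X j \<omega>) :: real)"
      by (intro Bochner_Integration.integrable_sum X1) auto
  qed (subst Bochner_Integration.integral_sum, auto intro!: X1)
  also have "(\<Sum>j\<in>{a<..a + N}. expectation (\<lambda>\<omega>. indicator {y. ?c < \<bar>y\<bar>} (X j \<omega>))) = real N * tail_prob ?c"
    by (simp add: X1)
  finally show ?thesis by simp
qed

text \<open>The integrand is dominated by the square of \<open>X 1\<close> over \<open>c^2\<close>
  and vanishes pointwise for large \<open>n\<close>. This improves the O(1) of Chebyshev's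
  inequality to o(1), so that large summands inside the gaps become negligible.\<close>

lemma tail_prob_limit:
  assumes "0 < c" shows "(\<lambda>n. real n * tail_prob (c * sqrt n)) \<longlonglongrightarrow> 0"
proof -
  have [measurable]: "X 1 \<in> borel_measurable M" by (rule rv) simp
  have "(\<lambda>n. expectation (\<lambda>\<omega>. real n * indicator {y. c * sqrt n < \<bar>y\<bar>} (X 1 \<omega>))) \<longlonglongrightarrow> expectation (\<lambda>_. 0)"
  proof (rule integral_dominated_convergence)
    show "integrable M (\<lambda>\<omega>. (X 1 \<omega>)\<^sup>2 / c\<^sup>2)" using square_integrable by simp
    show "AE \<omega> in M. (\<lambda>n. real n * indicator {y. c * sqrt n < \<bar>y\<bar>} (X 1 \<omega>)) \<longlonglongrightarrow> 0"
    proof (intro AE_I2 tendsto_eventually)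
      fix \<omega>
      have "filterlim (\<lambda>n. sqrt (real n)) at_top sequentially"
        by (intro filterlim_compose[OF sqrt_at_top] filterlim_real_sequentially)
      then have "\<forall>\<^sub>F n in sequentially. \<bar>X 1 \<omega>\<bar> / c < sqrt (real n)"
        by (simp add: filterlim_at_top_dense)
      then show "\<forall>\<^sub>F n in sequentially. real n * indicator {y. c * sqrt n < \<bar>y\<bar>} (X 1 \<omega>) = 0"
        by eventually_elim (use \<open>0 < c\<close> in \<open>auto simp: divide_less_eq mult_ac\<close>)
    qed
    fix n
    show "AE \<omega> in M. norm (real n * indicator {y. c * sqrt n < \<bar>y\<bar>} (X 1 \<omega>)) \<le> (X 1 \<omega>)\<^sup>2 / c\<^sup>2"
    proof (intro AE_I2)
      fix \<omega>
      have "real n \<le> (X 1 \<omega>)\<^sup>2 / c\<^sup>2" if "c * sqrt n < \<bar>X 1 \<omega>\<bar>"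
      proof -
        have "(c * sqrt n)\<^sup>2 \<le> \<bar>X 1 \<omega>\<bar>\<^sup>2" using that \<open>0 < c\<close> by (intro power_mono) auto
        then show ?thesis using \<open>0 < c\<close> by (simp add: power_mult_distrib field_simps)
      qed
      then show "norm (real n * indicator {y. c * sqrt n < \<bar>y\<bar>} (X 1 \<omega>)) \<le> (X 1 \<omega>)\<^sup>2 / c\<^sup>2"
        by (auto simp: indicator_def)
    qed
  qed measurable
  then show ?thesis by (simp add: tail_prob_def)
qed

end

section \<open>Block increments\<close>

text \<open>The number of summands included at time \<open>i / m\<close>, namely the integer part of
  \<open>n * (i / m)\<close>; for positive \<open>m\<close> the last grid point is
  \<open>grid m n m = n\<close>.\<close>

definition grid :: "nat \<Rightarrow> nat \<Rightarrow> nat \<Rightarrow> nat" where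
  "grid m n i = n * i div m"

abbreviation gridlen :: "nat \<Rightarrow> nat \<Rightarrow> nat \<Rightarrow> nat" where
  "gridlen m n i \<equiv> grid m n (Suc i) - grid m n i"

lemma grid_mono: "i \<le> j \<Longrightarrow> grid m n i \<le> grid m n j"
  unfolding grid_def by (intro div_le_mono mult_le_mono2)

lemma grid_0 [simp]: "grid m n 0 = 0"
  by (simp add: grid_def)

lemma grid_Suc: "grid m n (Suc i) = grid m n i + gridlen m n i"
  using grid_mono[of i "Suc i" m n] by simp

context stationary_L_weakly_dependent
begin

definition incr :: "nat \<Rightarrow> nat \<Rightarrow> nat \<Rightarrow> 'a \<Rightarrow> real" where
  "incr m n i \<omega> = psum (grid m n i) (grid m n (Suc i)) \<omega> / sqrt n"

lemma incr_measurable [measurable]: "incr m n i \<in> borel_measurable M"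
  unfolding incr_def by measurable

lemma grid_ratio_tendsto:
  assumes "0 < m" shows "(\<lambda>n. real (grid m n i) / real n) \<longlonglongrightarrow> real i / real m"
  unfolding grid_def
proof (rule nat_div_ratio_tendsto[OF _ assms])
  show "(\<lambda>n. real (n * i) / real n) \<longlonglongrightarrow> real i"
    by (rule tendsto_eventually) (use eventually_gt_at_top[of 0] in \<open>eventually_elim, simp\<close>)
qed

lemma gridlen_ratio_tendsto:
  assumes "0 < m" shows "(\<lambda>n. real (gridlen m n i) / real n) \<longlonglongrightarrow> 1 / real m"
proof -
  have "(\<lambda>n. real (grid m n (Suc i)) / real n - real (grid m n i) / real n) \<longlonglongrightarrow> real (Suc i) / real m - real i / real m"
    by (intro tendsto_diff grid_ratio_tendsto assms)
  then show ?thesis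
    by (simp add: of_nat_diff grid_mono diff_divide_distrib[symmetric])
qed

lemma incr_weak_limit:
  fixes h :: "real \<Rightarrow> real"
  assumes "0 < m" "continuous_on UNIV h" "\<And>x. \<bar>h x\<bar> \<le> B"
  shows "(\<lambda>n. expectation (\<lambda>\<omega>. h (incr m n i \<omega>))) \<longlonglongrightarrow> (\<integral>x. h (\<sigma> * sqrt (1 / real m) * x) \<partial>std_normal_distribution)"
  using psum_weak_limit[OF gridlen_ratio_tendsto[OF assms(1), of i] _ assms(2,3), of "\<lambda>n. grid m n i"]
  by (simp add: incr_def grid_Suc[symmetric])

text \<open>The 3 is the fourth moment of the standard normal law. Below \<open>c\<close> has order
  1 / sqrt m, so \<open>m\<close> such terms total O(1 / m).\<close>

lemma truncated_fourth_moment_le: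
  "(\<integral>x. min 1 ((c * x) ^ 4) \<partial>std_normal_distribution) \<le> 3 * c ^ 4"
proof -
  have 4: "(\<integral>x. x ^ 4 \<partial>std_normal_distribution) = 3"
    using std_normal_distribution_even_moments(1)[of 2] by (simp add: fact_numeral)
  interpret std: real_distribution std_normal_distribution by (rule real_dist_normal_dist)
  have "(\<integral>x. min 1 ((c * x) ^ 4) \<partial>std_normal_distribution) \<le> (\<integral>x. c ^ 4 * x ^ 4 \<partial>std_normal_distribution)"
  proof (rule integral_mono)
    show "integrable std_normal_distribution (\<lambda>x. min 1 ((c * x) ^ 4))"
      by (rule std.integrable_const_bound[of _ 1]) auto
    show "integrable std_normal_distribution (\<lambda>x. c ^ 4 * x ^ 4)"
      using std_normal_distribution_even_moments(2)[of 2] by simp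
  qed (simp add: power_mult_distrib)
  then show ?thesis by (simp add: 4 mult.commute)
qed

theorem tightness:
  assumes "0 < l" "0 < e"
  shows "\<forall>\<^sub>F m in sequentially. \<forall>\<^sub>F n in sequentially.
    (\<Sum>i<m. expectation (\<lambda>\<omega>. ramp (block_max n (grid m n i) (gridlen m n i) \<omega> / l - 2))) < e"
proof -
  obtain C where C: "0 < C" "\<And>a N. expectation (\<lambda>\<omega>. (psum a (a + N) \<omega>)\<^sup>2) \<le> C * real N"
    using psum_moment_bound by blast
  have "(\<lambda>q. 8 / l\<^sup>2 * tail q) \<longlonglongrightarrow> 8 / l\<^sup>2 * 0"
    by (intro tendsto_intros tail_tendsto_0)
  then have "\<forall>\<^sub>F q in sequentially. 8 / l\<^sup>2 * tail q < e / 2 \<and> 0 < q"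
    using eventually_gt_at_top[of 0] order_tendstoD(2)[of "\<lambda>q. 8 / l\<^sup>2 * tail q" 0 _ "e / 2"] \<open>0 < e\<close>
    by (intro eventually_conj) simp_all
  then obtain q where q: "8 / l\<^sup>2 * tail q < e / 2" "0 < q"
    using eventually_happens'[OF sequentially_bot] by blast
  \<comment> \<open>The 6 is the 2 of the maximal inequality times the Gaussian fourth moment
    3.\<close>
  let ?K = "6 * (2 / l * \<sigma>) ^ 4"
  have "(\<lambda>m. ?K * (1 / real m)) \<longlonglongrightarrow> ?K * 0" "(\<lambda>m. 8 * C * (1 / real m)) \<longlonglongrightarrow> 8 * C * 0"
    by (intro tendsto_intros lim_1_over_n)+
  \<comment> \<open>The middle condition is \<open>small\<close> of the maximal inequality in the
    limit of large \<open>n\<close>; being strict, it holds for all large \<open>n\<close>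
    too.\<close>
  then have "\<forall>\<^sub>F m in sequentially. ?K * (1 / real m) < e / 2 \<and> 8 * C * (1 / real m) < l\<^sup>2 \<and> 0 < m"
    using \<open>0 < e\<close> \<open>0 < l\<close> eventually_gt_at_top[of 0]
    by (intro eventually_conj order_tendstoD(2)[where y = 0]) simp_all
  then show ?thesis
  proof eventually_elim
    case (elim m)
    then have m: "?K * (1 / real m) < e / 2" "8 * C * (1 / real m) < l\<^sup>2" "0 < m" by auto
    \<comment> \<open>The right-hand side of \<open>maximal_inequality\<close> for block
      \<open>i\<close>, arranged into factors with known limits in \<open>n\<close>. In the limit
      \<open>L\<close> the term for large summands has disappeared.\<close>
    define b where "b n i = 2 * (expectation (\<lambda>\<omega>. min 1 ((2 / l * incr m n i \<omega>) ^ 4))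
        + (real (gridlen m n i) / n) * (real n * tail_prob (l / (2 * real q) * sqrt n))
        + (real (gridlen m n i) / n) * (4 / l\<^sup>2 * tail q))" for n i
    define L where "L = 2 * ((\<integral>x. min 1 ((2 / l * (\<sigma> * sqrt (1 / real m) * x)) ^ 4) \<partial>std_normal_distribution)
        + (1 / real m) * 0 + (1 / real m) * (4 / l\<^sup>2 * tail q))"
    have "(\<lambda>n. b n i) \<longlonglongrightarrow> L" for i
      unfolding b_def L_def using \<open>0 < l\<close> q(2) m(3)
      by (intro tendsto_intros gridlen_ratio_tendsto tail_prob_limit
            incr_weak_limit[where B = 1 and h = "\<lambda>x. min 1 ((2 / l * x) ^ 4)"] continuous_intros) auto
    then have "(\<lambda>n. \<Sum>i<m. b n i) \<longlonglongrightarrow> (\<Sum>i<m. L)"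
      by (intro tendsto_sum)
    moreover have "(\<Sum>i<m. L) < e"
    proof -
      have "L \<le> 2 * (3 * (2 / l * (\<sigma> * sqrt (1 / real m))) ^ 4 + (1 / real m) * (4 / l\<^sup>2 * tail q))"
        unfolding L_def using truncated_fourth_moment_le[of "2 / l * (\<sigma> * sqrt (1 / real m))"]
        by (simp add: mult_ac)
      also have "(2 / l * (\<sigma> * sqrt (1 / real m))) ^ 4 = (2 / l * \<sigma>) ^ 4 * (1 / real m)\<^sup>2"
      proof -
        have "sqrt (1 / real m) ^ 4 = (sqrt (1 / real m) ^ 2) ^ 2" by (simp only: power_mult[symmetric]) simp
        then have "sqrt (1 / real m) ^ 4 = (1 / real m)\<^sup>2" by simp
        then show ?thesis by (simp only: power_mult_distrib mult.assoc)
      qed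
      finally have "real m * L \<le> real m * (2 * (3 * ((2 / l * \<sigma>) ^ 4 * (1 / real m)\<^sup>2) + (1 / real m) * (4 / l\<^sup>2 * tail q)))"
        by (intro mult_left_mono) auto
      also have "\<dots> = ?K * (1 / real m) + 8 / l\<^sup>2 * tail q"
        using m(3) by (simp add: field_simps power2_eq_square)
      finally show ?thesis using m(1) q(1) by simp
    qed
    ultimately have 1: "\<forall>\<^sub>F n in sequentially. (\<Sum>i<m. b n i) < e"
      by (rule order_tendstoD(2))
    have "\<forall>\<^sub>F n in sequentially. 8 * C * (real (gridlen m n i) / real n) < l\<^sup>2" for i
      using m(2) by (intro order_tendstoD(2)[OF tendsto_mult[OF tendsto_const gridlen_ratio_tendsto[OF m(3)]]])
    then have 2: "\<forall>\<^sub>F n in sequentially. \<forall>i\<in>{..<m}. 8 * C * (real (gridlen m n i) / real n) < l\<^sup>2"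
      by (intro eventually_ball_finite) auto
    from 1 2 eventually_gt_at_top[of 0] show ?case
    proof eventually_elim
      fix n assume n: "(\<Sum>i<m. b n i) < e" "\<forall>i\<in>{..<m}. 8 * C * (real (gridlen m n i) / real n) < l\<^sup>2" "0 < n"
      have "(\<Sum>i<m. expectation (\<lambda>\<omega>. ramp (block_max n (grid m n i) (gridlen m n i) \<omega> / l - 2))) \<le> (\<Sum>i<m. b n i)"
      proof (rule sum_mono)
        fix i assume "i \<in> {..<m}"
        then have "8 * C * real (gridlen m n i) \<le> real n * l\<^sup>2"
          using n by (force simp: pos_divide_less_eq mult_ac)
        from maximal_inequality[OF C(2) n(3) q(2) \<open>0 < l\<close> this, of "grid m n i"]
        show "expectation (\<lambda>\<omega>. ramp (block_max n (grid m n i) (gridlen m n i) \<omega> / l - 2)) \<le> b n i"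
          using n(3) by (simp add: b_def incr_def grid_Suc[symmetric] mult_ac)
      qed
      then show "(\<Sum>i<m. expectation (\<lambda>\<omega>. ramp (block_max n (grid m n i) (gridlen m n i) \<omega> / l - 2))) < e"
        using n(1) by linarith
    qed
  qed
qed

lemma l1_dist_blocks: "(\<Sum>i<k. l1_dist {grid m n i<..grid m n (Suc i)} x y) = l1_dist {0<..grid m n k} x y"
proof (induction k)
  case (Suc k)
  then show ?case
    using block_sum_split[of 0 "grid m n k" "grid m n (Suc k)" "\<lambda>j. \<bar>x j - y j\<bar>"] grid_mono[of k "Suc k" m n]
    by (simp add: l1_dist_def block_sum_def)
qed (simp add: l1_dist_def)

text \<open>Induction on \<open>k\<close>, splitting off the last factor. The factors take values in
  [0,1] and read disjoint blocks, so the product of the earlier ones has the same Lipschitz constant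
  \<open>A / sqrt n\<close> as each of them, however many there are; each step costs one covariance
  across adjacent blocks.\<close>

lemma incr_product_factorises:
  assumes "0 \<le> A" and f01: "\<And>i u. 0 \<le> f i u" "\<And>i u. f i u \<le> 1"
    and lip: "\<And>i u v. \<bar>f i u - f i v\<bar> \<le> A * \<bar>u - v\<bar>" and "0 < n"
  shows "\<bar>expectation (\<lambda>\<omega>. \<Prod>i<k. f i (incr m n i \<omega>)) - (\<Prod>i<k. expectation (\<lambda>\<omega>. f i (incr m n i \<omega>)))\<bar>
    \<le> real k * (A\<^sup>2 / n * tail 0)"
proof (induction k)
  case (Suc k)
  define D where "D i x = block_sum (grid m n i) (grid m n (Suc i)) x / sqrt n" for i x
  let ?X = "\<lambda>\<omega> i. X i \<omega>"
  have DX: "D i (?X \<omega>) = incr m n i \<omega>" for i \<omega>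
    by (simp add: D_def incr_def psum_block_sum)
  have f_lip: "\<bar>f i (D i x) - f i (D i y)\<bar> \<le> A / sqrt n * l1_dist {grid m n i<..grid m n (Suc i)} x y" for i x y
  proof -
    have "\<bar>f i (u / sqrt n) - f i (v / sqrt n)\<bar> \<le> A / sqrt n * \<bar>u - v\<bar>" for u v
      using lip[of i "u / sqrt n" "v / sqrt n"] by (simp add: diff_divide_distrib[symmetric] abs_divide)
    from lipschitz_block_sum_compose[of "\<lambda>u. f i (u / sqrt n)", OF this] show ?thesis
      using \<open>0 \<le> A\<close> by (simp add: D_def)
  qed
  have P_lip: "\<bar>(\<Prod>i<k. f i (D i x)) - (\<Prod>i<k. f i (D i y))\<bar> \<le> A / sqrt n * l1_dist {0<..grid m n k} x y" for x y
  proof -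
    have "\<bar>(\<Prod>i<k. f i (D i x)) - (\<Prod>i<k. f i (D i y))\<bar> \<le> (\<Sum>i<k. \<bar>f i (D i x) - f i (D i y)\<bar>)"
      using norm_prod_diff[of "{..<k}" "\<lambda>i. f i (D i x)" "\<lambda>i. f i (D i y)"] f01 by simp
    also have "\<dots> \<le> (\<Sum>i<k. A / sqrt n * l1_dist {grid m n i<..grid m n (Suc i)} x y)"
      by (intro sum_mono f_lip)
    finally show ?thesis by (simp only: sum_distrib_left[symmetric] l1_dist_blocks)
  qed
  have sub: "{0<..grid m n k} \<subseteq> {1..grid m n k}" "finite {grid m n k<..grid m n (Suc k)}"
    "{grid m n k<..grid m n (Suc k)} \<subseteq> {grid m n k + 0<..}" by auto
  have A: "0 \<le> A / sqrt n" using \<open>0 \<le> A\<close> by simp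
  have AA: "A / sqrt n * (A / sqrt n) * tail 0 = A\<^sup>2 / n * tail 0"
    by (simp add: power2_eq_square)
  let ?P = "expectation (\<lambda>\<omega>. \<Prod>i<k. f i (incr m n i \<omega>))" and ?Q = "\<Prod>i<k. expectation (\<lambda>\<omega>. f i (incr m n i \<omega>))"
    and ?f = "expectation (\<lambda>\<omega>. f k (incr m n k \<omega>))"
  have 1: "\<bar>expectation (\<lambda>\<omega>. (\<Prod>i<k. f i (incr m n i \<omega>)) * f k (incr m n k \<omega>)) - ?P * ?f\<bar> \<le> A\<^sup>2 / n * tail 0"
    using covariance_tail_bound(4)[OF sub A P_lip A f_lip] unfolding AA DX .
  \<comment> \<open>With the new expectation in [0,1], multiplying by it does not enlarge the error
    of the induction hypothesis.\<close>
  have "0 \<le> ?f" "?f \<le> 1"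
    using covariance_tail_bound(2)[OF sub A P_lip A f_lip] f01
    by (auto simp: DX intro!: integral_nonneg_AE integral_le_const)
  then have "\<bar>?P * ?f - ?Q * ?f\<bar> \<le> \<bar>?P - ?Q\<bar>"
    using mult_left_le[of ?f "\<bar>?P - ?Q\<bar>"] by (simp add: left_diff_distrib[symmetric] abs_mult)
  with 1 Suc have "\<bar>expectation (\<lambda>\<omega>. (\<Prod>i<k. f i (incr m n i \<omega>)) * f k (incr m n k \<omega>)) - ?Q * ?f\<bar>
      \<le> real (Suc k) * (A\<^sup>2 / n * tail 0)"
    unfolding of_nat_Suc distrib_right mult_1_left by linarith
  then show ?case by simp
qed (simp add: prob_space)

theorem incr_product_limit:
  assumes "0 < m" "0 \<le> A" and f01: "\<And>i u. 0 \<le> f i u" "\<And>i u. f i u \<le> 1"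
    and lip: "\<And>i u v. \<bar>f i u - f i v\<bar> \<le> A * \<bar>u - v\<bar>"
  shows "(\<lambda>n. expectation (\<lambda>\<omega>. \<Prod>i<m. f i (incr m n i \<omega>)))
    \<longlonglongrightarrow> (\<Prod>i<m. \<integral>x. f i (\<sigma> * sqrt (1 / real m) * x) \<partial>std_normal_distribution)"
proof -
  have cont: "continuous_on UNIV (f i)" for i
  proof -
    have "A-lipschitz_on UNIV (f i)"
      using lip \<open>0 \<le> A\<close> by (intro lipschitz_onI) (auto simp: dist_real_def)
    then show ?thesis by (rule lipschitz_on_continuous_on)
  qed
  have "(\<lambda>n. expectation (\<lambda>\<omega>. \<Prod>i<m. f i (incr m n i \<omega>)) - (\<Prod>i<m. expectation (\<lambda>\<omega>. f i (incr m n i \<omega>)))) \<longlonglongrightarrow> 0"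
  proof (rule Lim_null_comparison)
    have "(\<lambda>n. real m * A\<^sup>2 * tail 0 * (1 / real n)) \<longlonglongrightarrow> real m * A\<^sup>2 * tail 0 * 0"
      by (intro tendsto_intros lim_1_over_n)
    then show "(\<lambda>n. real m * A\<^sup>2 * tail 0 * (1 / real n)) \<longlonglongrightarrow> 0" by simp
    show "\<forall>\<^sub>F n in sequentially. norm (expectation (\<lambda>\<omega>. \<Prod>i<m. f i (incr m n i \<omega>)) - (\<Prod>i<m. expectation (\<lambda>\<omega>. f i (incr m n i \<omega>))))
        \<le> real m * A\<^sup>2 * tail 0 * (1 / real n)"
      using eventually_gt_at_top[of 0]
      by eventually_elim (use incr_product_factorises[OF \<open>0 \<le> A\<close> f01 lip, where k = m and m = m] in \<open>simp add: mult_ac\<close>)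
  qed
  moreover have "(\<lambda>n. \<Prod>i<m. expectation (\<lambda>\<omega>. f i (incr m n i \<omega>)))
      \<longlonglongrightarrow> (\<Prod>i<m. \<integral>x. f i (\<sigma> * sqrt (1 / real m) * x) \<partial>std_normal_distribution)"
    using f01 by (intro tendsto_prod incr_weak_limit[where B = 1] cont assms(1)) (auto simp: abs_le_iff intro: order_trans[of _ 0])
  ultimately show ?thesis
    using tendsto_add by fastforce
qed

end

section \<open>Product test functions\<close>

text \<open>Sequences carry the product topology, in which only finitely many coordinates can be
  controlled at once. The continuity mostly serves to prove Borel measurability.\<close>

lemma l1_lipschitz_continuous:
  fixes F :: "(nat \<Rightarrow> real) \<Rightarrow> 'c::metric_space"
  assumes "finite I" and lip: "\<And>x y. dist (F x) (F y) \<le> L * l1_dist I x y"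
  shows "continuous_on UNIV F"
  unfolding continuous_on_def
proof
  fix x :: "nat \<Rightarrow> real"
  have coord: "((\<lambda>y. y i) \<longlongrightarrow> x i) (at x)" for i
    using continuous_on_product_coordinates[of i, where ?'b = real] unfolding continuous_on_def by simp
  have "((\<lambda>y. L * (\<Sum>i\<in>I. \<bar>y i - x i\<bar>)) \<longlongrightarrow> L * (\<Sum>i\<in>I. \<bar>x i - x i\<bar>)) (at x)"
    by (intro tendsto_intros coord)
  then have "((\<lambda>y. L * l1_dist I y x) \<longlongrightarrow> 0) (at x)" by (simp add: l1_dist_def)
  then have "((\<lambda>y. dist (F y) (F x)) \<longlongrightarrow> 0) (at x)"
    by (rule Lim_null_comparison[rotated]) (use lip in simp)
  then show "(F \<longlongrightarrow> F x) (at x within UNIV)" by (subst tendsto_dist_iff) simp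
qed

definition tent :: "real \<Rightarrow> real" where
  "tent u = ramp (1 - \<bar>u\<bar>)"

lemma tent_bounds: "0 \<le> tent u" "tent u \<le> 1"
  by (simp_all add: tent_def ramp_bounds)

lemma tent_lipschitz: "\<bar>tent u - tent v\<bar> \<le> \<bar>u - v\<bar>"
  unfolding tent_def using ramp_lipschitz[of "1 - \<bar>u\<bar>" "1 - \<bar>v\<bar>"] by linarith

lemma tent_measurable [measurable]: "tent \<in> borel_measurable borel"
  unfolding tent_def by measurable

text \<open>The integer translates of \<open>tent\<close> form a partition of unity of the line,
  here truncated to a finite sum.\<close>

definition tent_sum :: "int \<Rightarrow> real \<Rightarrow> real" where
  "tent_sum K u = (\<Sum>k\<in>{- K..K}. tent (u - of_int k))"

text \<open>At \<open>u\<close> only the translates centred at \<open>\<lfloor>u\<rfloor>\<close>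
  and \<open>\<lfloor>u\<rfloor> + 1\<close> can be nonzero, and they add up to 1. Both survive the
  truncation if \<open>\<bar>u\<bar> < K\<close>; otherwise the last bound is trivial. It is
  quadratic so that second moments control the lost mass.\<close>

lemma tent_sum_bounds:
  assumes "0 < K"
  shows "0 \<le> tent_sum K u" "tent_sum K u \<le> 1" "1 - tent_sum K u \<le> (u / of_int K)\<^sup>2"
proof -
  let ?f = "\<lambda>k::int. tent (u - of_int k)"
  let ?P = "{\<lfloor>u\<rfloor>, \<lfloor>u\<rfloor> + 1}"
  have zero: "?f k = 0" if "k \<notin> ?P" for k
  proof -
    from that have "k < \<lfloor>u\<rfloor> \<or> \<lfloor>u\<rfloor> + 1 < k" by auto
    then have "1 \<le> \<bar>u - of_int k\<bar>" by linarith
    then show ?thesis by (simp add: tent_def ramp_def)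
  qed
  have one: "sum ?f ?P = 1"
  proof -
    have "0 \<le> u - of_int \<lfloor>u\<rfloor>" "u - of_int \<lfloor>u\<rfloor> < 1" by linarith+
    then have "tent (u - of_int \<lfloor>u\<rfloor>) = 1 - (u - of_int \<lfloor>u\<rfloor>)" "tent (u - of_int (\<lfloor>u\<rfloor> + 1)) = u - of_int \<lfloor>u\<rfloor>"
      unfolding tent_def ramp_def of_int_add of_int_1 by linarith+
    then show ?thesis by simp
  qed
  show "0 \<le> tent_sum K u" unfolding tent_sum_def by (intro sum_nonneg tent_bounds)
  have "tent_sum K u = sum ?f ({- K..K} \<inter> ?P)"
    unfolding tent_sum_def by (rule sum.mono_neutral_right) (auto simp: zero)
  also have "\<dots> \<le> sum ?f ?P" by (rule sum_mono2) (auto simp: tent_bounds)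
  finally show "tent_sum K u \<le> 1" by (simp only: one)
  show "1 - tent_sum K u \<le> (u / of_int K)\<^sup>2"
  proof (cases "\<bar>u\<bar> < of_int K")
    case True
    then have "?P \<subseteq> {- K..K}" by (simp add: abs_less_iff) linarith
    then have "sum ?f ?P \<le> tent_sum K u"
      unfolding tent_sum_def by (intro sum_mono2) (auto simp: tent_bounds)
    then show ?thesis unfolding one using zero_le_power2[of "u / of_int K"] by linarith
  next
    case False
    then have "1 \<le> \<bar>u / of_int K\<bar>" using \<open>0 < K\<close> by (simp add: le_divide_eq)
    then have "1 \<le> \<bar>u / of_int K\<bar>\<^sup>2" by (rule one_le_power)
    then have "1 \<le> (u / of_int K)\<^sup>2" unfolding power2_abs .
    then show ?thesis using \<open>0 \<le> tent_sum K u\<close> by linarith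
  qed
qed

text \<open>Multilinear interpolation of \<open>G\<close> on a lattice of mesh \<open>h\<close>, cut
  off outside a cube: a finite combination of products of one-variable Lipschitz functions with
  values in [0,1].\<close>

definition tent_interpolant :: "nat \<Rightarrow> int \<Rightarrow> real \<Rightarrow> ((nat \<Rightarrow> real) \<Rightarrow> real) \<Rightarrow> (nat \<Rightarrow> real) \<Rightarrow> real" where
  "tent_interpolant m K h G x =
     (\<Sum>\<kappa>\<in>{..<m} \<rightarrow>\<^sub>E {- K..K}. G (\<lambda>i. h * of_int (\<kappa> i)) * (\<Prod>i<m. tent (x i / h - of_int (\<kappa> i))))"

text \<open>Nodes with nonzero weight lie within \<open>h\<close> of \<open>x\<close> in every
  coordinate, which gives the first error. The second is the weight missing from 1 because of the
  cut-off; by distributivity the total weight is a product of one-dimensional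
  \<open>tent_sum\<close>s.\<close>

lemma tent_interpolant_approx:
  assumes "0 < K" "0 < h" and B: "\<And>x. \<bar>G x\<bar> \<le> B" and lip: "\<And>x y. \<bar>G x - G y\<bar> \<le> L * l1_dist {..<m} x y" and "0 \<le> L"
  shows "\<bar>G x - tent_interpolant m K h G x\<bar> \<le> L * real m * h + B * (\<Sum>i<m. (x i)\<^sup>2) / (h * of_int K)\<^sup>2"
proof -
  let ?I = "{..<m} \<rightarrow>\<^sub>E {- K..K}"
  let ?w = "\<lambda>\<kappa>. \<Prod>i<m. tent (x i / h - of_int (\<kappa> i))"
  have B0: "0 \<le> B" using B[of x] by linarith
  have w0: "0 \<le> ?w \<kappa>" for \<kappa> by (intro prod_nonneg) (simp add: tent_bounds)
  have \<theta>: "(\<Sum>\<kappa>\<in>?I. ?w \<kappa>) = (\<Prod>i<m. tent_sum K (x i / h))"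
    unfolding tent_sum_def by (subst prod_sum_PiE) auto
  have "\<bar>(\<Prod>i<m. 1) - (\<Prod>i<m. tent_sum K (x i / h))\<bar> \<le> (\<Sum>i<m. \<bar>1 - tent_sum K (x i / h)\<bar>)"
    using norm_prod_diff[of "{..<m}" "\<lambda>_. 1" "\<lambda>i. tent_sum K (x i / h)"] tent_sum_bounds[OF \<open>0 < K\<close>] by simp
  also have "\<dots> \<le> (\<Sum>i<m. (x i / h / of_int K)\<^sup>2)"
    using tent_sum_bounds[OF \<open>0 < K\<close>] by (intro sum_mono) (simp del: divide_divide_eq_left)
  also have "\<dots> = (\<Sum>i<m. (x i)\<^sup>2) / (h * of_int K)\<^sup>2"
    by (simp add: sum_divide_distrib power_divide)
  finally have \<theta>1: "\<bar>1 - (\<Sum>\<kappa>\<in>?I. ?w \<kappa>)\<bar> \<le> (\<Sum>i<m. (x i)\<^sup>2) / (h * of_int K)\<^sup>2"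
    by (simp add: \<theta>)
  have \<theta>le: "(\<Sum>\<kappa>\<in>?I. ?w \<kappa>) \<le> 1"
    unfolding \<theta> using tent_sum_bounds[OF \<open>0 < K\<close>] by (intro prod_le_1) auto
  have summand: "\<bar>G x - G (\<lambda>i. h * of_int (\<kappa> i))\<bar> * ?w \<kappa> \<le> L * real m * h * ?w \<kappa>" for \<kappa>
  proof (cases "?w \<kappa> = 0")
    case False
    have "\<bar>x i - h * of_int (\<kappa> i)\<bar> \<le> h" if "i < m" for i
    proof -
      from False that have "tent (x i / h - of_int (\<kappa> i)) \<noteq> 0" by auto
      then have "\<bar>x i / h - of_int (\<kappa> i)\<bar> \<le> 1" by (auto simp: tent_def ramp_def max_def split: if_splits)
      moreover have "x i - h * of_int (\<kappa> i) = h * (x i / h - of_int (\<kappa> i))"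
        using \<open>0 < h\<close> by (simp add: right_diff_distrib)
      ultimately show ?thesis
        using \<open>0 < h\<close> mult_left_mono[of "\<bar>x i / h - of_int (\<kappa> i)\<bar>" 1 h] by (simp add: abs_mult)
    qed
    then have "l1_dist {..<m} x (\<lambda>i. h * of_int (\<kappa> i)) \<le> real m * h"
      unfolding l1_dist_def using sum_bounded_above[of "{..<m}" "\<lambda>i. \<bar>x i - h * of_int (\<kappa> i)\<bar>" h] by simp
    then have "\<bar>G x - G (\<lambda>i. h * of_int (\<kappa> i))\<bar> \<le> L * (real m * h)"
      using lip[of x "\<lambda>i. h * of_int (\<kappa> i)"] mult_left_mono[OF _ \<open>0 \<le> L\<close>] order_trans by blast
    then show ?thesis using w0[of \<kappa>] by (intro mult_right_mono) (simp_all add: mult.assoc)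
  next
    case True
    show ?thesis by (simp only: True mult_zero_right order_refl)
  qed
  have "G x - tent_interpolant m K h G x = G x * (1 - (\<Sum>\<kappa>\<in>?I. ?w \<kappa>)) + (\<Sum>\<kappa>\<in>?I. (G x - G (\<lambda>i. h * of_int (\<kappa> i))) * ?w \<kappa>)"
    unfolding tent_interpolant_def by (simp add: left_diff_distrib sum_subtractf right_diff_distrib sum_distrib_left)
  then have "\<bar>G x - tent_interpolant m K h G x\<bar>
      \<le> \<bar>G x\<bar> * \<bar>1 - (\<Sum>\<kappa>\<in>?I. ?w \<kappa>)\<bar> + \<bar>\<Sum>\<kappa>\<in>?I. (G x - G (\<lambda>i. h * of_int (\<kappa> i))) * ?w \<kappa>\<bar>"
    using abs_triangle_ineq[of "G x * (1 - (\<Sum>\<kappa>\<in>?I. ?w \<kappa>))"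
        "\<Sum>\<kappa>\<in>?I. (G x - G (\<lambda>i. h * of_int (\<kappa> i))) * ?w \<kappa>"] by (simp only: abs_mult)
  also have "\<dots> \<le> B * ((\<Sum>i<m. (x i)\<^sup>2) / (h * of_int K)\<^sup>2) + (\<Sum>\<kappa>\<in>?I. L * real m * h * ?w \<kappa>)"
  proof (intro add_mono mult_mono B \<theta>1 B0)
    have "\<bar>\<Sum>\<kappa>\<in>?I. (G x - G (\<lambda>i. h * of_int (\<kappa> i))) * ?w \<kappa>\<bar> \<le> (\<Sum>\<kappa>\<in>?I. \<bar>(G x - G (\<lambda>i. h * of_int (\<kappa> i))) * ?w \<kappa>\<bar>)"
      by (rule sum_abs)
    also have "\<dots> \<le> (\<Sum>\<kappa>\<in>?I. L * real m * h * ?w \<kappa>)"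
      using summand w0 by (intro sum_mono) (simp add: abs_mult)
    finally show "\<bar>\<Sum>\<kappa>\<in>?I. (G x - G (\<lambda>i. h * of_int (\<kappa> i))) * ?w \<kappa>\<bar> \<le> (\<Sum>\<kappa>\<in>?I. L * real m * h * ?w \<kappa>)" .
  qed simp
  also have "(\<Sum>\<kappa>\<in>?I. L * real m * h * ?w \<kappa>) \<le> L * real m * h"
    unfolding sum_distrib_left[symmetric] using \<theta>le \<open>0 \<le> L\<close> \<open>0 < h\<close> by (intro mult_left_le) auto
  finally show ?thesis by simp
qed

lemma (in prob_space) tent_interpolant_expectation:
  fixes D :: "nat \<Rightarrow> 'a \<Rightarrow> real"
  assumes [measurable]: "\<And>i. i < m \<Longrightarrow> D i \<in> borel_measurable M"
    and sq: "\<And>i. i < m \<Longrightarrow> integrable M (\<lambda>\<omega>. (D i \<omega>)\<^sup>2)" "\<And>i. i < m \<Longrightarrow> expectation (\<lambda>\<omega>. (D i \<omega>)\<^sup>2) \<le> V"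
    and "0 < K" "0 < h" and B: "\<And>x. \<bar>G x\<bar> \<le> B" and lip: "\<And>x y. \<bar>G x - G y\<bar> \<le> L * l1_dist {..<m} x y" and "0 \<le> L"
  shows "expectation (\<lambda>\<omega>. tent_interpolant m K h G (\<lambda>i. D i \<omega>))
      = (\<Sum>\<kappa>\<in>{..<m} \<rightarrow>\<^sub>E {- K..K}. G (\<lambda>i. h * of_int (\<kappa> i)) * expectation (\<lambda>\<omega>. \<Prod>i<m. tent (D i \<omega> / h - of_int (\<kappa> i))))" (is ?eq)
    and "\<bar>expectation (\<lambda>\<omega>. G (\<lambda>i. D i \<omega>)) - expectation (\<lambda>\<omega>. tent_interpolant m K h G (\<lambda>i. D i \<omega>))\<bar>
      \<le> L * real m * h + B * (real m * V) / (h * of_int K)\<^sup>2" (is ?le)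
proof -
  have int: "integrable M (\<lambda>\<omega>. \<Prod>i<m. tent (D i \<omega> / h - of_int (\<kappa> i)))" for \<kappa>
  proof (rule integrable_const_bound[of _ 1])
    show "(\<lambda>\<omega>. \<Prod>i<m. tent (D i \<omega> / h - of_int (\<kappa> i))) \<in> borel_measurable M"
      by (intro borel_measurable_prod) simp
    show "AE \<omega> in M. norm (\<Prod>i<m. tent (D i \<omega> / h - of_int (\<kappa> i))) \<le> 1"
      by (intro AE_I2) (auto simp: abs_prod tent_bounds intro!: prod_le_1)
  qed
  have int_t: "integrable M (\<lambda>\<omega>. tent_interpolant m K h G (\<lambda>i. D i \<omega>))"
    unfolding tent_interpolant_def by (intro Bochner_Integration.integrable_sum integrable_mult_right int)
  show ?eq
    unfolding tent_interpolant_def by (subst Bochner_Integration.integral_sum) (simp_all add: int)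
  have "continuous_on UNIV G"
    using lip by (intro l1_lipschitz_continuous[of "{..<m}" _ L]) (simp_all add: dist_real_def)
  then have [measurable]: "G \<in> borel_measurable borel" by (rule borel_measurable_continuous_onI)
  \<comment> \<open>\<open>D i\<close> is known to be measurable only for \<open>i < m\<close>. The
    other coordinates are set to 0, which \<open>G\<close> cannot notice.\<close>
  have "(\<lambda>\<omega> i. if i < m then D i \<omega> else 0) \<in> borel_measurable M"
  proof (rule measurable_coordinatewise_then_product)
    fix i show "(\<lambda>\<omega>. if i < m then D i \<omega> else 0) \<in> borel_measurable M" by (cases "i < m") simp_all
  qed
  then have "(\<lambda>\<omega>. G (\<lambda>i. if i < m then D i \<omega> else 0)) \<in> borel_measurable M" by simp
  also have "(\<lambda>\<omega>. G (\<lambda>i. if i < m then D i \<omega> else 0)) = (\<lambda>\<omega>. G (\<lambda>i. D i \<omega>))"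
  proof
    fix \<omega> show "G (\<lambda>i. if i < m then D i \<omega> else 0) = G (\<lambda>i. D i \<omega>)"
      using lip[of "\<lambda>i. if i < m then D i \<omega> else 0" "\<lambda>i. D i \<omega>"] by (simp add: l1_dist_def)
  qed
  finally have int_G: "integrable M (\<lambda>\<omega>. G (\<lambda>i. D i \<omega>))"
    using B by (intro integrable_const_bound[of _ B]) auto
  have B0: "0 \<le> B" using B[of undefined] by linarith
  have "\<bar>expectation (\<lambda>\<omega>. G (\<lambda>i. D i \<omega>)) - expectation (\<lambda>\<omega>. tent_interpolant m K h G (\<lambda>i. D i \<omega>))\<bar>
      = \<bar>expectation (\<lambda>\<omega>. G (\<lambda>i. D i \<omega>) - tent_interpolant m K h G (\<lambda>i. D i \<omega>))\<bar>"
    by (simp add: int_G int_t)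
  also have "\<dots> \<le> expectation (\<lambda>\<omega>. \<bar>G (\<lambda>i. D i \<omega>) - tent_interpolant m K h G (\<lambda>i. D i \<omega>)\<bar>)"
    by (rule integral_abs_bound)
  also have "\<dots> \<le> expectation (\<lambda>\<omega>. L * real m * h + B * (\<Sum>i<m. (D i \<omega>)\<^sup>2) / (h * of_int K)\<^sup>2)"
    by (intro integral_mono integrable_abs Bochner_Integration.integrable_diff int_G int_t
          tent_interpolant_approx[OF \<open>0 < K\<close> \<open>0 < h\<close> B lip \<open>0 \<le> L\<close>] Bochner_Integration.integrable_add
          integrable_divide integrable_mult_right Bochner_Integration.integrable_sum sq(1)) auto
  also have "\<dots> = L * real m * h + B * (\<Sum>i<m. expectation (\<lambda>\<omega>. (D i \<omega>)\<^sup>2)) / (h * of_int K)\<^sup>2"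
  proof -
    have "integrable M (\<lambda>\<omega>. B * (\<Sum>i<m. (D i \<omega>)\<^sup>2) / (h * of_int K)\<^sup>2)"
      by (intro integrable_divide integrable_mult_right Bochner_Integration.integrable_sum sq(1)) auto
    then show ?thesis by (simp add: sq(1) prob_space Bochner_Integration.integral_sum)
  qed
  also have "\<dots> \<le> L * real m * h + B * (real m * V) / (h * of_int K)\<^sup>2"
    using sum_bounded_above[of "{..<m}" "\<lambda>i. expectation (\<lambda>\<omega>. (D i \<omega>)\<^sup>2)" V] sq(2) B0
    by (intro add_mono order_refl divide_right_mono mult_left_mono) auto
  finally show ?le .
qed

text \<open>The common bound \<open>V\<close> makes the interpolation error uniform in
  \<open>n\<close> and valid for the limit as well; the interpolant itself is a finite sum of
  products.\<close>

theorem product_convergence_imp_lipschitz_convergence: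
  fixes D :: "nat \<Rightarrow> nat \<Rightarrow> 'a \<Rightarrow> real" and Z :: "nat \<Rightarrow> 'b \<Rightarrow> real"
  assumes "prob_space M" "prob_space N"
    and D: "\<And>n i. i < m \<Longrightarrow> D n i \<in> borel_measurable M" "\<And>n i. i < m \<Longrightarrow> integrable M (\<lambda>\<omega>. (D n i \<omega>)\<^sup>2)"
      "\<And>n i. i < m \<Longrightarrow> (\<integral>\<omega>. (D n i \<omega>)\<^sup>2 \<partial>M) \<le> V"
    and Z: "\<And>i. i < m \<Longrightarrow> Z i \<in> borel_measurable N" "\<And>i. i < m \<Longrightarrow> integrable N (\<lambda>\<omega>. (Z i \<omega>)\<^sup>2)"
      "\<And>i. i < m \<Longrightarrow> (\<integral>\<omega>. (Z i \<omega>)\<^sup>2 \<partial>N) \<le> V"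
    and prod: "\<And>f A. 0 \<le> A \<Longrightarrow> (\<And>i u. 0 \<le> f i u) \<Longrightarrow> (\<And>i u. f i u \<le> 1) \<Longrightarrow> (\<And>i u v. \<bar>f i u - f i v\<bar> \<le> A * \<bar>u - v\<bar>) \<Longrightarrow>
      (\<lambda>n. \<integral>\<omega>. (\<Prod>i<m. f i (D n i \<omega>)) \<partial>M) \<longlonglongrightarrow> (\<integral>\<omega>. (\<Prod>i<m. f i (Z i \<omega>)) \<partial>N)"
    and B: "\<And>x. \<bar>G x\<bar> \<le> B" and lip: "\<And>x y. \<bar>G x - G y\<bar> \<le> L * l1_dist {..<m} x y" and "0 \<le> L"
  shows "(\<lambda>n. \<integral>\<omega>. G (\<lambda>i. D n i \<omega>) \<partial>M) \<longlonglongrightarrow> (\<integral>\<omega>. G (\<lambda>i. Z i \<omega>) \<partial>N)"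
proof (rule tendstoI)
  interpret M: prob_space M by fact
  interpret N: prob_space N by fact
  fix e :: real assume "0 < e"
  \<comment> \<open>Each law incurs at most \<open>e / 8\<close> from the mesh and less than
    \<open>e / 8\<close> from the cut-off; with \<open>e / 4\<close> for the interpolants the total
    stays below \<open>e\<close>. The added 1 avoids a zero denominator.\<close>
  define h where "h = e / (8 * (L * real m + 1))"
  have "0 \<le> L * real m" using \<open>0 \<le> L\<close> by simp
  then have h: "0 < h" "L * real m * h \<le> e / 8"
    using \<open>0 < e\<close> by (auto simp: h_def divide_simps)
  have "(\<lambda>K. B * (real m * V) / h\<^sup>2 * (1 / real K)\<^sup>2) \<longlonglongrightarrow> B * (real m * V) / h\<^sup>2 * 0\<^sup>2"
    by (intro tendsto_intros lim_1_over_n)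
  then have "\<forall>\<^sub>F K in sequentially. B * (real m * V) / h\<^sup>2 * (1 / real K)\<^sup>2 < e / 8 \<and> 0 < K"
    using \<open>0 < e\<close> eventually_gt_at_top[of 0] by (intro eventually_conj order_tendstoD(2)[where y = 0]) simp_all
  then obtain K0 :: nat where K0: "B * (real m * V) / h\<^sup>2 * (1 / real K0)\<^sup>2 < e / 8" "0 < K0"
    using eventually_happens'[OF sequentially_bot] by blast
  define K where "K = int K0"
  have K: "0 < K" "B * (real m * V) / (h * of_int K)\<^sup>2 < e / 8"
    using K0 by (simp_all add: K_def power_mult_distrib power_divide)
  let ?T = "tent_interpolant m K h G"
  let ?sum = "\<lambda>E. \<Sum>\<kappa>\<in>{..<m} \<rightarrow>\<^sub>E {- K..K}. G (\<lambda>i. h * of_int (\<kappa> i)) * E (\<lambda>x. \<Prod>i<m. tent (x i / h - of_int (\<kappa> i)))"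
  note bounds = K(1) h(1) B lip \<open>0 \<le> L\<close>
  have DM1: "(\<integral>\<omega>. ?T (\<lambda>i. D n i \<omega>) \<partial>M) = ?sum (\<lambda>\<phi>. \<integral>\<omega>. \<phi> (\<lambda>i. D n i \<omega>) \<partial>M)" for n
    using M.tent_interpolant_expectation(1)[of m "D n", OF D bounds] .
  have DM2: "\<bar>(\<integral>\<omega>. G (\<lambda>i. D n i \<omega>) \<partial>M) - (\<integral>\<omega>. ?T (\<lambda>i. D n i \<omega>) \<partial>M)\<bar>
      \<le> L * real m * h + B * (real m * V) / (h * of_int K)\<^sup>2" for n
    using M.tent_interpolant_expectation(2)[of m "D n", OF D bounds] .
  have ZN1: "(\<integral>\<omega>. ?T (\<lambda>i. Z i \<omega>) \<partial>N) = ?sum (\<lambda>\<phi>. \<integral>\<omega>. \<phi> (\<lambda>i. Z i \<omega>) \<partial>N)"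
    using N.tent_interpolant_expectation(1)[of m Z, OF Z bounds] .
  have ZN2: "\<bar>(\<integral>\<omega>. G (\<lambda>i. Z i \<omega>) \<partial>N) - (\<integral>\<omega>. ?T (\<lambda>i. Z i \<omega>) \<partial>N)\<bar>
      \<le> L * real m * h + B * (real m * V) / (h * of_int K)\<^sup>2"
    using N.tent_interpolant_expectation(2)[of m Z, OF Z bounds] .
  have "(\<lambda>n. \<integral>\<omega>. ?T (\<lambda>i. D n i \<omega>) \<partial>M) \<longlonglongrightarrow> (\<integral>\<omega>. ?T (\<lambda>i. Z i \<omega>) \<partial>N)"
    unfolding DM1 ZN1
  proof (intro tendsto_sum tendsto_mult tendsto_const prod[where A = "1 / h"] tent_bounds)
    fix u v c :: real
    show "\<bar>tent (u / h - c) - tent (v / h - c)\<bar> \<le> 1 / h * \<bar>u - v\<bar>"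
      using tent_lipschitz[of "u / h - c" "v / h - c"] h(1) by (simp add: diff_divide_distrib[symmetric])
  qed (use h in simp)
  then have "\<forall>\<^sub>F n in sequentially. dist (\<integral>\<omega>. ?T (\<lambda>i. D n i \<omega>) \<partial>M) (\<integral>\<omega>. ?T (\<lambda>i. Z i \<omega>) \<partial>N) < e / 4"
    using \<open>0 < e\<close> by (intro tendstoD) auto
  then show "\<forall>\<^sub>F n in sequentially. dist (\<integral>\<omega>. G (\<lambda>i. D n i \<omega>) \<partial>M) (\<integral>\<omega>. G (\<lambda>i. Z i \<omega>) \<partial>N) < e"
  proof eventually_elim
    case (elim n)
    with DM2[of n] ZN2 K(2) h(2) show ?case
      unfolding dist_real_def by linarith
  qed
qed

section \<open>Convergence against Lipschitz functions\<close>

text \<open>The Pasch-Hausdorff envelope: for bounded \<open>f\<close>, the largest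
  \<open>k\<close>-Lipschitz function below \<open>f\<close>.\<close>

definition lipschitz_minorant :: "('c::metric_space \<Rightarrow> real) \<Rightarrow> nat \<Rightarrow> 'c \<Rightarrow> real" where
  "lipschitz_minorant f k x = (INF y. f y + real k * dist x y)"

lemma lipschitz_minorant_props:
  assumes B: "\<And>x. \<bar>f x\<bar> \<le> B"
  shows "lipschitz_minorant f k x \<le> f x" "\<bar>lipschitz_minorant f k x\<bar> \<le> B"
    "\<bar>lipschitz_minorant f k x - lipschitz_minorant f k y\<bar> \<le> real k * dist x y"
proof -
  have ge: "- B \<le> f y + real k * dist x y" for x y
    using B[of y] zero_le_dist[of x y] mult_nonneg_nonneg[of "real k" "dist x y"] by linarith
  have bdd: "bdd_below (range (\<lambda>y. f y + real k * dist x y))" for x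
    using ge by (intro bdd_belowI2)
  show 1: "lipschitz_minorant f k x \<le> f x"
    unfolding lipschitz_minorant_def using cINF_lower[OF bdd, of x x] by simp
  have "- B \<le> lipschitz_minorant f k x"
    unfolding lipschitz_minorant_def by (intro cINF_greatest ge) simp
  with 1 B[of x] show "\<bar>lipschitz_minorant f k x\<bar> \<le> B" by linarith
  have le: "lipschitz_minorant f k x - real k * dist x y \<le> lipschitz_minorant f k y" for x y
    unfolding lipschitz_minorant_def[of f k y]
  proof (rule cINF_greatest)
    fix z
    have "lipschitz_minorant f k x \<le> f z + real k * dist x z"
      unfolding lipschitz_minorant_def by (rule cINF_lower[OF bdd]) simp
    also have "\<dots> \<le> f z + real k * (dist x y + dist y z)"
      by (intro add_left_mono mult_left_mono dist_triangle) simp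
    finally show "lipschitz_minorant f k x - real k * dist x y \<le> f z + real k * dist y z"
      by (simp add: distrib_left)
  qed simp
  from le[of x y] le[of y x]
  show "\<bar>lipschitz_minorant f k x - lipschitz_minorant f k y\<bar> \<le> real k * dist x y"
    by (simp add: dist_commute abs_le_iff)
qed

text \<open>Near \<open>x\<close> continuity bounds \<open>f y\<close> from below; at distance
  \<open>d\<close> or more the penalty outweighs the oscillation \<open>2 * B\<close> of
  \<open>f\<close> once \<open>k\<close> exceeds \<open>2 * B / d\<close>.\<close>

lemma lipschitz_minorant_tendsto:
  assumes B: "\<And>x. \<bar>f x\<bar> \<le> B" and cont: "continuous_on UNIV f"
  shows "(\<lambda>k. lipschitz_minorant f k x) \<longlonglongrightarrow> f x"
proof (rule tendstoI)
  fix e :: real assume "0 < e"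
  have "\<exists>d>0. \<forall>y\<in>UNIV. dist y x < d \<longrightarrow> dist (f y) (f x) < e / 2"
    using cont[unfolded continuous_on_iff] half_gt_zero[OF \<open>0 < e\<close>] by blast
  then obtain d where d: "0 < d" "\<And>y. dist y x < d \<Longrightarrow> dist (f y) (f x) < e / 2" by blast
  obtain k0 :: nat where k0: "2 * B / d < real k0" using reals_Archimedean2 by blast
  show "\<forall>\<^sub>F k in sequentially. dist (lipschitz_minorant f k x) (f x) < e"
    using eventually_ge_at_top[of k0]
  proof eventually_elim
    case (elim k)
    have "f x - e / 2 \<le> lipschitz_minorant f k x"
      unfolding lipschitz_minorant_def
    proof (rule cINF_greatest)
      fix y
      show "f x - e / 2 \<le> f y + real k * dist x y"
      proof (cases "dist y x < d")
        case True
        have "0 \<le> real k * dist x y" by simp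
        with d(2)[OF True] show ?thesis unfolding dist_real_def by linarith
      next
        case False
        have "2 * B < real k0 * d" using k0 d(1) by (simp add: divide_less_eq)
        also have "\<dots> \<le> real k * dist x y"
          using False elim d(1) by (intro mult_mono) (auto simp: dist_commute)
        finally show ?thesis using B[of x] B[of y] \<open>0 < e\<close> by linarith
      qed
    qed simp
    with lipschitz_minorant_props(1)[of f B k x, OF B] \<open>0 < e\<close> show ?case
      by (simp add: dist_real_def abs_less_iff)
  qed
qed

text \<open>Minorants give lower estimates only, so they are applied to \<open>F\<close> and to its
  negative. Dominated convergence is used under the fixed law of \<open>Z\<close>; under the laws of
  \<open>Y n\<close> the inequality between minorant and function suffices.\<close>

theorem converges_in_distribution_lipschitzI:
  fixes Y :: "nat \<Rightarrow> 'a \<Rightarrow> 'c::metric_space" and Z :: "'b \<Rightarrow> 'c"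
  assumes "prob_space M" "prob_space N"
    and Y [measurable]: "\<And>n. Y n \<in> borel_measurable M" and Z [measurable]: "Z \<in> borel_measurable N"
    and lip: "\<And>F L B. 0 \<le> L \<Longrightarrow> (\<And>x y. \<bar>F x - F y\<bar> \<le> L * dist x y) \<Longrightarrow> (\<And>x. \<bar>F x\<bar> \<le> B) \<Longrightarrow>
      F \<in> borel_measurable borel \<Longrightarrow> (\<lambda>n. \<integral>\<omega>. F (Y n \<omega>) \<partial>M) \<longlonglongrightarrow> (\<integral>\<omega>. F (Z \<omega>) \<partial>N)"
  shows "converges_in_distribution M Y N Z"
proof -
  interpret M: prob_space M by fact
  interpret N: prob_space N by fact
  have lower: "\<forall>\<^sub>F n in sequentially. (\<integral>\<omega>. f (Z \<omega>) \<partial>N) - e < (\<integral>\<omega>. f (Y n \<omega>) \<partial>M)"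
    if cont: "continuous_on UNIV f" and B: "\<And>x. \<bar>f x\<bar> \<le> B" and "0 < e" for f :: "'c \<Rightarrow> real" and B e
  proof -
    have [measurable]: "f \<in> borel_measurable borel" using cont by (rule borel_measurable_continuous_onI)
    let ?f = "lipschitz_minorant f"
    have [measurable]: "?f k \<in> borel_measurable borel" for k
    proof (rule borel_measurable_continuous_onI)
      have "(real k)-lipschitz_on UNIV (?f k)"
        using lipschitz_minorant_props(3)[of f B, OF B] by (intro lipschitz_onI) (auto simp: dist_real_def)
      then show "continuous_on UNIV (?f k)" by (rule lipschitz_on_continuous_on)
    qed
    have "(\<lambda>k. \<integral>\<omega>. ?f k (Z \<omega>) \<partial>N) \<longlonglongrightarrow> (\<integral>\<omega>. f (Z \<omega>) \<partial>N)"
      using lipschitz_minorant_tendsto[OF B cont] lipschitz_minorant_props(2)[of f B, OF B]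
      by (intro integral_dominated_convergence[where w = "\<lambda>_. B"]) auto
    from order_tendstoD(1)[OF this, of "(\<integral>\<omega>. f (Z \<omega>) \<partial>N) - e"] \<open>0 < e\<close>
    obtain k where k: "(\<integral>\<omega>. f (Z \<omega>) \<partial>N) - e < (\<integral>\<omega>. ?f k (Z \<omega>) \<partial>N)"
      using eventually_happens'[OF sequentially_bot] by force
    have "(\<lambda>n. \<integral>\<omega>. ?f k (Y n \<omega>) \<partial>M) \<longlonglongrightarrow> (\<integral>\<omega>. ?f k (Z \<omega>) \<partial>N)"
      using lipschitz_minorant_props(2,3)[of f B, OF B] by (intro lip[where L = "real k" and B = B]) auto
    from order_tendstoD(1)[OF this k] show ?thesis
    proof eventually_elim
      case (elim n)
      have "(\<integral>\<omega>. ?f k (Y n \<omega>) \<partial>M) \<le> (\<integral>\<omega>. f (Y n \<omega>) \<partial>M)"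
        using lipschitz_minorant_props(1,2)[of f B, OF B] B
        by (intro integral_mono M.integrable_const_bound[of _ B]) auto
      with elim show ?case by linarith
    qed
  qed
  have "(\<lambda>n. \<integral>\<omega>. F (Y n \<omega>) \<partial>M) \<longlonglongrightarrow> (\<integral>\<omega>. F (Z \<omega>) \<partial>N)"
    if cont: "continuous_on UNIV F" and bd: "bounded (range F)" for F :: "'c \<Rightarrow> real"
  proof (rule tendstoI)
    fix e :: real assume "0 < e"
    obtain B where B: "\<And>x. \<bar>F x\<bar> \<le> B" using bd by (auto simp: bounded_iff)
    have "continuous_on UNIV (\<lambda>x. - F x)" using cont by (rule continuous_on_minus)
    from lower[OF cont B \<open>0 < e\<close>] lower[OF this _ \<open>0 < e\<close>, of B] B
    have "\<forall>\<^sub>F n in sequentially. (\<integral>\<omega>. F (Z \<omega>) \<partial>N) - e < (\<integral>\<omega>. F (Y n \<omega>) \<partial>M)"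
      "\<forall>\<^sub>F n in sequentially. (\<integral>\<omega>. - F (Z \<omega>) \<partial>N) - e < (\<integral>\<omega>. - F (Y n \<omega>) \<partial>M)" by simp_all
    then show "\<forall>\<^sub>F n in sequentially. dist (\<integral>\<omega>. F (Y n \<omega>) \<partial>M) (\<integral>\<omega>. F (Z \<omega>) \<partial>N) < e"
      by eventually_elim (simp add: dist_real_def abs_less_iff)
  qed
  with Y Z show ?thesis unfolding converges_in_distribution_def by blast
qed

section \<open>Step functions in Skorohod space\<close>

text \<open>For positive \<open>m\<close> the value \<open>v k\<close> is taken on [k / m, (k + 1) /
  m), and \<open>v m\<close> at the end point 1 alone.\<close>

definition step :: "nat \<Rightarrow> (nat \<Rightarrow> real) \<Rightarrow> skorohod" where
  "step m v = to_skorohod (\<lambda>t. v (nat \<lfloor>real m * t\<rfloor>))"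

text \<open>A step function is its initial value plus a scaled partial-sum path built from its own
  jumps, and such paths are known to be cadlag.\<close>

lemma cadlag_step: "cadlag (\<lambda>t. v (nat \<lfloor>real m * t\<rfloor>))"
proof (cases "m = 0")
  case True
  then show ?thesis by (simp add: continuous_imp_cadlag)
next
  case False
  \<comment> \<open>The sample space has one point, and the factor \<open>sqrt m\<close> cancels the
    normalisation.\<close>
  let ?Y = "\<lambda>j (_::unit). sqrt (real m) * (v j - v (j - 1))"
  have telescope: "(\<Sum>j = 1..k. v j - v (j - 1)) = v k - v 0" for k
    by (induction k) simp_all
  have eq: "(\<lambda>t. v (nat \<lfloor>real m * t\<rfloor>)) = (\<lambda>t. v 0 + scaled_partial_sums ?Y m () t)"
    unfolding scaled_partial_sums_def sum_distrib_left[symmetric] telescope using False by (simp add: fun_eq_iff)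
  have "cadlag (\<lambda>t. c + x t)" if "cadlag x" for c x
    unfolding cadlag_def
  proof (intro conjI ballI)
    show "((\<lambda>t. c + x t) \<longlongrightarrow> c + x t) (at_right t)" if "t \<in> {0..<1}" for t
      using \<open>cadlag x\<close> that by (intro tendsto_add tendsto_const) (simp add: cadlag_def)
    show "\<exists>l. ((\<lambda>t. c + x t) \<longlongrightarrow> l) (at_left t)" if t: "t \<in> {0<..1}" for t
    proof -
      obtain l where "(x \<longlongrightarrow> l) (at_left t)" using \<open>cadlag x\<close> t unfolding cadlag_def by blast
      then have "((\<lambda>t. c + x t) \<longlongrightarrow> c + l) (at_left t)" by (intro tendsto_add tendsto_const)
      then show ?thesis by blast
    qed
  qed
  from this[OF cadlag_scaled_partial_sums] show ?thesis unfolding eq .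
qed

text \<open>The identity is an admissible time change. All approximations below are uniform, so no
  other time change is ever chosen.\<close>

lemma dist_to_skorohod_le:
  assumes "cadlag x" "cadlag y" "\<And>t. t \<in> {0..1} \<Longrightarrow> \<bar>x t - y t\<bar> \<le> e"
  shows "dist (to_skorohod x) (to_skorohod y) \<le> e"
proof -
  have "0 \<le> e" using assms(3)[of 0] by simp
  then have "\<forall>t\<in>{0..1}. \<bar>t - t\<bar> \<le> e \<and> \<bar>restrict x {0..1} t - restrict y {0..1} t\<bar> \<le> e"
    using assms(3) by simp
  then have "e \<in> skorohod_bounds (restrict x {0..1}) (restrict y {0..1})"
    unfolding skorohod_bounds_def by (intro CollectI bexI[OF _ id_time_change])
  then show ?thesis
    unfolding dist_skorohod_def Rep_to_skorohod[OF assms(1)] Rep_to_skorohod[OF assms(2)]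
    by (rule cInf_lower[OF _ bdd_below_skorohod_bounds])
qed

lemma nat_floor_grid_le: "t \<in> {0..1} \<Longrightarrow> nat \<lfloor>real m * t\<rfloor> \<le> m"
proof -
  assume "t \<in> {0..1}"
  then have "real m * t \<le> real m" by (simp add: mult_left_le)
  then show ?thesis by linarith
qed

lemma dist_step_le:
  assumes "\<And>k. k \<le> m \<Longrightarrow> \<bar>u k - v k\<bar> \<le> e"
  shows "dist (step m u) (step m v) \<le> e"
  unfolding step_def
proof (rule dist_to_skorohod_le)
  show "\<bar>u (nat \<lfloor>real m * t\<rfloor>) - v (nat \<lfloor>real m * t\<rfloor>)\<bar> \<le> e" if "t \<in> {0..1}" for t
    by (rule assms[OF nat_floor_grid_le[OF that]])
qed (rule cadlag_step)+

text \<open>As a continuous map from sequences, \<open>step m\<close> supplies measurability in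
  Skorohod space without any description of its Borel sets by coordinates.\<close>

lemma step_measurable [measurable]: "step m \<in> borel_measurable borel"
proof -
  have "dist (step m u) (step m v) \<le> 1 * l1_dist {..m} u v" for u v
    unfolding mult_1_left l1_dist_def
    by (intro dist_step_le member_le_sum[of _ _ "\<lambda>k. \<bar>u k - v k\<bar>"]) auto
  then have "continuous_on UNIV (step m)" by (intro l1_lipschitz_continuous[of "{..m}" _ 1]) auto
  then show ?thesis by (rule borel_measurable_continuous_onI)
qed

text \<open>The truncation \<open>min 1\<close> only affects sample points \<open>k > m\<close>, which \<open>step m\<close> never reads; it
  keeps every sample point in \<open>[0,1]\<close>, where alone Brownian motion is measurable.\<close>

lemma step_tendsto:
  assumes "continuous_on {0..1} w"
  shows "(\<lambda>m. step m (\<lambda>k. w (min 1 (real k / real m)))) \<longlonglongrightarrow> to_skorohod w"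
proof (rule tendstoI)
  fix e :: real assume "0 < e"
  have "uniformly_continuous_on {0..1} w" using assms by (intro compact_uniformly_continuous) auto
  from uniformly_continuous_onE[OF this half_gt_zero[OF \<open>0 < e\<close>]]
  obtain d where d: "0 < d" "\<And>t s. t \<in> {0..1} \<Longrightarrow> s \<in> {0..1} \<Longrightarrow> dist s t < d \<Longrightarrow> dist (w s) (w t) < e / 2"
    by blast
  have "\<forall>\<^sub>F m in sequentially. 1 / real m < d"
    using lim_1_over_n d(1) by (rule order_tendstoD(2))
  then show "\<forall>\<^sub>F m in sequentially. dist (step m (\<lambda>k. w (min 1 (real k / real m)))) (to_skorohod w) < e"
    using eventually_gt_at_top[of 0]
  proof eventually_elim
    case (elim m)
    have "dist (step m (\<lambda>k. w (min 1 (real k / real m)))) (to_skorohod w) \<le> e / 2"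
      unfolding step_def
    proof (intro dist_to_skorohod_le cadlag_step continuous_imp_cadlag assms)
      fix t :: real assume t: "t \<in> {0..1}"
      let ?k = "nat \<lfloor>real m * t\<rfloor>"
      have k: "real ?k \<le> real m * t" "real m * t < real ?k + 1" using t by auto
      have "?k \<le> m" by (rule nat_floor_grid_le[OF t])
      then have s: "min 1 (real ?k / real m) = real ?k / real m" "real ?k / real m \<in> {0..1}" using elim by (auto simp: divide_le_eq)
      have "real ?k / real m \<le> t" "t < real ?k / real m + 1 / real m"
        using k elim by (simp_all add: divide_le_eq add_divide_distrib[symmetric] less_divide_eq mult.commute)
      then have "dist (real ?k / real m) t < d" using elim by (simp add: dist_real_def)
      from d(2)[OF t s(2) this] show "\<bar>w (min 1 (real ?k / real m)) - w t\<bar> \<le> e / 2"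
        unfolding s(1) by (simp add: dist_real_def)
    qed
    with \<open>0 < e\<close> show ?case by simp
  qed
qed

section \<open>Brownian increments and the invariance principle\<close>

lemma (in prob_space) normal_expectation:
  fixes \<phi> :: "real \<Rightarrow> real"
  assumes D: "distributed M lborel Y (normal_density 0 s)" and "0 < s" and [measurable]: "\<phi> \<in> borel_measurable borel"
  shows "expectation (\<lambda>\<omega>. \<phi> (Y \<omega>)) = (\<integral>x. \<phi> (s * x) \<partial>std_normal_distribution)"
    and "integrable M (\<lambda>\<omega>. \<phi> (Y \<omega>)) \<longleftrightarrow> integrable std_normal_distribution (\<lambda>x. \<phi> (s * x))"
proof -
  have D': "distributed M lborel (\<lambda>\<omega>. Y \<omega> / s) std_normal_density"
    using normal_standard_normal_convert[OF \<open>0 < s\<close>, of Y 0] D by simp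
  then have eq: "distr M lborel (\<lambda>\<omega>. Y \<omega> / s) = std_normal_distribution"
    by (rule distributed_distr_eq_density)
  have [measurable]: "(\<lambda>\<omega>. Y \<omega> / s) \<in> measurable M lborel"
    using D' by (rule distributed_measurable)
  have [measurable]: "(\<lambda>x. \<phi> (s * x)) \<in> borel_measurable lborel" by simp
  have sY: "\<phi> (s * (Y \<omega> / s)) = \<phi> (Y \<omega>)" for \<omega> using \<open>0 < s\<close> by simp
  show "expectation (\<lambda>\<omega>. \<phi> (Y \<omega>)) = (\<integral>x. \<phi> (s * x) \<partial>std_normal_distribution)"
    unfolding eq[symmetric] by (subst integral_distr) (simp_all only: sY, measurable)
  show "integrable M (\<lambda>\<omega>. \<phi> (Y \<omega>)) \<longleftrightarrow> integrable std_normal_distribution (\<lambda>x. \<phi> (s * x))"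
    unfolding eq[symmetric] by (subst integrable_distr_eq) (simp_all only: sY, measurable)
qed

definition cumulate :: "(nat \<Rightarrow> real) \<Rightarrow> nat \<Rightarrow> real" where
  "cumulate x k = (\<Sum>i<k. x i)"

text \<open>Turns a Lipschitz function on Skorohod space into an \<open>l1_dist\<close>-Lipschitz
  function of the \<open>m\<close> increments.\<close>

lemma dist_step_cumulate_le: "dist (step m (cumulate x)) (step m (cumulate y)) \<le> l1_dist {..<m} x y"
proof (rule dist_step_le)
  fix k assume "k \<le> m"
  have "\<bar>cumulate x k - cumulate y k\<bar> \<le> (\<Sum>i<k. \<bar>x i - y i\<bar>)"
    unfolding cumulate_def sum_subtractf[symmetric] by (rule sum_abs)
  also have "\<dots> \<le> l1_dist {..<m} x y"
    unfolding l1_dist_def using \<open>k \<le> m\<close> by (intro sum_mono2) auto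
  finally show "\<bar>cumulate x k - cumulate y k\<bar> \<le> l1_dist {..<m} x y" .
qed

text \<open>The partial-sum process is itself a step function of mesh 1 / n.\<close>

lemma scaled_partial_sums_measurable:
  assumes "\<And>j. 1 \<le> j \<Longrightarrow> X j \<in> borel_measurable M"
  shows "(\<lambda>\<omega>. to_skorohod (scaled_partial_sums X n \<omega>)) \<in> borel_measurable M"
proof -
  have v: "(\<lambda>\<omega> k. 1 / sqrt (real n) * (\<Sum>j = 1..k. X j \<omega>)) \<in> borel_measurable M"
    by (intro measurable_coordinatewise_then_product borel_measurable_times borel_measurable_const borel_measurable_sum assms) auto
  have "(\<lambda>\<omega>. to_skorohod (scaled_partial_sums X n \<omega>))
      = (\<lambda>\<omega>. step n (\<lambda>k. 1 / sqrt (real n) * (\<Sum>j = 1..k. X j \<omega>)))"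
    by (simp add: step_def scaled_partial_sums_def[abs_def])
  with measurable_compose[OF v step_measurable] show ?thesis by (simp only:)
qed

section \<open>Brownian motion through its increments on a grid\<close>

locale brownian_motion = prob_space N for N :: "'b measure" +
  fixes W :: "real \<Rightarrow> 'b \<Rightarrow> real"
  assumes brownian: "standard_brownian_motion N W"
begin

lemma W_measurable: "t \<in> {0..1} \<Longrightarrow> W t \<in> borel_measurable N"
  using brownian by (simp add: standard_brownian_motion_def)

lemma W_continuous: "\<omega> \<in> space N \<Longrightarrow> continuous_on {0..1} (\<lambda>t. W t \<omega>)"
  using brownian by (simp add: standard_brownian_motion_def)

definition W_incr :: "real \<Rightarrow> nat \<Rightarrow> nat \<Rightarrow> 'b \<Rightarrow> real" where
  "W_incr \<sigma> m i \<omega> = \<sigma> * (W (real (Suc i) / real m) \<omega> - W (real i / real m) \<omega>)"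

lemma W_incr_measurable: "i < m \<Longrightarrow> W_incr \<sigma> m i \<in> borel_measurable N"
  unfolding W_incr_def
  by (intro borel_measurable_times borel_measurable_const borel_measurable_diff W_measurable) (auto simp: divide_le_eq)

lemma W_incr_expectation:
  fixes \<phi> :: "real \<Rightarrow> real"
  assumes "i < m" and [measurable]: "\<phi> \<in> borel_measurable borel"
  shows "expectation (\<lambda>\<omega>. \<phi> (W_incr \<sigma> m i \<omega>)) = (\<integral>x. \<phi> (\<sigma> * sqrt (1 / real m) * x) \<partial>std_normal_distribution)"
    and "integrable N (\<lambda>\<omega>. \<phi> (W_incr \<sigma> m i \<omega>)) \<longleftrightarrow> integrable std_normal_distribution (\<lambda>x. \<phi> (\<sigma> * sqrt (1 / real m) * x))"
proof -
  have "real (Suc i) / real m - real i / real m = 1 / real m"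
    by (simp add: diff_divide_distrib[symmetric])
  moreover have "0 \<le> real i / real m" "real i / real m < real (Suc i) / real m" "real (Suc i) / real m \<le> 1"
    using \<open>i < m\<close> by (auto simp: divide_strict_right_mono divide_le_eq)
  ultimately have D: "distributed N lborel (\<lambda>\<omega>. W (real (Suc i) / real m) \<omega> - W (real i / real m) \<omega>) (normal_density 0 (sqrt (1 / real m)))"
    using brownian unfolding standard_brownian_motion_def by metis
  have s: "0 < sqrt (1 / real m)" using \<open>i < m\<close> by simp
  have [measurable]: "(\<lambda>x. \<phi> (\<sigma> * x)) \<in> borel_measurable borel" by simp
  show "expectation (\<lambda>\<omega>. \<phi> (W_incr \<sigma> m i \<omega>)) = (\<integral>x. \<phi> (\<sigma> * sqrt (1 / real m) * x) \<partial>std_normal_distribution)"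
    "integrable N (\<lambda>\<omega>. \<phi> (W_incr \<sigma> m i \<omega>)) \<longleftrightarrow> integrable std_normal_distribution (\<lambda>x. \<phi> (\<sigma> * sqrt (1 / real m) * x))"
    using normal_expectation[OF D s, of "\<lambda>x. \<phi> (\<sigma> * x)"] by (simp_all only: W_incr_def mult.assoc, measurable)
qed

lemma W_incr_product:
  fixes f :: "nat \<Rightarrow> real \<Rightarrow> real"
  assumes "0 < m" and [measurable]: "\<And>i. f i \<in> borel_measurable borel" and f01: "\<And>i u. 0 \<le> f i u" "\<And>i u. f i u \<le> 1"
  shows "expectation (\<lambda>\<omega>. \<Prod>i<m. f i (W_incr \<sigma> m i \<omega>)) = (\<Prod>i<m. \<integral>x. f i (\<sigma> * sqrt (1 / real m) * x) \<partial>std_normal_distribution)"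
proof -
  define t where "t i = real i / real m" for i
  have "strict_mono_on {..m} t" "t ` {..m} \<subseteq> {0..1}"
    using \<open>0 < m\<close> by (auto simp: t_def strict_mono_on_def divide_strict_right_mono divide_le_eq)
  then have "indep_vars (\<lambda>_. borel) (\<lambda>i \<omega>. W (t (Suc i)) \<omega> - W (t i) \<omega>) {..<m}"
    using brownian by (simp add: standard_brownian_motion_def)
  then have "indep_vars (\<lambda>_. borel) (\<lambda>i \<omega>. f i (\<sigma> * (W (t (Suc i)) \<omega> - W (t i) \<omega>))) {..<m}"
    by (rule indep_vars_compose2[where Y = "\<lambda>i x. f i (\<sigma> * x)"]) simp
  then have ind: "indep_vars (\<lambda>_. borel) (\<lambda>i \<omega>. f i (W_incr \<sigma> m i \<omega>)) {..<m}"
    by (simp add: W_incr_def t_def)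
  have "integrable N (\<lambda>\<omega>. f i (W_incr \<sigma> m i \<omega>))" if "i < m" for i
    using measurable_compose[OF W_incr_measurable[OF that] assms(2)] f01
    by (intro integrable_const_bound[of _ 1]) auto
  then have "expectation (\<lambda>\<omega>. \<Prod>i<m. f i (W_incr \<sigma> m i \<omega>)) = (\<Prod>i<m. expectation (\<lambda>\<omega>. f i (W_incr \<sigma> m i \<omega>)))"
    by (intro indep_vars_lebesgue_integral ind) auto
  also have "\<dots> = (\<Prod>i<m. \<integral>x. f i (\<sigma> * sqrt (1 / real m) * x) \<partial>std_normal_distribution)"
    by (intro prod.cong refl W_incr_expectation) auto
  finally show ?thesis .
qed

lemma W_incr_square:
  assumes "i < m"
  shows "integrable N (\<lambda>\<omega>. (W_incr \<sigma> m i \<omega>)\<^sup>2)" "expectation (\<lambda>\<omega>. (W_incr \<sigma> m i \<omega>)\<^sup>2) \<le> \<sigma>\<^sup>2"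
proof -
  have int: "integrable std_normal_distribution (\<lambda>x. (\<sigma> * sqrt (1 / real m) * x)\<^sup>2)"
    using integrable_std_normal_distribution_moment[of 2] by (simp add: power_mult_distrib)
  show "integrable N (\<lambda>\<omega>. (W_incr \<sigma> m i \<omega>)\<^sup>2)"
    using W_incr_expectation(2)[OF assms, of "\<lambda>x. x\<^sup>2" \<sigma>] int by simp
  have "(\<integral>x. (\<sigma> * sqrt (1 / real m) * x)\<^sup>2 \<partial>std_normal_distribution) = \<sigma>\<^sup>2 * (1 / real m)"
    using std_normal_distribution_even_moments(1)[of 1] by (simp add: power_mult_distrib)
  also have "\<dots> \<le> \<sigma>\<^sup>2" using assms by (intro mult_left_le) auto
  finally show "expectation (\<lambda>\<omega>. (W_incr \<sigma> m i \<omega>)\<^sup>2) \<le> \<sigma>\<^sup>2"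
    using W_incr_expectation(1)[OF assms, of "\<lambda>x. x\<^sup>2" \<sigma>] by simp
qed

lemma brownian_path_step_tendsto:
  assumes "\<omega> \<in> space N"
  shows "(\<lambda>m. step m (\<lambda>k. \<sigma> * W (min 1 (real k / real m)) \<omega>)) \<longlonglongrightarrow> to_skorohod (\<lambda>t. \<sigma> * W t \<omega>)"
  by (rule step_tendsto) (intro continuous_intros W_continuous assms)

lemma step_W_measurable: "(\<lambda>\<omega>. step m (\<lambda>k. \<sigma> * W (min 1 (real k / real m)) \<omega>)) \<in> borel_measurable N"
proof -
  have "(\<lambda>\<omega> k. \<sigma> * W (min 1 (real k / real m)) \<omega>) \<in> borel_measurable N"
    by (intro measurable_coordinatewise_then_product borel_measurable_times borel_measurable_const W_measurable) simp
  then show ?thesis by simp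
qed

text \<open>Continuity makes each path a limit of its discretisations, which are measurable.\<close>

lemma brownian_path_measurable: "(\<lambda>\<omega>. to_skorohod (\<lambda>t. \<sigma> * W t \<omega>)) \<in> borel_measurable N"
  by (rule borel_measurable_LIMSEQ_metric[OF step_W_measurable brownian_path_step_tendsto])

text \<open>Dominated convergence along the discretised paths, followed by a rewriting in terms of
  increments. The rewriting holds only almost surely, because \<open>W 0 = 0\<close> does.\<close>

lemma brownian_step_limit:
  fixes F :: "skorohod \<Rightarrow> real"
  assumes cont: "continuous_on UNIV F" and B: "\<And>x. \<bar>F x\<bar> \<le> B"
  shows "(\<lambda>m. expectation (\<lambda>\<omega>. F (step m (cumulate (\<lambda>i. W_incr \<sigma> m i \<omega>))))) \<longlonglongrightarrow> expectation (\<lambda>\<omega>. F (to_skorohod (\<lambda>t. \<sigma> * W t \<omega>)))"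
proof -
  have [measurable]: "F \<in> borel_measurable borel" using cont by (rule borel_measurable_continuous_onI)
  have [measurable]: "(\<lambda>\<omega>. step m (\<lambda>k. \<sigma> * W (min 1 (real k / real m)) \<omega>)) \<in> borel_measurable N"
    "(\<lambda>\<omega>. to_skorohod (\<lambda>t. \<sigma> * W t \<omega>)) \<in> borel_measurable N" for m
    by (rule step_W_measurable brownian_path_measurable)+
  have "(\<lambda>m. expectation (\<lambda>\<omega>. F (step m (\<lambda>k. \<sigma> * W (min 1 (real k / real m)) \<omega>)))) \<longlonglongrightarrow> expectation (\<lambda>\<omega>. F (to_skorohod (\<lambda>t. \<sigma> * W t \<omega>)))"
  proof (rule integral_dominated_convergence[where w = "\<lambda>_. B"])
    have "(\<lambda>m. F (step m (\<lambda>k. \<sigma> * W (min 1 (real k / real m)) \<omega>))) \<longlonglongrightarrow> F (to_skorohod (\<lambda>t. \<sigma> * W t \<omega>))" if "\<omega> \<in> space N" for \<omega>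
      using cont brownian_path_step_tendsto[OF that] by (rule continuous_on_tendsto_compose) auto
    then show "AE \<omega> in N. (\<lambda>m. F (step m (\<lambda>k. \<sigma> * W (min 1 (real k / real m)) \<omega>))) \<longlonglongrightarrow> F (to_skorohod (\<lambda>t. \<sigma> * W t \<omega>))"
      by (intro AE_I2)
  qed (use B in auto)
  moreover have "\<forall>\<^sub>F m in sequentially. expectation (\<lambda>\<omega>. F (step m (\<lambda>k. \<sigma> * W (min 1 (real k / real m)) \<omega>)))
      = expectation (\<lambda>\<omega>. F (step m (cumulate (\<lambda>i. W_incr \<sigma> m i \<omega>))))"
    using eventually_gt_at_top[of 0]
  proof eventually_elim
    case (elim m)
    have cont_G: "continuous_on UNIV (\<lambda>x. step m (cumulate x))"
      by (rule l1_lipschitz_continuous[of "{..<m}" _ 1]) (simp_all add: dist_step_cumulate_le)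
    then have [measurable]: "(\<lambda>x. step m (cumulate x)) \<in> borel_measurable borel"
      by (rule borel_measurable_continuous_onI)
    have "(\<lambda>\<omega> i. if i < m then W_incr \<sigma> m i \<omega> else 0) \<in> borel_measurable N"
    proof (rule measurable_coordinatewise_then_product)
      fix i show "(\<lambda>\<omega>. if i < m then W_incr \<sigma> m i \<omega> else 0) \<in> borel_measurable N"
        by (cases "i < m") (simp_all add: W_incr_measurable)
    qed
    then have "(\<lambda>\<omega>. step m (cumulate (\<lambda>i. if i < m then W_incr \<sigma> m i \<omega> else 0))) \<in> borel_measurable N"
      by simp
    also have "(\<lambda>\<omega>. step m (cumulate (\<lambda>i. if i < m then W_incr \<sigma> m i \<omega> else 0))) = (\<lambda>\<omega>. step m (cumulate (\<lambda>i. W_incr \<sigma> m i \<omega>)))"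
    proof
      fix \<omega>
      have "dist (step m (cumulate (\<lambda>i. if i < m then W_incr \<sigma> m i \<omega> else 0))) (step m (cumulate (\<lambda>i. W_incr \<sigma> m i \<omega>))) \<le> 0"
        by (rule order_trans[OF dist_step_cumulate_le]) (simp add: l1_dist_def)
      then show "step m (cumulate (\<lambda>i. if i < m then W_incr \<sigma> m i \<omega> else 0)) = step m (cumulate (\<lambda>i. W_incr \<sigma> m i \<omega>))"
        by simp
    qed
    finally have [measurable]: "(\<lambda>\<omega>. step m (cumulate (\<lambda>i. W_incr \<sigma> m i \<omega>))) \<in> borel_measurable N" .
    have "AE \<omega> in N. W 0 \<omega> = 0" using brownian by (simp add: standard_brownian_motion_def)
    then have "AE \<omega> in N. F (step m (\<lambda>k. \<sigma> * W (min 1 (real k / real m)) \<omega>)) = F (step m (cumulate (\<lambda>i. W_incr \<sigma> m i \<omega>)))"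
    proof eventually_elim
      fix \<omega> assume W0: "W 0 \<omega> = 0"
      have "cumulate (\<lambda>i. W_incr \<sigma> m i \<omega>) k = \<sigma> * W (real k / real m) \<omega>" for k
        by (induction k) (simp_all add: cumulate_def W_incr_def W0 right_diff_distrib)
      moreover have "min 1 (real k / real m) = real k / real m" if "k \<le> m" for k
        using that elim by (simp add: divide_le_eq)
      ultimately have "dist (step m (\<lambda>k. \<sigma> * W (min 1 (real k / real m)) \<omega>)) (step m (cumulate (\<lambda>i. W_incr \<sigma> m i \<omega>))) \<le> 0"
        by (intro dist_step_le) simp
      then show "F (step m (\<lambda>k. \<sigma> * W (min 1 (real k / real m)) \<omega>)) = F (step m (cumulate (\<lambda>i. W_incr \<sigma> m i \<omega>)))"
        by simp
    qed
    then show ?case by (intro integral_cong_AE) simp_all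
  qed
  ultimately show ?thesis by (rule Lim_transform_eventually)
qed

end

section \<open>Comparison of the partial-sum process with its discretisation\<close>

context stationary_L_weakly_dependent
begin

lemma incr_square:
  assumes "\<And>a N. expectation (\<lambda>\<omega>. (psum a (a + N) \<omega>)\<^sup>2) \<le> C * real N" "0 \<le> C" "i < m"
  shows "integrable M (\<lambda>\<omega>. (incr m n i \<omega>)\<^sup>2)" "expectation (\<lambda>\<omega>. (incr m n i \<omega>)\<^sup>2) \<le> C"
proof -
  have sq: "(incr m n i \<omega>)\<^sup>2 = (psum (grid m n i) (grid m n (Suc i)) \<omega>)\<^sup>2 / real n" for \<omega>
    by (simp add: incr_def power_divide)
  show "integrable M (\<lambda>\<omega>. (incr m n i \<omega>)\<^sup>2)"
    unfolding sq by (simp add: psum_square_integrable)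
  have "gridlen m n i \<le> grid m n m"
    using grid_mono[of "Suc i" m m n] \<open>i < m\<close> by simp
  also have "\<dots> = n" using \<open>i < m\<close> by (simp add: grid_def)
  finally have "expectation (\<lambda>\<omega>. (psum (grid m n i) (grid m n (Suc i)) \<omega>)\<^sup>2) \<le> C * real n"
    using assms(1)[of "grid m n i" "gridlen m n i"] \<open>0 \<le> C\<close> unfolding grid_Suc[symmetric]
    by (elim order_trans) (simp add: mult_left_mono)
  then show "expectation (\<lambda>\<omega>. (incr m n i \<omega>)\<^sup>2) \<le> C"
    unfolding sq by (cases "n = 0") (simp_all add: divide_le_eq \<open>0 \<le> C\<close>)
qed

theorem incr_lipschitz_limit:
  assumes "brownian_motion N W" "0 < m" and B: "\<And>x. \<bar>G x\<bar> \<le> B"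
    and lip: "\<And>x y. \<bar>G x - G y\<bar> \<le> L * l1_dist {..<m} x y" and "0 \<le> L"
  shows "(\<lambda>n. expectation (\<lambda>\<omega>. G (\<lambda>i. incr m n i \<omega>)))
    \<longlonglongrightarrow> (\<integral>\<omega>. G (\<lambda>i. brownian_motion.W_incr W \<sigma> m i \<omega>) \<partial>N)"
proof -
  interpret N: brownian_motion N W by fact
  obtain C where C: "0 < C" "\<And>a N. expectation (\<lambda>\<omega>. (psum a (a + N) \<omega>)\<^sup>2) \<le> C * real N"
    using psum_moment_bound by blast
  have prob: "prob_space M" "prob_space N" by unfold_locales
  show ?thesis
  \<comment> \<open>\<open>C\<close> bounds the second moments of the block increments, and
    \<sigma>^2 those of the Brownian ones.\<close>
  proof (rule product_convergence_imp_lipschitz_convergence[where m = m and V = "max C (\<sigma>\<^sup>2)", OF prob _ _ _ _ _ _ _ B lip \<open>0 \<le> L\<close>])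
    fix f :: "nat \<Rightarrow> real \<Rightarrow> real" and A :: real
    assume f: "0 \<le> A" "\<And>i u. 0 \<le> f i u" "\<And>i u. f i u \<le> 1" "\<And>i u v. \<bar>f i u - f i v\<bar> \<le> A * \<bar>u - v\<bar>"
    have "f i \<in> borel_measurable borel" for i
    proof (rule borel_measurable_continuous_onI)
      have "A-lipschitz_on UNIV (f i)" using f by (intro lipschitz_onI) (auto simp: dist_real_def)
      then show "continuous_on UNIV (f i)" by (rule lipschitz_on_continuous_on)
    qed
    then show "(\<lambda>n. expectation (\<lambda>\<omega>. \<Prod>i<m. f i (incr m n i \<omega>))) \<longlonglongrightarrow> N.expectation (\<lambda>\<omega>. \<Prod>i<m. f i (N.W_incr \<sigma> m i \<omega>))"
      using N.W_incr_product[OF \<open>0 < m\<close>, of f \<sigma>] incr_product_limit[OF \<open>0 < m\<close> f] f by simp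
  qed (use incr_square[OF C(2) less_imp_le[OF C(1)]] N.W_incr_square N.W_incr_measurable in
      \<open>auto intro: max.coboundedI1 max.coboundedI2\<close>)
qed

text \<open>At time \<open>t\<close> the process has reached index
  \<open>\<lfloor>n * t\<rfloor>\<close>, which lies in the block numbered
  \<open>\<lfloor>m * t\<rfloor>\<close>. The two paths differ by the sum from the start of that
  block to this index.\<close>

lemma dist_scaled_partial_sums_step_le:
  assumes "0 < m" "0 < n" and max: "\<And>i. i < m \<Longrightarrow> block_max n (grid m n i) (gridlen m n i) \<omega> \<le> e" and "0 \<le> e"
  shows "dist (to_skorohod (scaled_partial_sums X n \<omega>)) (step m (cumulate (\<lambda>i. incr m n i \<omega>))) \<le> e"
  unfolding step_def
proof (intro dist_to_skorohod_le cadlag_step cadlag_scaled_partial_sums)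
  fix t :: real assume t: "t \<in> {0..1}"
  let ?i = "nat \<lfloor>real m * t\<rfloor>" and ?k = "nat \<lfloor>real n * t\<rfloor>"
  have Y: "scaled_partial_sums X n \<omega> t = psum 0 ?k \<omega> / sqrt n"
    by (simp add: scaled_partial_sums_def psum_def atLeastSucAtMost_greaterThanAtMost)
  have cum: "cumulate (\<lambda>i. incr m n i \<omega>) i = psum 0 (grid m n i) \<omega> / sqrt n" for i
  proof (induction i)
    case (Suc i)
    then show ?case
      using psum_split[of 0 "grid m n i" "grid m n (Suc i)" \<omega>] grid_mono[of i "Suc i" m n]
      by (simp add: cumulate_def incr_def add_divide_distrib)
  qed (simp add: cumulate_def psum_def)
  have i: "real ?i \<le> real m * t" "real m * t < real ?i + 1" "?i \<le> m"
    using t nat_floor_grid_le by auto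
  have k: "real ?k \<le> real n * t" "?k \<le> n"
    using t nat_floor_grid_le by auto
  have "real (grid m n ?i) * real m \<le> real n * real ?i"
    unfolding grid_def of_nat_mult[symmetric] of_nat_le_iff by (rule div_times_less_eq_dividend)
  also have "\<dots> \<le> real n * (real m * t)" using i(1) by (intro mult_left_mono) auto
  finally have "real (grid m n ?i) \<le> real n * t" using \<open>0 < m\<close> by (simp add: mult_ac)
  then have le: "grid m n ?i \<le> ?k" by (rule le_nat_floor)
  show "\<bar>scaled_partial_sums X n \<omega> t - cumulate (\<lambda>i. incr m n i \<omega>) ?i\<bar> \<le> e"
  proof (cases "?i < m")
    case True
    have "real ?k * real m \<le> (real n * t) * real m" using k(1) by (intro mult_right_mono) auto
    also have "\<dots> = real n * (real m * t)" by simp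
    also have "\<dots> \<le> real n * (real ?i + 1)" using i(2) by (intro mult_left_mono) auto
    finally have "real (?k * m) \<le> real (n * Suc ?i)" by (simp add: algebra_simps)
    then have "?k * m \<le> n * Suc ?i" unfolding of_nat_le_iff .
    then have "?k \<le> grid m n (Suc ?i)"
      unfolding grid_def using \<open>0 < m\<close> by (simp add: less_eq_div_iff_mult_less_eq)
    then have "?k - grid m n ?i \<le> gridlen m n ?i" by (rule diff_le_mono)
    then have "\<bar>psum (grid m n ?i) ?k \<omega> / sqrt n\<bar> \<le> block_max n (grid m n ?i) (gridlen m n ?i) \<omega>"
      unfolding block_max_def
      using abs_le_runmax[of "?k - grid m n ?i" "gridlen m n ?i" "\<lambda>k. psum (grid m n ?i) (grid m n ?i + k) \<omega> / sqrt n"] le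
      by simp
    then show ?thesis
      using max[OF True] psum_split[of 0 "grid m n ?i" ?k \<omega>] le
      unfolding Y cum by (simp add: add_divide_distrib)
  next
    \<comment> \<open>This is the time \<open>t = 1\<close>: there is no block with number
      \<open>m\<close>, but both paths have reached the full sum.\<close>
    case False
    then have "?i = m" using i(3) by simp
    then have "grid m n ?i = n" using \<open>0 < m\<close> by (simp add: grid_def)
    then have "grid m n ?i = ?k" using le k(2) by simp
    then show ?thesis unfolding Y cum using \<open>0 \<le> e\<close> by simp
  qed
qed

theorem donsker:
  assumes "brownian_motion N W"
  shows "converges_in_distribution M (\<lambda>n \<omega>. to_skorohod (scaled_partial_sums X n \<omega>))
    N (\<lambda>\<omega>. to_skorohod (\<lambda>t. \<sigma> * W t \<omega>))"
proof (rule converges_in_distribution_lipschitzI)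
  interpret N: brownian_motion N W by fact
  show "prob_space M" "prob_space N" by unfold_locales
  show Z: "(\<lambda>\<omega>. to_skorohod (\<lambda>t. \<sigma> * W t \<omega>)) \<in> borel_measurable N"
    by (rule N.brownian_path_measurable)
  show Y: "(\<lambda>\<omega>. to_skorohod (scaled_partial_sums X n \<omega>)) \<in> borel_measurable M" for n
    by (rule scaled_partial_sums_measurable) (rule rv)
  fix F :: "skorohod \<Rightarrow> real" and L B :: real
  assume L: "0 \<le> L" "\<And>x y. \<bar>F x - F y\<bar> \<le> L * dist x y" and B: "\<And>x. \<bar>F x\<bar> \<le> B" and F [measurable]: "F \<in> borel_measurable borel"
  have "L-lipschitz_on UNIV F" using L by (intro lipschitz_onI) (auto simp: dist_real_def)
  then have cont: "continuous_on UNIV F" by (rule lipschitz_on_continuous_on)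
  have B0: "0 \<le> B" using B[of undefined] by linarith
  let ?E = "\<lambda>n. expectation (\<lambda>\<omega>. F (to_skorohod (scaled_partial_sums X n \<omega>)))"
    and ?E' = "\<lambda>m n. expectation (\<lambda>\<omega>. F (step m (cumulate (\<lambda>i. incr m n i \<omega>))))"
    and ?Z = "N.expectation (\<lambda>\<omega>. F (to_skorohod (\<lambda>t. \<sigma> * W t \<omega>)))"
    and ?Z' = "\<lambda>m. N.expectation (\<lambda>\<omega>. F (step m (cumulate (\<lambda>i. N.W_incr \<sigma> m i \<omega>))))"
  show "?E \<longlonglongrightarrow> ?Z"
  proof (rule tendstoI)
    fix e :: real assume "0 < e"
    \<comment> \<open>The block maxima are controlled up to \<open>3 * l\<close>, where the ramp
      reaches 1; hence 12 = 3 * 4. The other three quarters of \<open>e\<close> go to the ramps, to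
      the convergence of the increments and to the Brownian discretisation.\<close>
    define l where "l = e / (12 * (L + 1))"
    have l: "0 < l" "L * (3 * l) \<le> e / 4" using \<open>0 < e\<close> L(1) by (auto simp: l_def divide_simps)
    have "0 < e / (8 * (B + 1))" using \<open>0 < e\<close> B0 by simp
    from tightness[OF l(1) this] tendstoD[OF N.brownian_step_limit[OF cont B, of \<sigma>], of "e / 4"] eventually_gt_at_top[of 0]
    have "\<forall>\<^sub>F m in sequentially. (\<forall>\<^sub>F n in sequentially.
        (\<Sum>i<m. expectation (\<lambda>\<omega>. ramp (block_max n (grid m n i) (gridlen m n i) \<omega> / l - 2))) < e / (8 * (B + 1)))
        \<and> dist (?Z' m) ?Z < e / 4 \<and> 0 < m"
      using \<open>0 < e\<close> by (intro eventually_conj) simp_all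
    then obtain m where m: "\<forall>\<^sub>F n in sequentially.
        (\<Sum>i<m. expectation (\<lambda>\<omega>. ramp (block_max n (grid m n i) (gridlen m n i) \<omega> / l - 2))) < e / (8 * (B + 1))"
      "dist (?Z' m) ?Z < e / 4" "0 < m"
      using eventually_happens'[OF sequentially_bot] by blast
    have "\<bar>F (step m (cumulate x)) - F (step m (cumulate y))\<bar> \<le> L * l1_dist {..<m} x y" for x y
      by (rule order_trans[OF L(2) mult_left_mono[OF dist_step_cumulate_le L(1)]])
    from incr_lipschitz_limit[OF assms m(3) B this L(1)]
    have "\<forall>\<^sub>F n in sequentially. dist (?E' m n) (?Z' m) < e / 4"
      using \<open>0 < e\<close> by (intro tendstoD) simp_all
    with m(1) eventually_gt_at_top[of 0]
    show "\<forall>\<^sub>F n in sequentially. dist (?E n) ?Z < e"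
    proof eventually_elim
      case (elim n)
      let ?Y = "\<lambda>\<omega>. F (to_skorohod (scaled_partial_sums X n \<omega>))" and ?S = "\<lambda>\<omega>. F (step m (cumulate (\<lambda>i. incr m n i \<omega>)))"
      let ?r = "\<lambda>i \<omega>. ramp (block_max n (grid m n i) (gridlen m n i) \<omega> / l - 2)"
      have mS: "(\<lambda>\<omega>. step m (cumulate (\<lambda>i. incr m n i \<omega>))) \<in> borel_measurable M"
      proof -
        have "(\<lambda>\<omega> k. \<Sum>i<k. incr m n i \<omega>) \<in> borel_measurable M"
          by (intro measurable_coordinatewise_then_product) measurable
        from measurable_compose[OF this step_measurable] show ?thesis
          by (simp add: cumulate_def[abs_def])
      qed
      have int: "integrable M ?Y" "integrable M ?S" "integrable M (?r i)" for i
        using measurable_compose[OF Y F] measurable_compose[OF mS F] B ramp_bounds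
        by (auto intro!: integrable_const_bound[of _ B] integrable_const_bound[of "?r i" 1])
      \<comment> \<open>Either all block maxima are at most \<open>3 * l\<close> and the Lipschitz
        bound applies, or some ramp equals 1 and pays for the trivial bound
        \<open>2 * B\<close>.\<close>
      have "\<bar>?Y \<omega> - ?S \<omega>\<bar> \<le> L * (3 * l) + 2 * B * (\<Sum>i<m. ?r i \<omega>)" for \<omega>
      proof (cases "\<forall>i<m. block_max n (grid m n i) (gridlen m n i) \<omega> \<le> 3 * l")
        case True
        have "\<bar>?Y \<omega> - ?S \<omega>\<bar> \<le> L * (3 * l)"
          by (rule order_trans[OF L(2) mult_left_mono[OF dist_scaled_partial_sums_step_le L(1)]])
             (use True m(3) elim l(1) in auto)
        moreover have "0 \<le> 2 * B * (\<Sum>i<m. ?r i \<omega>)"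
          using B0 by (intro mult_nonneg_nonneg sum_nonneg ramp_bounds) auto
        ultimately show ?thesis by linarith
      next
        case False
        then obtain i where i: "i < m" "3 * l < block_max n (grid m n i) (gridlen m n i) \<omega>" by force
        then have "1 < block_max n (grid m n i) (gridlen m n i) \<omega> / l - 2"
          using l(1) by (simp add: less_diff_eq less_divide_eq)
        then have "?r i \<omega> = 1" by (simp add: ramp_def)
        with i(1) have "1 \<le> (\<Sum>i<m. ?r i \<omega>)"
          using member_le_sum[of i "{..<m}" "\<lambda>i. ?r i \<omega>"] ramp_bounds by simp
        then have "2 * B \<le> 2 * B * (\<Sum>i<m. ?r i \<omega>)"
          using B0 mult_left_mono[of 1 "\<Sum>i<m. ?r i \<omega>" "2 * B"] by simp
        moreover have "\<bar>?Y \<omega> - ?S \<omega>\<bar> \<le> 2 * B"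
          using B[of "to_skorohod (scaled_partial_sums X n \<omega>)"] B[of "step m (cumulate (\<lambda>i. incr m n i \<omega>))"] by linarith
        moreover have "0 \<le> L * (3 * l)" using L(1) l(1) by simp
        ultimately show ?thesis by linarith
      qed
      then have "expectation (\<lambda>\<omega>. \<bar>?Y \<omega> - ?S \<omega>\<bar>) \<le> expectation (\<lambda>\<omega>. L * (3 * l) + 2 * B * (\<Sum>i<m. ?r i \<omega>))"
        by (intro integral_mono integrable_abs Bochner_Integration.integrable_diff Bochner_Integration.integrable_add
              integrable_mult_right Bochner_Integration.integrable_sum int) simp_all
      also have "\<dots> = L * (3 * l) + 2 * B * (\<Sum>i<m. expectation (?r i))"
        by (simp add: int prob_space Bochner_Integration.integral_sum)
      also have "2 * B * (\<Sum>i<m. expectation (?r i)) \<le> 2 * B * (e / (8 * (B + 1)))"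
        using elim B0 by (intro mult_left_mono) auto
      also have "\<dots> \<le> e / 4" using \<open>0 < e\<close> B0 by (simp add: divide_simps)
      finally have "expectation (\<lambda>\<omega>. \<bar>?Y \<omega> - ?S \<omega>\<bar>) \<le> L * (3 * l) + e / 4" by simp
      moreover have "\<bar>?E n - ?E' m n\<bar> \<le> expectation (\<lambda>\<omega>. \<bar>?Y \<omega> - ?S \<omega>\<bar>)"
        using integral_abs_bound[of M "\<lambda>\<omega>. ?Y \<omega> - ?S \<omega>"] int by simp
      ultimately show ?case
        using l(2) m(2) elim unfolding dist_real_def by linarith
    qed
  qed
qed

end

theorem theorem16:
  fixes M :: "'a measure" and X :: "nat \<Rightarrow> 'a \<Rightarrow> real"
    and \<gamma> :: "nat \<Rightarrow> real" and \<delta> \<sigma> :: real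
    and N :: "'b measure" and W :: "real \<Rightarrow> 'b \<Rightarrow> real"
  assumes "prob_space M"
    and random_variables: "\<And>n. n \<ge> 1 \<Longrightarrow> X n \<in> borel_measurable M"
    and centered: "\<And>n. n \<ge> 1 \<Longrightarrow> integrable M (X n) \<and> (\<integral>\<omega>. X n \<omega> \<partial>M) = 0"
    and weakly_dependent: "L_weakly_dependent M X \<gamma>"
    and stationary: "strictly_stationary M X"
    and "\<delta> > 0"
    and moment: "integrable M (\<lambda>\<omega>. \<bar>X 1 \<omega>\<bar> powr (4 + \<delta>))"
    and "\<sigma> > 0"
    and variance: "(\<lambda>n. (\<integral>\<omega>. (\<Sum>j = 1..n. X j \<omega>)\<^sup>2 \<partial>M) / real n) \<longlonglongrightarrow> \<sigma>\<^sup>2"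
    and decreasing: "antimono_on {1..} \<gamma>"
    and decay: "\<gamma> \<in> O(\<lambda>k. real k powr (- 2 - 8 / \<delta>))"
    and brownian_motion: "standard_brownian_motion N W"
  shows "converges_in_distribution
    M (\<lambda>n \<omega>. to_skorohod (scaled_partial_sums X n \<omega>))
    N (\<lambda>\<omega>. to_skorohod (\<lambda>t. \<sigma> * W t \<omega>))"
proof -
  interpret prob_space M by fact
  have "stationary_L_weakly_dependent M X \<gamma> \<sigma>"
  proof unfold_locales
    show "integrable M (\<lambda>\<omega>. (X 1 \<omega>)\<^sup>2)"
    proof (rule Bochner_Integration.integrable_bound)
      show "integrable M (\<lambda>\<omega>. 1 + \<bar>X 1 \<omega>\<bar> powr (4 + \<delta>))" using moment by simp
      show "(\<lambda>\<omega>. (X 1 \<omega>)\<^sup>2) \<in> borel_measurable M" using random_variables[of 1] by simp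
      have "x\<^sup>2 \<le> 1 + \<bar>x\<bar> powr (4 + \<delta>)" for x :: real
      proof (cases "\<bar>x\<bar> \<le> 1")
        case True
        then have "x\<^sup>2 \<le> 1" by (simp add: abs_square_le_1)
        moreover have "0 \<le> \<bar>x\<bar> powr (4 + \<delta>)" by simp
        ultimately show ?thesis by linarith
      next
        case False
        then have "\<bar>x\<bar> powr 2 \<le> \<bar>x\<bar> powr (4 + \<delta>)" using \<open>\<delta> > 0\<close> by (intro powr_mono) auto
        then show ?thesis using False by simp
      qed
      then show "AE \<omega> in M. norm ((X 1 \<omega>)\<^sup>2) \<le> norm (1 + \<bar>X 1 \<omega>\<bar> powr (4 + \<delta>))"
        by (intro AE_I2) simp
    qed
    \<comment> \<open>Weighting by \<open>k\<close> raises the exponent to -1 - 8 / \<delta>, which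
      is still below -1.\<close>
    show "summable (\<lambda>k. real (Suc k) * \<gamma> (Suc k))"
    proof -
      have "(\<lambda>k. real k * \<gamma> k) \<in> O(\<lambda>k. real k * real k powr (- 2 - 8 / \<delta>))"
        by (intro landau_o.big.mult decay) simp
      also have "O(\<lambda>k. real k * real k powr (- 2 - 8 / \<delta>)) = O(\<lambda>k. real k powr (- 1 - 8 / \<delta>))"
      proof (rule landau_o.big.cong)
        show "\<forall>\<^sub>F k in sequentially. real k * real k powr (- 2 - 8 / \<delta>) = real k powr (- 1 - 8 / \<delta>)"
          using eventually_gt_at_top[of 0]
        proof eventually_elim
          case (elim k)
          have "real k * real k powr (- 2 - 8 / \<delta>) = real k powr (1 + (- 2 - 8 / \<delta>))"
            using elim by (subst powr_add) simp
          then show ?case by simp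
        qed
      qed
      finally have bigo: "(\<lambda>k. real k * \<gamma> k) \<in> O(\<lambda>k. real k powr (- 1 - 8 / \<delta>))" .
      have "summable (\<lambda>k. real k powr (- 1 - 8 / \<delta>))"
        using \<open>\<delta> > 0\<close> by (subst summable_real_powr_iff) simp
      then have "summable (\<lambda>k. norm (real k powr (- 1 - 8 / \<delta>)))" by simp
      then have "summable (\<lambda>k. real k * \<gamma> k)" using bigo by (rule summable_comparison_test_bigo)
      then show ?thesis by (rule summable_Suc_iff[THEN iffD2])
    qed
  qed (use assms in auto)
  moreover have "brownian_motion N W"
    using brownian_motion
    by (simp add: brownian_motion_def brownian_motion_axioms_def standard_brownian_motion_def)
  ultimately show ?thesis by (rule stationary_L_weakly_dependent.donsker)
qed

end
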